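(* Let $A/B$ be a depth two (D2) ring extension such that the natural right $B$-module $A_B$ is a progenerator and such that $A/B$ is a Procesi extension, i.e. $BR = A$ where $R = C_A(B)$ is the centralizer of $B$ in $A$. Let $\mathcal{T} = (T,\Delta,\varepsilon)$ be the $R$-coring with $T=(A\otimes_B A)^B$ described in the context. Then $A/B$ is a Frobenius extension if and only if $\mathcal{T}$ is a Frobenius coring.
   Context: Rings are associative and unital; $B$ is a unital subring of $A$. $BR$ denotes the set of finite sums $\sum_i b_ir_i$ with $b_i\in B$, $r_i\in R$. Depth two: $A/B$ is D2 if $A\otimes_B A$ is isomorphic to a direct summand of a finite direct sum $A \oplus\cdots\oplus A$ as $B$-$A$-bimodules and also as $A$-$B$-bimodules (natural bimodule structures). Put $S := \mathrm{End}({}_BA_B)$ and $T := (A\otimes_B A)^B=\{t : bt=tb\ \forall b\in B\}$. Equivalently, there are finitely many $\beta_i\in S$, $t_i\in T$ with $a\otimes a' = \sum_i t_i\beta_i(a)a'$, and finitely many $\gamma_j\in S$, $u_j\in T$ with $a\otimes a' = \sum_j a\gamma_j(a')u_j$, for all $a,a'\in A$. Coring: for a ring $R'$, an $R'$-coring is an $R'$-$R'$-bimodule $\mathcal{C}$ with $R'$-$R'$-bimodule maps $\Delta:\mathcal{C}\to\mathcal{C}\otimes_{R'}\mathcal{C}$ (coassociative, written $\Delta(c) = c_{(1)}\otimes c_{(2)}$) and $\varepsilon:\mathcal{C}\to R'$ (counit). The $R$-coring $\mathcal{T}$: the bimodule structure on $T$ is $r\cdot t\cdot r' = rt^1\otimes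 t^2r'$ for $t = t^1\otimes t^2\in T$ (summation suppressed). The coproduct is $\Delta(t) = \sum_i t_i\otimes_R(\beta_i(t^1)\otimes_B t^2) = \sum_j (t^1\otimes_B\gamma_j(t^2))\otimes_R u_j$; equivalently, under the isomorphism $T\otimes_R T\cong (A\otimes_BA\otimes_BA)^B$, $t\otimes t'\mapsto t^1\otimes t^2t'^1\otimes t'^2$, it is $\Delta(t) = t^1\otimes 1\otimes t^2$. The counit is $\varepsilon(t) = t^1t^2$. An $R'$-coring $\mathcal{C}$ is Frobenius if there are an $R'$-$R'$-bimodule homomorphism $\gamma:\mathcal{C}\otimes_{R'}\mathcal{C}\to R'$ and an element $e\in\mathcal{C}^{R'}=\{c : rc=cr\ \forall r\in R'\}$ such that $\gamma(c\otimes e) = \varepsilon(c) = \gamma(e\otimes c)$ and $\gamma(c\otimes c'_{(1)})c'_{(2)} = c_{(1)}\gamma(c_{(2)}\otimes c')$ for all $c,c'\in\mathcal{C}$. $A/B$ is a Frobenius extension if there are a $B$-$B$-bimodule homomorphism $E:A\to B$ and $e = e^1\otimes e^2\in A\otimes_B A$ (summation suppressed) with $ae=ea$ and $a = e^1E(e^2a) = E(ae^1)e^2$ for all $a\in A$. *)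

theory Defs
  imports "HOL-Algebra.IntRing" "HOL-Algebra.Subrings" "HOL-Algebra.Free_Abelian_Groups"
begin

section \<open>Bimodules over noncommutative rings\<close>

text \<open>As in \<^theory>\<open>HOL-Algebra.Module\<close>, the additive group of a (bi)module is kept in a ring
  record; the multiplicative fields \<open>mult\<close> and \<open>one\<close> are never used.  The scalar rings are not part
  of the record, so that restricting scalars to a subring does not change the record.\<close>

record ('r, 's, 'm) bimodule = "'m ring" +
  lact :: "'r \<Rightarrow> 'm \<Rightarrow> 'm"
  ract :: "'m \<Rightarrow> 's \<Rightarrow> 'm"

locale bimodule = R?: ring R + S?: ring S + M?: abelian_group M
  for R :: "('r, 'x) ring_scheme" (structure)
  and S :: "('s, 'y) ring_scheme" (structure)
  and M :: "('r, 's, 'm, 'z) bimodule_scheme" (structure) +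
  assumes lact_closed: "r \<in> carrier R \<Longrightarrow> m \<in> carrier M \<Longrightarrow> lact M r m \<in> carrier M"
    and lact_add: "r \<in> carrier R \<Longrightarrow> m \<in> carrier M \<Longrightarrow> m' \<in> carrier M \<Longrightarrow>
      lact M r (m \<oplus>\<^bsub>M\<^esub> m') = lact M r m \<oplus>\<^bsub>M\<^esub> lact M r m'"
    and add_lact: "r \<in> carrier R \<Longrightarrow> r' \<in> carrier R \<Longrightarrow> m \<in> carrier M \<Longrightarrow>
      lact M (r \<oplus>\<^bsub>R\<^esub> r') m = lact M r m \<oplus>\<^bsub>M\<^esub> lact M r' m"
    and mult_lact: "r \<in> carrier R \<Longrightarrow> r' \<in> carrier R \<Longrightarrow> m \<in> carrier M \<Longrightarrow>
      lact M (r \<otimes>\<^bsub>R\<^esub> r') m = lact M r (lact M r' m)"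
    and one_lact: "m \<in> carrier M \<Longrightarrow> lact M \<one>\<^bsub>R\<^esub> m = m"
    and ract_closed: "m \<in> carrier M \<Longrightarrow> s \<in> carrier S \<Longrightarrow> ract M m s \<in> carrier M"
    and ract_add: "m \<in> carrier M \<Longrightarrow> m' \<in> carrier M \<Longrightarrow> s \<in> carrier S \<Longrightarrow>
      ract M (m \<oplus>\<^bsub>M\<^esub> m') s = ract M m s \<oplus>\<^bsub>M\<^esub> ract M m' s"
    and add_ract: "m \<in> carrier M \<Longrightarrow> s \<in> carrier S \<Longrightarrow> s' \<in> carrier S \<Longrightarrow>
      ract M m (s \<oplus>\<^bsub>S\<^esub> s') = ract M m s \<oplus>\<^bsub>M\<^esub> ract M m s'"
    and mult_ract: "m \<in> carrier M \<Longrightarrow> s \<in> carrier S \<Longrightarrow> s' \<in> carrier S \<Longrightarrow>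
      ract M m (s \<otimes>\<^bsub>S\<^esub> s') = ract M (ract M m s) s'"
    and one_ract: "m \<in> carrier M \<Longrightarrow> ract M m \<one>\<^bsub>S\<^esub> = m"
    and lact_ract: "r \<in> carrier R \<Longrightarrow> m \<in> carrier M \<Longrightarrow> s \<in> carrier S \<Longrightarrow>
      ract M (lact M r m) s = lact M r (ract M m s)"

definition bimodule_hom ::
  "('r, 'x) ring_scheme \<Rightarrow> ('s, 'y) ring_scheme \<Rightarrow>
    ('r, 's, 'm, 'u) bimodule_scheme \<Rightarrow> ('r, 's, 'n, 'v) bimodule_scheme \<Rightarrow> ('m \<Rightarrow> 'n) set"
  where "bimodule_hom R S M N = {f \<in> carrier M \<rightarrow> carrier N.
    (\<forall>m\<in>carrier M. \<forall>m'\<in>carrier M. f (m \<oplus>\<^bsub>M\<^esub> m') = f m \<oplus>\<^bsub>N\<^esub> f m') \<and>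
    (\<forall>r\<in>carrier R. \<forall>m\<in>carrier M. f (lact M r m) = lact N r (f m)) \<and>
    (\<forall>m\<in>carrier M. \<forall>s\<in>carrier S. f (ract M m s) = ract N (f m) s)}"

definition bimodule_isomorphic ::
  "('r, 'x) ring_scheme \<Rightarrow> ('s, 'y) ring_scheme \<Rightarrow>
    ('r, 's, 'm, 'u) bimodule_scheme \<Rightarrow> ('r, 's, 'n, 'v) bimodule_scheme \<Rightarrow> bool"
  where "bimodule_isomorphic R S M N \<longleftrightarrow>
    (\<exists>f \<in> bimodule_hom R S M N. bij_betw f (carrier M) (carrier N))"

definition subbimodule ::
  "('r, 'x) ring_scheme \<Rightarrow> ('s, 'y) ring_scheme \<Rightarrow>
    'm set \<Rightarrow> ('r, 's, 'm, 'u) bimodule_scheme \<Rightarrow> bool"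
  where "subbimodule R S P M \<longleftrightarrow> subgroup P (add_monoid M) \<and>
    (\<forall>r\<in>carrier R. \<forall>m\<in>P. lact M r m \<in> P) \<and> (\<forall>m\<in>P. \<forall>s\<in>carrier S. ract M m s \<in> P)"

text \<open>The finite direct sum \<open>M \<oplus> \<dots> \<oplus> M\<close> with \<open>n\<close> summands.\<close>

definition direct_power ::
  "nat \<Rightarrow> ('r, 's, 'm, 'u) bimodule_scheme \<Rightarrow> ('r, 's, nat \<Rightarrow> 'm) bimodule"
  where "direct_power n M =
    \<lparr>carrier = {..<n} \<rightarrow>\<^sub>E carrier M,
     monoid.mult = undefined, one = undefined,
     ring.zero = (\<lambda>i\<in>{..<n}. \<zero>\<^bsub>M\<^esub>),
     ring.add = (\<lambda>f g. \<lambda>i\<in>{..<n}. f i \<oplus>\<^bsub>M\<^esub> g i),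
     lact = (\<lambda>r f. \<lambda>i\<in>{..<n}. lact M r (f i)),
     ract = (\<lambda>f s. \<lambda>i\<in>{..<n}. ract M (f i) s)\<rparr>"

text \<open>\<open>M\<close> is isomorphic to a direct summand \<open>P\<close> of a finite direct sum of copies of \<open>N\<close>.\<close>

definition summand_of_power ::
  "('r, 'x) ring_scheme \<Rightarrow> ('s, 'y) ring_scheme \<Rightarrow>
    ('r, 's, 'm, 'u) bimodule_scheme \<Rightarrow> ('r, 's, 'n, 'v) bimodule_scheme \<Rightarrow> bool"
  where "summand_of_power R S M N \<longleftrightarrow> (\<exists>n P Q.
    subbimodule R S P (direct_power n N) \<and> subbimodule R S Q (direct_power n N) \<and>
    P \<inter> Q = {\<zero>\<^bsub>direct_power n N\<^esub>} \<and>
    P <+>\<^bsub>direct_power n N\<^esub> Q = carrier (direct_power n N) \<and>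
    bimodule_isomorphic R S M ((direct_power n N)\<lparr>carrier := P\<rparr>))"

text \<open>\<open>M\<^sup>B = {m. bm = mb for all b \<in> B}\<close>.\<close>

definition invariants :: "'r set \<Rightarrow> ('r, 'r, 'm, 'u) bimodule_scheme \<Rightarrow> 'm set"
  where "invariants B M = {m \<in> carrier M. \<forall>b\<in>B. lact M b m = ract M m b}"

text \<open>A ring as a bimodule over itself, and hence over any of its subrings.\<close>

definition regular_bimodule :: "('a, 'x) ring_scheme \<Rightarrow> ('a, 'a, 'a) bimodule"
  where "regular_bimodule A =
    \<lparr>carrier = carrier A, monoid.mult = monoid.mult A, one = one A, ring.zero = ring.zero A, ring.add = ring.add A,
     lact = monoid.mult A, ract = monoid.mult A\<rparr>"

text \<open>Right modules are encoded as bimodules with \<open>\<int>\<close> acting on the left by integer multiples.\<close>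

definition right_regular_module :: "('a, 'x) ring_scheme \<Rightarrow> (int, 'a, 'a) bimodule"
  where "right_regular_module A =
    \<lparr>carrier = carrier A, monoid.mult = monoid.mult A, one = one A, ring.zero = ring.zero A, ring.add = ring.add A,
     lact = (\<lambda>k a. add_pow A k a), ract = monoid.mult A\<rparr>"

text \<open>A progenerator is a finitely generated projective generator: \<open>M\<close> is a direct summand of
  some \<open>S\<^sup>n\<close>, and \<open>S\<close> is a direct summand of some \<open>M\<^sup>n\<close>.\<close>

definition right_progenerator ::
  "('s, 'y) ring_scheme \<Rightarrow> (int, 's, 'm, 'u) bimodule_scheme \<Rightarrow> bool"
  where "right_progenerator S M \<longleftrightarrow>
    summand_of_power \<Z> S M (right_regular_module S) \<and>
    summand_of_power \<Z> S (right_regular_module S) M"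


section \<open>Tensor products over a noncommutative ring\<close>

text \<open>\<open>M \<otimes>\<^sub>S N\<close> is the quotient of the free abelian group on \<open>M \<times> N\<close> by the bilinearity and
  \<open>S\<close>-balancing relations; its elements are cosets.\<close>

type_synonym ('m, 'n) tensor = "(('m \<times> 'n) \<Rightarrow>\<^sub>0 int) set"

abbreviation tensor_free ::
  "('r, 's, 'm, 'u) bimodule_scheme \<Rightarrow> ('s, 't, 'n, 'v) bimodule_scheme \<Rightarrow>
    (('m \<times> 'n) \<Rightarrow>\<^sub>0 int) monoid"
  where "tensor_free M N \<equiv> free_Abelian_group (carrier M \<times> carrier N)"

definition tensor_relations ::
  "('s, 'y) ring_scheme \<Rightarrow> ('r, 's, 'm, 'u) bimodule_scheme \<Rightarrow>
    ('s, 't, 'n, 'v) bimodule_scheme \<Rightarrow> ('m, 'n) tensor"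
  where "tensor_relations S M N = generate (tensor_free M N)
    ({frag_of (m \<oplus>\<^bsub>M\<^esub> m', n) - frag_of (m, n) - frag_of (m', n) | m m' n.
        m \<in> carrier M \<and> m' \<in> carrier M \<and> n \<in> carrier N} \<union>
     {frag_of (m, n \<oplus>\<^bsub>N\<^esub> n') - frag_of (m, n) - frag_of (m, n') | m n n'.
        m \<in> carrier M \<and> n \<in> carrier N \<and> n' \<in> carrier N} \<union>
     {frag_of (ract M m s, n) - frag_of (m, lact N s n) | m s n.
        m \<in> carrier M \<and> s \<in> carrier S \<and> n \<in> carrier N})"

definition tensor_elt ::
  "('s, 'y) ring_scheme \<Rightarrow> ('r, 's, 'm, 'u) bimodule_scheme \<Rightarrow>
    ('s, 't, 'n, 'v) bimodule_scheme \<Rightarrow> 'm \<Rightarrow> 'n \<Rightarrow> ('m, 'n) tensor"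
  where "tensor_elt S M N m n =
    tensor_relations S M N #>\<^bsub>tensor_free M N\<^esub> frag_of (m, n)"

definition tensor_group ::
  "('s, 'y) ring_scheme \<Rightarrow> ('r, 's, 'm, 'u) bimodule_scheme \<Rightarrow>
    ('s, 't, 'n, 'v) bimodule_scheme \<Rightarrow> ('m, 'n) tensor ring"
  where "tensor_group S M N = (let G = tensor_free M N Mod tensor_relations S M N in
    \<lparr>carrier = carrier G, monoid.mult = undefined, one = undefined,
     ring.zero = \<one>\<^bsub>G\<^esub>, ring.add = monoid.mult G\<rparr>)"

text \<open>The map \<open>\<Sum> m \<otimes> n \<mapsto> \<Sum> f m n\<close> from a tensor product to the abelian group \<open>P\<close>.  It is
  independent of the chosen representative whenever \<open>f\<close> is biadditive and balanced.\<close>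

definition tensor_lift ::
  "('p, 'z) ring_scheme \<Rightarrow> ('m \<Rightarrow> 'n \<Rightarrow> 'p) \<Rightarrow> ('m, 'n) tensor \<Rightarrow> 'p"
  where "tensor_lift P f w = (let c = (SOME c. c \<in> w) in
    \<Oplus>\<^bsub>P\<^esub>z\<in>Poly_Mapping.keys c. add_pow P (Poly_Mapping.lookup c z) (f (fst z) (snd z)))"

definition tensor_product ::
  "('s, 'y) ring_scheme \<Rightarrow> ('r, 's, 'm, 'u) bimodule_scheme \<Rightarrow>
    ('s, 't, 'n, 'v) bimodule_scheme \<Rightarrow> ('r, 't, ('m, 'n) tensor) bimodule"
  where "tensor_product S M N = ring.extend (tensor_group S M N)
    \<lparr>lact = (\<lambda>r. tensor_lift (tensor_group S M N) (\<lambda>m n. tensor_elt S M N (lact M r m) n)),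
     ract = (\<lambda>w t. tensor_lift (tensor_group S M N) (\<lambda>m n. tensor_elt S M N m (ract N n t)) w)\<rparr>"


section \<open>Corings\<close>

record ('r, 'c) coring = "('r, 'r, 'c) bimodule" +
  coprod :: "'c \<Rightarrow> ('c, 'c) tensor"
  counit :: "'c \<Rightarrow> 'r"

text \<open>In coassociativity, the right-hand side is the image of \<open>c\<^sub>(\<^sub>1\<^sub>) \<otimes> \<Delta> c\<^sub>(\<^sub>2\<^sub>)\<close> under
  \<open>C \<otimes> (C \<otimes> C) \<cong> (C \<otimes> C) \<otimes> C\<close>.\<close>

locale coring = bimodule R R C
  for R :: "('r, 'x) ring_scheme" (structure)
  and C :: "('r, 'c, 'z) coring_scheme" (structure) +
  assumes coprod_hom: "coprod C \<in> bimodule_hom R R C (tensor_product R C C)"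
    and counit_hom: "counit C \<in> bimodule_hom R R C (regular_bimodule R)"
    and coassoc: "c \<in> carrier C \<Longrightarrow>
      tensor_lift (tensor_product R (tensor_product R C C) C)
        (\<lambda>x y. tensor_elt R (tensor_product R C C) C (coprod C x) y) (coprod C c) =
      tensor_lift (tensor_product R (tensor_product R C C) C)
        (\<lambda>x y. tensor_lift (tensor_product R (tensor_product R C C) C)
          (\<lambda>y\<^sub>1 y\<^sub>2. tensor_elt R (tensor_product R C C) C (tensor_elt R C C x y\<^sub>1) y\<^sub>2)
          (coprod C y)) (coprod C c)"
    and counit_left: "c \<in> carrier C \<Longrightarrow>
      tensor_lift C (\<lambda>x y. lact C (counit C x) y) (coprod C c) = c"
    and counit_right: "c \<in> carrier C \<Longrightarrow>
      tensor_lift C (\<lambda>x y. ract C x (counit C y)) (coprod C c) = c"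

definition frobenius_coring :: "('r, 'x) ring_scheme \<Rightarrow> ('r, 'c, 'z) coring_scheme \<Rightarrow> bool"
  where "frobenius_coring R C \<longleftrightarrow> coring R C \<and>
    (\<exists>\<gamma> \<in> bimodule_hom R R (tensor_product R C C) (regular_bimodule R).
     \<exists>e \<in> invariants (carrier R) C.
      (\<forall>c\<in>carrier C. \<gamma> (tensor_elt R C C c e) = counit C c \<and>
        counit C c = \<gamma> (tensor_elt R C C e c)) \<and>
      (\<forall>c\<in>carrier C. \<forall>c'\<in>carrier C.
        tensor_lift C (\<lambda>c\<^sub>1' c\<^sub>2'. lact C (\<gamma> (tensor_elt R C C c c\<^sub>1')) c\<^sub>2') (coprod C c') =
        tensor_lift C (\<lambda>c\<^sub>1 c\<^sub>2. ract C c\<^sub>1 (\<gamma> (tensor_elt R C C c\<^sub>2 c'))) (coprod C c)))"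


section \<open>Ring extensions\<close>

text \<open>Throughout, \<open>B\<close> is the carrier of a unital subring of \<open>A\<close>.\<close>

abbreviation subring_of :: "('a, 'x) ring_scheme \<Rightarrow> 'a set \<Rightarrow> ('a, 'x) ring_scheme"
  where "subring_of A B \<equiv> A\<lparr>carrier := B\<rparr>"

definition centralizer :: "('a, 'x) ring_scheme \<Rightarrow> 'a set \<Rightarrow> 'a set"
  where "centralizer A B = {r \<in> carrier A. \<forall>b\<in>B. b \<otimes>\<^bsub>A\<^esub> r = r \<otimes>\<^bsub>A\<^esub> b}"

definition sums_of_products :: "('a, 'x) ring_scheme \<Rightarrow> 'a set \<Rightarrow> 'a set \<Rightarrow> 'a set"
  where "sums_of_products A B R =
    {\<Oplus>\<^bsub>A\<^esub>i\<in>{..<n}. b i \<otimes>\<^bsub>A\<^esub> r i | (n::nat) b r. b \<in> {..<n} \<rightarrow> B \<and> r \<in> {..<n} \<rightarrow> R}"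

definition procesi_extension :: "('a, 'x) ring_scheme \<Rightarrow> 'a set \<Rightarrow> bool"
  where "procesi_extension A B \<longleftrightarrow> sums_of_products A B (centralizer A B) = carrier A"

definition tensor_square :: "('a, 'x) ring_scheme \<Rightarrow> 'a set \<Rightarrow> ('a, 'a, ('a, 'a) tensor) bimodule"
  where "tensor_square A B =
    tensor_product (subring_of A B) (regular_bimodule A) (regular_bimodule A)"

definition tensor_square_elt :: "('a, 'x) ring_scheme \<Rightarrow> 'a set \<Rightarrow> 'a \<Rightarrow> 'a \<Rightarrow> ('a, 'a) tensor"
  where "tensor_square_elt A B =
    tensor_elt (subring_of A B) (regular_bimodule A) (regular_bimodule A)"

definition depth_two :: "('a, 'x) ring_scheme \<Rightarrow> 'a set \<Rightarrow> bool"
  where "depth_two A B \<longleftrightarrow>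
    summand_of_power (subring_of A B) A (tensor_square A B) (regular_bimodule A) \<and>
    summand_of_power A (subring_of A B) (tensor_square A B) (regular_bimodule A)"

definition frobenius_extension :: "('a, 'x) ring_scheme \<Rightarrow> 'a set \<Rightarrow> bool"
  where "frobenius_extension A B \<longleftrightarrow>
    (\<exists>E \<in> bimodule_hom (subring_of A B) (subring_of A B)
        (regular_bimodule A) (regular_bimodule (subring_of A B)).
     \<exists>e \<in> invariants (carrier A) (tensor_square A B).
      \<forall>a\<in>carrier A.
        a = tensor_lift A (\<lambda>x y. x \<otimes>\<^bsub>A\<^esub> E (y \<otimes>\<^bsub>A\<^esub> a)) e \<and>
        a = tensor_lift A (\<lambda>x y. E (a \<otimes>\<^bsub>A\<^esub> x) \<otimes>\<^bsub>A\<^esub> y) e)"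


section \<open>The coring of a depth two extension\<close>

definition centralizer_ring :: "('a, 'x) ring_scheme \<Rightarrow> 'a set \<Rightarrow> ('a, 'x) ring_scheme"
  where "centralizer_ring A B = subring_of A (centralizer A B)"

text \<open>\<open>T = (A \<otimes>\<^sub>B A)\<^sup>B\<close>, with \<open>r \<cdot> t \<cdot> r' = r t\<^sup>1 \<otimes> t\<^sup>2 r'\<close>.\<close>

definition T_bimodule :: "('a, 'x) ring_scheme \<Rightarrow> 'a set \<Rightarrow> ('a, 'a, ('a, 'a) tensor) bimodule"
  where "T_bimodule A B = (tensor_square A B)\<lparr>carrier := invariants B (tensor_square A B)\<rparr>"

text \<open>\<open>\<beta>\<^sub>i \<in> End(\<^sub>BA\<^sub>B)\<close> and \<open>t\<^sub>i \<in> T\<close>, \<open>i < n\<close>, with \<open>a \<otimes> a' = \<Sum>\<^sub>i t\<^sub>i \<beta>\<^sub>i(a) a'\<close>.\<close>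

definition D2_quasibase ::
  "('a, 'x) ring_scheme \<Rightarrow> 'a set \<Rightarrow> nat \<Rightarrow> (nat \<Rightarrow> ('a, 'a) tensor) \<Rightarrow> (nat \<Rightarrow> 'a \<Rightarrow> 'a) \<Rightarrow> bool"
  where "D2_quasibase A B n t \<beta> \<longleftrightarrow>
    t \<in> {..<n} \<rightarrow> carrier (T_bimodule A B) \<and>
    \<beta> \<in> {..<n} \<rightarrow> bimodule_hom (subring_of A B) (subring_of A B)
      (regular_bimodule A) (regular_bimodule A) \<and>
    (\<forall>a\<in>carrier A. \<forall>a'\<in>carrier A. tensor_square_elt A B a a' =
      (\<Oplus>\<^bsub>tensor_square A B\<^esub>i\<in>{..<n}. ract (tensor_square A B) (t i) (\<beta> i a \<otimes>\<^bsub>A\<^esub> a')))"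

text \<open>\<open>\<Delta>(t) = \<Sum>\<^sub>i t\<^sub>i \<otimes>\<^sub>R (\<beta>\<^sub>i(t\<^sup>1) \<otimes>\<^sub>B t\<^sup>2)\<close>.  A quasibase exists when \<open>A/B\<close> is depth two, and
  \<open>\<Delta>\<close> does not depend on which one is chosen.\<close>

definition T_coprod ::
  "('a, 'x) ring_scheme \<Rightarrow> 'a set \<Rightarrow> ('a, 'a) tensor \<Rightarrow> (('a, 'a) tensor, ('a, 'a) tensor) tensor"
  where "T_coprod A B u =
    (let (n, t, \<beta>) = (SOME (n, t, \<beta>). D2_quasibase A B n t \<beta>);
         R = centralizer_ring A B; T = T_bimodule A B
     in \<Oplus>\<^bsub>tensor_product R T T\<^esub>i\<in>{..<n}. tensor_elt R T T (t i)
          (tensor_lift (tensor_square A B) (\<lambda>x y. tensor_square_elt A B (\<beta> i x) y) u))"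

definition T_coring :: "('a, 'x) ring_scheme \<Rightarrow> 'a set \<Rightarrow> ('a, ('a, 'a) tensor) coring"
  where "T_coring A B = bimodule.extend (T_bimodule A B)
    \<lparr>coprod = T_coprod A B, counit = tensor_lift A (\<lambda>x y. x \<otimes>\<^bsub>A\<^esub> y)\<rparr>"

end

(*
  A left quasibase t_i, beta_i gives the expansion w = sum_i t_i beta_i(w^1) w^2 in the tensor square,
  and with it sum_i h(t_i^1) t_i^2 beta_i(x) \<otimes> y = h(x) \<otimes> y for every right B-linear h; all coring
  axioms and the Frobenius identities reduce to this. For a B-B-endomorphism f put
  <c, d> = c^1 f(c^2 d^1) d^2. The two sides of the Frobenius condition for this form are
  c^1 f(c^2 d^1) \<otimes> d^2 and c^1 \<otimes> f(c^2 d^1) d^2, so they agree as soon as f has values in B; this gives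
  a Frobenius coring from a Frobenius homomorphism f = E. Conversely, a form gamma on T \<otimes>_R T extends
  to the tensor square because T spans it as a left and as a right A-module. The extension is
  A-balanced because A = BR, hence it is of the form <c, d> for some f. The Frobenius condition
  now says f(a) \<otimes> 1 = 1 \<otimes> f(a), and since A_B is a generator this puts f(a) into B.
*)
theory Submission
  imports Defs
begin

section \<open>Additive maps and tensor products\<close>

text \<open>The coproduct comes from one left quasibase, so its formula shows right R-linearity but
  neither left R-linearity nor coassociativity. Both are proved by expanding factors in the t_i
  again: for v in T the coefficients beta_i(v^1) v^2 commute with B, hence lie in R and may cross
  the tensor sign over R, and the remaining sum collapses. In the converse, the values a gamma(x, y)
  a' on a x and y a' are forced, but such presentations are not unique. Expanding the first argument
  by a right quasibase and the second by a left one gives a formula without that choice. Elements of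
  B then pass through the middle because they commute with T and with the values of gamma, elements
  of R because gamma is balanced, and A = BR combines the two. Likewise e commutes with R by
  assumption and with B as an element of T, hence with A. The generator condition supplies right
  B-linear maps g_i from A to B and elements a_i with sum g_i(a_i) = 1. Applying g_i to the first
  leg of a_i f(a) \<otimes> 1 = a_i \<otimes> f(a) and multiplying the legs gives g_i(a_i f(a)) =
  g_i(a_i) f(a), and the sum over i lies in B.\<close>

definition additive_map :: "('m, 'x) ring_scheme \<Rightarrow> ('n, 'y) ring_scheme \<Rightarrow> ('m \<Rightarrow> 'n) \<Rightarrow> bool"
  where "additive_map M N f \<longleftrightarrow> f \<in> carrier M \<rightarrow> carrier N \<and>
    (\<forall>m\<in>carrier M. \<forall>m'\<in>carrier M. f (m \<oplus>\<^bsub>M\<^esub> m') = f m \<oplus>\<^bsub>N\<^esub> f m')"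

lemma additive_mapI:
  assumes "\<And>m. m \<in> carrier M \<Longrightarrow> f m \<in> carrier N"
    and "\<And>m m'. m \<in> carrier M \<Longrightarrow> m' \<in> carrier M \<Longrightarrow> f (m \<oplus>\<^bsub>M\<^esub> m') = f m \<oplus>\<^bsub>N\<^esub> f m'"
  shows "additive_map M N f"
  using assms unfolding additive_map_def by auto

lemma additive_map_closed: "additive_map M N f \<Longrightarrow> m \<in> carrier M \<Longrightarrow> f m \<in> carrier N"
  unfolding additive_map_def by auto

lemma additive_map_add:
  "additive_map M N f \<Longrightarrow> m \<in> carrier M \<Longrightarrow> m' \<in> carrier M \<Longrightarrow> f (m \<oplus>\<^bsub>M\<^esub> m') = f m \<oplus>\<^bsub>N\<^esub> f m'"
  unfolding additive_map_def by auto

lemmas additive_mapD = additive_map_closed additive_map_add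

lemma additive_map_zero:
  assumes "abelian_group M" "abelian_group N" "additive_map M N f"
  shows "f \<zero>\<^bsub>M\<^esub> = \<zero>\<^bsub>N\<^esub>"
proof -
  interpret M: abelian_group M by fact
  interpret N: abelian_group N by fact
  have "f \<zero>\<^bsub>M\<^esub> = f \<zero>\<^bsub>M\<^esub> \<oplus>\<^bsub>N\<^esub> f \<zero>\<^bsub>M\<^esub>"
    using additive_map_add[OF assms(3), of "\<zero>\<^bsub>M\<^esub>" "\<zero>\<^bsub>M\<^esub>"] by simp
  then show ?thesis
    using additive_map_closed[OF assms(3), of "\<zero>\<^bsub>M\<^esub>"] by (simp add: N.add.r_cancel_one')
qed

lemma additive_map_neg:
  assumes "abelian_group M" "abelian_group N" "additive_map M N f" "m \<in> carrier M"
  shows "f (\<ominus>\<^bsub>M\<^esub> m) = \<ominus>\<^bsub>N\<^esub> f m"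
proof -
  interpret M: abelian_group M by fact
  interpret N: abelian_group N by fact
  have "f (\<ominus>\<^bsub>M\<^esub> m) \<oplus>\<^bsub>N\<^esub> f m = \<zero>\<^bsub>N\<^esub>"
    using additive_map_add[OF assms(3), of "\<ominus>\<^bsub>M\<^esub> m" m] assms(4) additive_map_zero[OF assms(1-3)]
    by (simp add: M.l_neg)
  then show ?thesis
    using additive_map_closed[OF assms(3)] assms(4) by (simp add: N.minus_equality)
qed

lemma additive_map_finsum:
  assumes "abelian_group M" "abelian_group N" "additive_map M N f"
    and "finite I" "\<And>i. i \<in> I \<Longrightarrow> g i \<in> carrier M"
  shows "f (\<Oplus>\<^bsub>M\<^esub>i\<in>I. g i) = (\<Oplus>\<^bsub>N\<^esub>i\<in>I. f (g i))"
proof -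
  interpret M: abelian_group M by fact
  interpret N: abelian_group N by fact
  show ?thesis
    using assms(4,5)
  proof (induction I)
    case empty
    show ?case using additive_map_zero[OF assms(1-3)] by simp
  next
    case (insert i I)
    then have "f (g i \<oplus>\<^bsub>M\<^esub> (\<Oplus>\<^bsub>M\<^esub>i\<in>I. g i)) = f (g i) \<oplus>\<^bsub>N\<^esub> (\<Oplus>\<^bsub>N\<^esub>i\<in>I. f (g i))"
      by (subst additive_map_add[OF assms(3)]) auto
    then show ?case
      using insert.hyps insert.prems additive_map_closed[OF assms(3)]
      by (simp add: Pi_def)
  qed
qed

lemma additive_map_compose:
  "additive_map M N f \<Longrightarrow> additive_map N P g \<Longrightarrow> additive_map M P (\<lambda>m. g (f m))"
  unfolding additive_map_def by (simp add: Pi_iff)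

lemma additive_map_sum:
  assumes "abelian_group N" "finite I" "\<And>i. i \<in> I \<Longrightarrow> additive_map M N (f i)"
  shows "additive_map M N (\<lambda>m. \<Oplus>\<^bsub>N\<^esub>i\<in>I. f i m)"
proof -
  interpret N: abelian_group N by fact
  show ?thesis
  proof (rule additive_mapI)
    fix m assume "m \<in> carrier M"
    then show "(\<Oplus>\<^bsub>N\<^esub>i\<in>I. f i m) \<in> carrier N"
      using additive_map_closed[OF assms(3)] by auto
  next
    fix m m' assume m: "m \<in> carrier M" "m' \<in> carrier M"
    have "(\<Oplus>\<^bsub>N\<^esub>i\<in>I. f i (m \<oplus>\<^bsub>M\<^esub> m')) = (\<Oplus>\<^bsub>N\<^esub>i\<in>I. f i m \<oplus>\<^bsub>N\<^esub> f i m')"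
      using m assms(3) by (intro N.finsum_cong')
        (auto simp: additive_map_add intro!: N.a_closed dest: additive_map_closed)
    then show "(\<Oplus>\<^bsub>N\<^esub>i\<in>I. f i (m \<oplus>\<^bsub>M\<^esub> m')) = (\<Oplus>\<^bsub>N\<^esub>i\<in>I. f i m) \<oplus>\<^bsub>N\<^esub> (\<Oplus>\<^bsub>N\<^esub>i\<in>I. f i m')"
      using m additive_map_closed[OF assms(3)] by (simp add: N.finsum_addf Pi_def)
  qed
qed

lemma additive_map_plus:
  assumes "abelian_group N" "additive_map M N f" "additive_map M N g"
  shows "additive_map M N (\<lambda>m. f m \<oplus>\<^bsub>N\<^esub> g m)"
proof -
  interpret N: abelian_group N by fact
  have "(a \<oplus>\<^bsub>N\<^esub> b) \<oplus>\<^bsub>N\<^esub> (c \<oplus>\<^bsub>N\<^esub> d) = (a \<oplus>\<^bsub>N\<^esub> c) \<oplus>\<^bsub>N\<^esub> (b \<oplus>\<^bsub>N\<^esub> d)"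
    if "a \<in> carrier N" "b \<in> carrier N" "c \<in> carrier N" "d \<in> carrier N" for a b c d
    using that by (simp add: N.a_ac)
  with assms show ?thesis
    unfolding additive_map_def by (simp add: Pi_iff)
qed

lemma additive_map_id: "additive_map M M (\<lambda>m. m)"
  by (simp add: additive_map_def)

lemma (in abelian_group) finsum_swap:
  assumes "finite I" "finite J" "\<And>i j. i \<in> I \<Longrightarrow> j \<in> J \<Longrightarrow> f i j \<in> carrier G"
  shows "(\<Oplus>i\<in>I. \<Oplus>j\<in>J. f i j) = (\<Oplus>j\<in>J. \<Oplus>i\<in>I. f i j)"
  using assms(1,3)
proof (induction I)
  case (insert i I)
  then have "(\<Oplus>i\<in>insert i I. \<Oplus>j\<in>J. f i j) = (\<Oplus>j\<in>J. f i j) \<oplus> (\<Oplus>j\<in>J. \<Oplus>i\<in>I. f i j)"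
    by (subst finsum_insert) auto
  also have "\<dots> = (\<Oplus>j\<in>J. f i j \<oplus> (\<Oplus>i\<in>I. f i j))"
    using insert by (subst finsum_addf) auto
  also have "\<dots> = (\<Oplus>j\<in>J. \<Oplus>i\<in>insert i I. f i j)"
    using insert by (intro finsum_cong') auto
  finally show ?case .
qed auto

section \<open>Evaluation of elements of a free abelian group\<close>

definition free_sum :: "('p, 'z) ring_scheme \<Rightarrow> ('i \<Rightarrow> 'p) \<Rightarrow> ('i \<Rightarrow>\<^sub>0 int) \<Rightarrow> 'p"
  where "free_sum P f c = (\<Oplus>\<^bsub>P\<^esub>z\<in>Poly_Mapping.keys c. add_pow P (Poly_Mapping.lookup c z) (f z))"

context abelian_group
begin

lemma free_sum_superset:
  assumes "finite K" "Poly_Mapping.keys c \<subseteq> K" "f \<in> K \<rightarrow> carrier G"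
  shows "free_sum G f c = (\<Oplus>z\<in>K. add_pow G (Poly_Mapping.lookup c z) (f z))"
  unfolding free_sum_def
proof (rule add.finprod_mono_neutral_cong_left)
  have "add_pow G (0::int) x = \<zero>" for x by (simp add: add_pow_def)
  then show "\<And>i. i \<in> K - Poly_Mapping.keys c \<Longrightarrow> add_pow G (Poly_Mapping.lookup c i) (f i) = \<zero>"
    by (simp add: in_keys_iff)
qed (use assms in auto)

lemma free_sum_closed:
  "f \<in> X \<rightarrow> carrier G \<Longrightarrow> Poly_Mapping.keys c \<subseteq> X \<Longrightarrow> free_sum G f c \<in> carrier G"
  unfolding free_sum_def by (intro finsum_closed) auto

lemma free_sum_add:
  assumes "f \<in> X \<rightarrow> carrier G" "Poly_Mapping.keys c \<subseteq> X" "Poly_Mapping.keys d \<subseteq> X"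
  shows "free_sum G f (c + d) = free_sum G f c \<oplus> free_sum G f d"
proof -
  let ?K = "Poly_Mapping.keys c \<union> Poly_Mapping.keys d"
  have f: "f \<in> ?K \<rightarrow> carrier G" using assms by auto
  have "free_sum G f (c + d) = (\<Oplus>z\<in>?K. add_pow G (Poly_Mapping.lookup (c + d) z) (f z))"
    using f by (intro free_sum_superset) (auto simp: Poly_Mapping.keys_add)
  also have "\<dots> = (\<Oplus>z\<in>?K. add_pow G (Poly_Mapping.lookup c z) (f z) \<oplus>
      add_pow G (Poly_Mapping.lookup d z) (f z))"
    using f by (intro finsum_cong') (auto simp: lookup_add add.int_pow_mult Pi_def)
  also have "\<dots> = free_sum G f c \<oplus> free_sum G f d"
    using f free_sum_superset[of ?K c f] free_sum_superset[of ?K d f]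
    by (subst finsum_addf) (auto simp: Pi_def)
  finally show ?thesis .
qed

lemma free_sum_frag_of: "f z \<in> carrier G \<Longrightarrow> free_sum G f (frag_of z) = f z"
  unfolding free_sum_def by (simp add: finsum_singleton[of z "{z}", simplified] add.int_pow_1)

lemma free_sum_zero: "free_sum G f 0 = \<zero>"
  unfolding free_sum_def by simp

lemma free_sum_uminus:
  assumes "f \<in> X \<rightarrow> carrier G" "Poly_Mapping.keys c \<subseteq> X"
  shows "free_sum G f (- c) = \<ominus> free_sum G f c"
proof -
  have "free_sum G f (- c) \<oplus> free_sum G f c = \<zero>"
    using free_sum_add[OF assms(1), of "-c" c] assms(2) by (simp add: free_sum_zero)
  then show ?thesis
    using free_sum_closed[OF assms(1), of "-c"] free_sum_closed[OF assms(1), of c] assms(2)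
    by (simp add: minus_equality)
qed

end

section \<open>Balanced maps, the universal property of the tensor product and its bimodule
  structure\<close>

definition balanced_map ::
  "('s, 'y) ring_scheme \<Rightarrow> ('r, 's, 'm, 'u) bimodule_scheme \<Rightarrow>
    ('s, 't, 'n, 'v) bimodule_scheme \<Rightarrow> ('p, 'z) ring_scheme \<Rightarrow> ('m \<Rightarrow> 'n \<Rightarrow> 'p) \<Rightarrow> bool"
  where "balanced_map S M N P f \<longleftrightarrow>
    (\<forall>m\<in>carrier M. additive_map N P (f m)) \<and>
    (\<forall>n\<in>carrier N. additive_map M P (\<lambda>m. f m n)) \<and>
    (\<forall>m\<in>carrier M. \<forall>s\<in>carrier S. \<forall>n\<in>carrier N. f (ract M m s) n = f m (lact N s n))"

lemma balanced_mapI: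
  assumes "\<And>m. m \<in> carrier M \<Longrightarrow> additive_map N P (f m)"
    and "\<And>n. n \<in> carrier N \<Longrightarrow> additive_map M P (\<lambda>m. f m n)"
    and "\<And>m s n. m \<in> carrier M \<Longrightarrow> s \<in> carrier S \<Longrightarrow> n \<in> carrier N \<Longrightarrow>
      f (ract M m s) n = f m (lact N s n)"
  shows "balanced_map S M N P f"
  using assms unfolding balanced_map_def by auto

text \<open>One locale serves the three tensor products that occur: A \<otimes>_B A, T \<otimes>_R T
  and (T \<otimes>_R T) \<otimes>_R T.\<close>

locale tensor_factors =
  fixes R :: "('r, 'x) ring_scheme" and S :: "('s, 'y) ring_scheme" and T :: "('t, 'w) ring_scheme"
    and M :: "('r, 's, 'm, 'u) bimodule_scheme" and N :: "('s, 't, 'n, 'v) bimodule_scheme"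
  assumes left_factor: "bimodule R S M" and right_factor: "bimodule S T N"
begin

lemma ag: "abelian_group M" "abelian_group N"
  using left_factor right_factor by (auto simp: bimodule_def)

sublocale F: comm_group "tensor_free M N"
  by (rule abelian_free_Abelian_group)

abbreviation "rels \<equiv> tensor_relations S M N"
abbreviation "TG \<equiv> tensor_group S M N"
abbreviation "TP \<equiv> tensor_product S M N"
abbreviation elt (infixl \<open>\<boxtimes>\<close> 68) where "m \<boxtimes> n \<equiv> tensor_elt S M N m n"

lemma rels_subgroup: "subgroup rels (tensor_free M N)"
proof -
  interpret M: bimodule R S M by (rule left_factor)
  interpret N: bimodule S T N by (rule right_factor)
  have *: "a - b \<in> carrier (tensor_free M N)"
    if "a \<in> carrier (tensor_free M N)" "b \<in> carrier (tensor_free M N)" for a b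
    using that keys_diff[of a b] by auto
  have **: "frag_of (m, n) \<in> carrier (tensor_free M N)"
    if "m \<in> carrier M" "n \<in> carrier N" for m n
    using that by simp
  show ?thesis
    unfolding tensor_relations_def
    by (rule F.generate_is_subgroup, intro Un_least subsetI; clarify)
      (intro * **; simp add: M.ract_closed N.lact_closed)+
qed

sublocale Q: normal rels "tensor_free M N"
  by (rule F.subgroup_imp_normal[OF rels_subgroup])

lemma TG_simps:
  "carrier TG = carrier (tensor_free M N Mod rels)"
  "ring.zero TG = \<one>\<^bsub>tensor_free M N Mod rels\<^esub>" "ring.add TG = monoid.mult (tensor_free M N Mod rels)"
  by (simp_all add: tensor_group_def Let_def del: one_FactGroup mult_FactGroup)

lemma TP_simps:
  "carrier TP = carrier TG" "ring.zero TP = ring.zero TG" "ring.add TP = ring.add TG"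
  "lact TP = (\<lambda>r. tensor_lift TG (\<lambda>m n. lact M r m \<boxtimes> n))"
  "ract TP = (\<lambda>w t. tensor_lift TG (\<lambda>m n. m \<boxtimes> ract N n t) w)"
  by (simp_all add: tensor_product_def ring.extend_def)

lemma TG_abelian_group: "abelian_group TG"
proof -
  interpret G: comm_group "tensor_free M N Mod rels"
    by (rule F.abelian_FactGroup[OF rels_subgroup])
  show ?thesis
  proof (rule abelian_groupI, unfold TG_simps)
    fix x y z
    assume "x \<in> carrier (tensor_free M N Mod rels)" "y \<in> carrier (tensor_free M N Mod rels)"
      "z \<in> carrier (tensor_free M N Mod rels)"
    then show "x \<otimes>\<^bsub>tensor_free M N Mod rels\<^esub> y \<otimes>\<^bsub>tensor_free M N Mod rels\<^esub> z =
      x \<otimes>\<^bsub>tensor_free M N Mod rels\<^esub> (y \<otimes>\<^bsub>tensor_free M N Mod rels\<^esub> z)"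
      by (rule G.m_assoc)
  qed (fact G.m_closed G.one_closed G.m_comm G.l_one G.l_inv_ex)+
qed

sublocale TG: abelian_group TG
  by (rule TG_abelian_group)

lemma elt_closed: "m \<in> carrier M \<Longrightarrow> n \<in> carrier N \<Longrightarrow> m \<boxtimes> n \<in> carrier TG"
  by (auto simp: TG_simps tensor_elt_def carrier_FactGroup simp del: one_FactGroup mult_FactGroup)

lemma coset_add:
  assumes "c \<in> carrier (tensor_free M N)" "d \<in> carrier (tensor_free M N)"
  shows "(rels #>\<^bsub>tensor_free M N\<^esub> c) \<oplus>\<^bsub>TG\<^esub> (rels #>\<^bsub>tensor_free M N\<^esub> d) =
    rels #>\<^bsub>tensor_free M N\<^esub> (c + d)"
  using Q.rcos_sum[OF assms] by (simp add: TG_simps)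

lemma coset_eqI:
  assumes "c \<in> carrier (tensor_free M N)" "d \<in> carrier (tensor_free M N)" "c - d \<in> rels"
  shows "rels #>\<^bsub>tensor_free M N\<^esub> c = rels #>\<^bsub>tensor_free M N\<^esub> d"
proof -
  have "c \<in> rels #>\<^bsub>tensor_free M N\<^esub> d"
    using assms(3) unfolding r_coset_def by force
  then show ?thesis
    using F.repr_independence assms(2) rels_subgroup by metis
qed

lemma frag_of_carrier:
  "m \<in> carrier M \<Longrightarrow> n \<in> carrier N \<Longrightarrow> frag_of (m, n) \<in> carrier (tensor_free M N)"
  by simp

lemma elt_add_left:
  assumes "m \<in> carrier M" "m' \<in> carrier M" "n \<in> carrier N"
  shows "(m \<oplus>\<^bsub>M\<^esub> m') \<boxtimes> n = m \<boxtimes> n \<oplus>\<^bsub>TG\<^esub> m' \<boxtimes> n"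
proof -
  have c: "m \<oplus>\<^bsub>M\<^esub> m' \<in> carrier M"
    using assms ag by (simp add: abelian_groupE)
  have "frag_of (m \<oplus>\<^bsub>M\<^esub> m', n) - frag_of (m, n) - frag_of (m', n) \<in> rels"
    unfolding tensor_relations_def using assms by (intro generate.incl) blast
  then have "frag_of (m \<oplus>\<^bsub>M\<^esub> m', n) - (frag_of (m, n) + frag_of (m', n)) \<in> rels"
    by (simp add: algebra_simps)
  moreover have "frag_of (m, n) + frag_of (m', n) \<in> carrier (tensor_free M N)"
    using F.m_closed[OF frag_of_carrier frag_of_carrier, of m n m' n] assms
    by (simp only: mult_free_Abelian_group)
  ultimately show ?thesis
    unfolding tensor_elt_def coset_add[OF frag_of_carrier[OF assms(1,3)] frag_of_carrier[OF assms(2,3)]]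
    by (intro coset_eqI frag_of_carrier c assms)
qed

lemma elt_add_right:
  assumes "m \<in> carrier M" "n \<in> carrier N" "n' \<in> carrier N"
  shows "m \<boxtimes> (n \<oplus>\<^bsub>N\<^esub> n') = m \<boxtimes> n \<oplus>\<^bsub>TG\<^esub> m \<boxtimes> n'"
proof -
  have c: "n \<oplus>\<^bsub>N\<^esub> n' \<in> carrier N"
    using assms ag by (simp add: abelian_groupE)
  have "frag_of (m, n \<oplus>\<^bsub>N\<^esub> n') - frag_of (m, n) - frag_of (m, n') \<in> rels"
    unfolding tensor_relations_def using assms by (intro generate.incl) blast
  then have "frag_of (m, n \<oplus>\<^bsub>N\<^esub> n') - (frag_of (m, n) + frag_of (m, n')) \<in> rels"
    by (simp add: algebra_simps)
  moreover have "frag_of (m, n) + frag_of (m, n') \<in> carrier (tensor_free M N)"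
    using F.m_closed[OF frag_of_carrier frag_of_carrier, of m n m n'] assms
    by (simp only: mult_free_Abelian_group)
  ultimately show ?thesis
    unfolding tensor_elt_def coset_add[OF frag_of_carrier[OF assms(1,2)] frag_of_carrier[OF assms(1,3)]]
    by (intro coset_eqI frag_of_carrier c assms)
qed

lemma elt_balanced:
  assumes "m \<in> carrier M" "s \<in> carrier S" "n \<in> carrier N"
  shows "ract M m s \<boxtimes> n = m \<boxtimes> lact N s n"
proof -
  have c: "ract M m s \<in> carrier M" "lact N s n \<in> carrier N"
    using assms left_factor right_factor bimodule.ract_closed bimodule.lact_closed by metis+
  have "frag_of (ract M m s, n) - frag_of (m, lact N s n) \<in> rels"
    unfolding tensor_relations_def using assms by (intro generate.incl) blast
  then show ?thesis
    unfolding tensor_elt_def using assms c by (intro coset_eqI frag_of_carrier)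
qed

lemma balanced_map_elt: "balanced_map S M N TG (\<boxtimes>)"
  by (intro balanced_mapI additive_mapI elt_closed elt_add_left elt_add_right elt_balanced)

lemma elt_neg:
  assumes "m \<in> carrier M" "n \<in> carrier N"
  shows "(\<ominus>\<^bsub>M\<^esub> m) \<boxtimes> n = rels #>\<^bsub>tensor_free M N\<^esub> (- frag_of (m, n))"
proof -
  interpret M: abelian_group M by (rule ag)
  have ad: "additive_map M TG (\<lambda>m. m \<boxtimes> n)"
    using balanced_map_elt assms unfolding balanced_map_def by blast
  have 1: "(\<ominus>\<^bsub>M\<^esub> m) \<boxtimes> n \<oplus>\<^bsub>TG\<^esub> m \<boxtimes> n = \<zero>\<^bsub>TG\<^esub>"
    using additive_map_zero[OF ag(1) TG_abelian_group ad] elt_add_left[of "\<ominus>\<^bsub>M\<^esub> m" m n] assms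
    by (simp add: M.l_neg)
  have c: "- frag_of (m, n) \<in> carrier (tensor_free M N)"
    using F.inv_closed[OF frag_of_carrier[OF assms]] assms by simp
  have 2: "(rels #>\<^bsub>tensor_free M N\<^esub> (- frag_of (m, n))) \<oplus>\<^bsub>TG\<^esub> m \<boxtimes> n = \<zero>\<^bsub>TG\<^esub>"
    unfolding tensor_elt_def
    using assms rels_subgroup F.coset_mult_one[of rels]
    by (subst coset_add[OF c frag_of_carrier])
      (auto simp: TG_simps subgroup.subset)
  have "rels #>\<^bsub>tensor_free M N\<^esub> (- frag_of (m, n)) \<in> carrier TG"
    using c by (auto simp: TG_simps carrier_FactGroup)
  then show ?thesis
    using 1 2 assms by (metis TG.minus_equality elt_closed M.a_inv_closed TG.add.right_cancel)
qed

text \<open>Elements of a free abelian group arise from generators by differences, so the induction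
  carries a representative together with its negative. By \<open>elt_neg\<close> the coset of a
  negated generator is again a pure tensor, which is why the rule needs no case for
  negation.\<close>

lemma tensor_induct [consumes 1, case_names zero elt add]:
  assumes "w \<in> carrier TG"
    and zero: "Q \<zero>\<^bsub>TG\<^esub>"
    and elt: "\<And>m n. m \<in> carrier M \<Longrightarrow> n \<in> carrier N \<Longrightarrow> Q (m \<boxtimes> n)"
    and add: "\<And>v w. v \<in> carrier TG \<Longrightarrow> w \<in> carrier TG \<Longrightarrow> Q v \<Longrightarrow> Q w \<Longrightarrow> Q (v \<oplus>\<^bsub>TG\<^esub> w)"
  shows "Q w"
proof -
  interpret M: abelian_group M by (rule ag)
  obtain c where c: "c \<in> carrier (tensor_free M N)" and w: "w = rels #>\<^bsub>tensor_free M N\<^esub> c"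
    using assms(1) by (auto simp: TG_simps carrier_FactGroup)
  let ?q = "\<lambda>c. rels #>\<^bsub>tensor_free M N\<^esub> c"
  have cl: "?q c \<in> carrier TG" if "c \<in> carrier (tensor_free M N)" for c
    using that by (auto simp: TG_simps carrier_FactGroup)
  have neg: "Q (?q (- frag_of z))" if "z \<in> carrier M \<times> carrier N" for z
    using that elt[of "\<ominus>\<^bsub>M\<^esub> fst z" "snd z"] elt_neg[of "fst z" "snd z"] by auto
  have "Poly_Mapping.keys c \<subseteq> carrier M \<times> carrier N"
    using c by simp
  then have "c \<in> carrier (tensor_free M N) \<and> Q (?q c) \<and> Q (?q (- c))"
  proof (induction c rule: frag_induction)
    case zero
    then show ?case
      using assms(2) rels_subgroup F.coset_mult_one[of rels] by (auto simp: TG_simps subgroup.subset)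
  next
    case (one z)
    then show ?case using elt[of "fst z" "snd z"] neg[of z] by (auto simp: tensor_elt_def)
  next
    case (diff a b)
    have *: "d \<in> carrier (tensor_free M N) \<Longrightarrow> - d \<in> carrier (tensor_free M N)" for d
      using F.inv_closed[of d] by simp
    show ?case
      using diff add[of "?q a" "?q (- b)"] add[of "?q b" "?q (- a)"] *[of a] *[of b]
        coset_add[of a "- b"] coset_add[of b "- a"] F.m_closed[of a "- b"]
        cl[of a] cl[of b] cl[of "-a"] cl[of "-b"] by (simp del: carrier_free_Abelian_group_iff)
  qed
  then show ?thesis by (simp add: w)
qed

text \<open>Pure tensors generate the group, so additive maps can be compared on them. Almost every
  tensor identity below is proved by this rule or by one of its instances \<open>TP_ext\<close>,
  \<open>AA_ext\<close> and \<open>TT_ext\<close>.\<close>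

lemma additive_map_ext:
  assumes "additive_map TG P f" "additive_map TG P g" "abelian_group P"
    and "\<And>m n. m \<in> carrier M \<Longrightarrow> n \<in> carrier N \<Longrightarrow> f (m \<boxtimes> n) = g (m \<boxtimes> n)"
    and "w \<in> carrier TG"
  shows "f w = g w"
  using assms(5)
proof (induction w rule: tensor_induct)
  case zero
  then show ?case
    using additive_map_zero[OF TG_abelian_group assms(3)] assms(1,2) by metis
qed (use assms(1,2,4) in \<open>auto simp: additive_map_add\<close>)

context
  fixes P :: "('p, 'z) ring_scheme" and f :: "'m \<Rightarrow> 'n \<Rightarrow> 'p"
  assumes P: "abelian_group P" and f: "balanced_map S M N P f"
begin

interpretation P: abelian_group P by (rule P)

lemma balanced_closed: "m \<in> carrier M \<Longrightarrow> n \<in> carrier N \<Longrightarrow> f m n \<in> carrier P"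
  using f unfolding balanced_map_def additive_map_def by blast

lemma free_sum_rels:
  assumes "c \<in> rels"
  shows "free_sum P (\<lambda>z. f (fst z) (snd z)) c = \<zero>\<^bsub>P\<^esub>"
proof -
  interpret M: bimodule R S M by (rule left_factor)
  interpret N: bimodule S T N by (rule right_factor)
  let ?X = "carrier M \<times> carrier N" and ?s = "free_sum P (\<lambda>z. f (fst z) (snd z))"
  have fX: "(\<lambda>z. f (fst z) (snd z)) \<in> ?X \<rightarrow> carrier P"
    using balanced_closed by auto
  have diff: "?s (a - b) = ?s a \<ominus>\<^bsub>P\<^esub> ?s b \<and> Poly_Mapping.keys (a - b) \<subseteq> ?X"
    if "Poly_Mapping.keys a \<subseteq> ?X" "Poly_Mapping.keys b \<subseteq> ?X" for a b
    using P.free_sum_add[OF fX that(1), of "-b"] P.free_sum_uminus[OF fX that(2)] that keys_diff[of a b]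
    by (auto simp: a_minus_def)
  have s: "?s (frag_of (m, n)) = f m n" "Poly_Mapping.keys (frag_of (m, n)) \<subseteq> ?X"
    if "m \<in> carrier M" "n \<in> carrier N" for m n
    using that by (simp_all add: P.free_sum_frag_of balanced_closed)
  have z1: "x \<oplus>\<^bsub>P\<^esub> y \<ominus>\<^bsub>P\<^esub> x \<ominus>\<^bsub>P\<^esub> y = \<zero>\<^bsub>P\<^esub>" if "x \<in> carrier P" "y \<in> carrier P" for x y
    using that P.r_neg[of "x \<oplus>\<^bsub>P\<^esub> y"] by (simp add: a_minus_def P.minus_add P.a_assoc)
  have bal: "f (m \<oplus>\<^bsub>M\<^esub> m') n = f m n \<oplus>\<^bsub>P\<^esub> f m' n"
    if "m \<in> carrier M" "m' \<in> carrier M" "n \<in> carrier N" for m m' n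
    using f that unfolding balanced_map_def additive_map_def by blast
  have bal': "f m (n \<oplus>\<^bsub>N\<^esub> n') = f m n \<oplus>\<^bsub>P\<^esub> f m n'"
    if "m \<in> carrier M" "n \<in> carrier N" "n' \<in> carrier N" for m n n'
    using f that unfolding balanced_map_def additive_map_def by blast
  have bal'': "f (ract M m s) n = f m (lact N s n)"
    if "m \<in> carrier M" "s \<in> carrier S" "n \<in> carrier N" for m s n
    using f that unfolding balanced_map_def by blast
  have diff3: "?s (a - b - d) = ?s a \<ominus>\<^bsub>P\<^esub> ?s b \<ominus>\<^bsub>P\<^esub> ?s d \<and> Poly_Mapping.keys (a - b - d) \<subseteq> ?X"
    if "Poly_Mapping.keys a \<subseteq> ?X" "Poly_Mapping.keys b \<subseteq> ?X" "Poly_Mapping.keys d \<subseteq> ?X" for a b d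
    using diff[of a b] diff[of "a - b" d] that by simp
  \<comment> \<open>The three families of relations are hidden behind \<open>K\<close>, so that the
    induction over \<open>generate\<close> sees only that every generator sums to zero.\<close>
  have "\<exists>K. rels = generate (tensor_free M N) K \<and>
      (\<forall>c\<in>K. ?s c = \<zero>\<^bsub>P\<^esub> \<and> Poly_Mapping.keys c \<subseteq> ?X)"
    unfolding tensor_relations_def
  proof (intro exI conjI, rule refl, intro ballI, elim UnE)
    fix c
    assume "c \<in> {frag_of (m \<oplus>\<^bsub>M\<^esub> m', n) - frag_of (m, n) - frag_of (m', n) | m m' n.
        m \<in> carrier M \<and> m' \<in> carrier M \<and> n \<in> carrier N}"
    then obtain m m' n where mn: "m \<in> carrier M" "m' \<in> carrier M" "n \<in> carrier N"
      and c: "c = frag_of (m \<oplus>\<^bsub>M\<^esub> m', n) - frag_of (m, n) - frag_of (m', n)"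
      by blast
    have "m \<oplus>\<^bsub>M\<^esub> m' \<in> carrier M" using mn by simp
    then show "?s c = \<zero>\<^bsub>P\<^esub> \<and> Poly_Mapping.keys c \<subseteq> ?X"
      using diff3[OF s(2) s(2) s(2), of "m \<oplus>\<^bsub>M\<^esub> m'" n m n m' n] mn
      by (simp add: c s(1) bal z1 balanced_closed)
  next
    fix c
    assume "c \<in> {frag_of (m, n \<oplus>\<^bsub>N\<^esub> n') - frag_of (m, n) - frag_of (m, n') | m n n'.
        m \<in> carrier M \<and> n \<in> carrier N \<and> n' \<in> carrier N}"
    then obtain m n n' where mn: "m \<in> carrier M" "n \<in> carrier N" "n' \<in> carrier N"
      and c: "c = frag_of (m, n \<oplus>\<^bsub>N\<^esub> n') - frag_of (m, n) - frag_of (m, n')"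
      by blast
    have "n \<oplus>\<^bsub>N\<^esub> n' \<in> carrier N" using mn by simp
    then show "?s c = \<zero>\<^bsub>P\<^esub> \<and> Poly_Mapping.keys c \<subseteq> ?X"
      using diff3[OF s(2) s(2) s(2), of m "n \<oplus>\<^bsub>N\<^esub> n'" m n m n'] mn
      by (simp add: c s(1) bal' z1 balanced_closed)
  next
    fix c
    assume "c \<in> {frag_of (ract M m s, n) - frag_of (m, lact N s n) | m s n.
        m \<in> carrier M \<and> s \<in> carrier S \<and> n \<in> carrier N}"
    then obtain m s n where mn: "m \<in> carrier M" "s \<in> carrier S" "n \<in> carrier N"
      and c: "c = frag_of (ract M m s, n) - frag_of (m, lact N s n)"
      by blast
    have "ract M m s \<in> carrier M" "lact N s n \<in> carrier N"
      using mn by (simp_all add: M.ract_closed N.lact_closed)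
    then show "?s c = \<zero>\<^bsub>P\<^esub> \<and> Poly_Mapping.keys c \<subseteq> ?X"
      using diff[OF s(2) s(2), of "ract M m s" n m "lact N s n"] mn
      by (simp add: c s(1) bal'' balanced_closed P.r_neg a_minus_def)
  qed
  then obtain K where K: "rels = generate (tensor_free M N) K"
    "\<And>c. c \<in> K \<Longrightarrow> ?s c = \<zero>\<^bsub>P\<^esub>" "\<And>c. c \<in> K \<Longrightarrow> Poly_Mapping.keys c \<subseteq> ?X"
    by blast
  have "Poly_Mapping.keys c \<subseteq> ?X \<and> ?s c = \<zero>\<^bsub>P\<^esub>"
    using assms unfolding K(1)
  proof (induction rule: generate.induct)
    case one
    show ?case by (simp add: P.free_sum_zero)
  next
    case (incl c)
    then show ?case using K by blast
  next
    case (inv c)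
    then show ?case
      using P.free_sum_uminus[OF fX, of c] K by simp
  next
    case (eng c d)
    then show ?case
      using P.free_sum_add[OF fX, of c d] keys_add[of c d] by auto
  qed
  then show ?thesis by simp
qed

text \<open>\<open>tensor_lift\<close> evaluates the sum at a representative picked by
  \<open>SOME\<close>. Two representatives differ by a relation, on which the sum vanishes by
  \<open>free_sum_rels\<close>, so any representative gives the value.\<close>

lemma tensor_lift_coset:
  assumes "c \<in> carrier (tensor_free M N)"
  shows "tensor_lift P f (rels #>\<^bsub>tensor_free M N\<^esub> c) = free_sum P (\<lambda>z. f (fst z) (snd z)) c"
proof -
  let ?w = "rels #>\<^bsub>tensor_free M N\<^esub> c"
  have "(SOME d. d \<in> ?w) \<in> ?w"
    using F.rcos_self[OF assms rels_subgroup] by (rule someI)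
  then obtain h where h: "h \<in> rels" "(SOME d. d \<in> ?w) = h + c"
    by (auto simp: r_coset_def)
  have fX: "(\<lambda>z. f (fst z) (snd z)) \<in> carrier M \<times> carrier N \<rightarrow> carrier P"
    using balanced_closed by auto
  have "h \<in> carrier (tensor_free M N)"
    using h rels_subgroup subgroup.mem_carrier by metis
  then have "free_sum P (\<lambda>z. f (fst z) (snd z)) (h + c) = free_sum P (\<lambda>z. f (fst z) (snd z)) c"
    using P.free_sum_add[OF fX, of h c] assms free_sum_rels[OF h(1)] P.free_sum_closed[OF fX, of c]
    by simp
  then show ?thesis
    unfolding tensor_lift_def Let_def h(2) free_sum_def by simp
qed

lemma tensor_lift_elt:
  "m \<in> carrier M \<Longrightarrow> n \<in> carrier N \<Longrightarrow> tensor_lift P f (m \<boxtimes> n) = f m n"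
  using tensor_lift_coset[OF frag_of_carrier]
  by (simp add: tensor_elt_def P.free_sum_frag_of balanced_closed)

lemma additive_map_tensor_lift: "additive_map TG P (tensor_lift P f)"
proof -
  have fX: "(\<lambda>z. f (fst z) (snd z)) \<in> carrier M \<times> carrier N \<rightarrow> carrier P"
    using balanced_closed by auto
  show ?thesis
  proof (rule additive_mapI)
    fix w assume "w \<in> carrier TG"
    then show "tensor_lift P f w \<in> carrier P"
      using P.free_sum_closed[OF fX] tensor_lift_coset by (auto simp: TG_simps carrier_FactGroup)
  next
    fix v w assume "v \<in> carrier TG" "w \<in> carrier TG"
    then obtain c d where cd: "c \<in> carrier (tensor_free M N)" "d \<in> carrier (tensor_free M N)"
      and "v = rels #>\<^bsub>tensor_free M N\<^esub> c" "w = rels #>\<^bsub>tensor_free M N\<^esub> d"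
      by (auto simp: TG_simps carrier_FactGroup)
    moreover have "c + d \<in> carrier (tensor_free M N)"
      using F.m_closed[OF cd] by simp
    ultimately show "tensor_lift P f (v \<oplus>\<^bsub>TG\<^esub> w) = tensor_lift P f v \<oplus>\<^bsub>P\<^esub> tensor_lift P f w"
      using P.free_sum_add[OF fX, of c d] by (simp add: coset_add tensor_lift_coset)
  qed
qed

end

lemma lact_additive:
  assumes "r \<in> carrier R"
  shows "balanced_map S M N TG (\<lambda>m n. lact M r m \<boxtimes> n)"
proof -
  interpret M: bimodule R S M by (rule left_factor)
  interpret N: bimodule S T N by (rule right_factor)
  show ?thesis
    using assms
    by (intro balanced_mapI additive_mapI)
      (simp_all add: elt_closed elt_add_left elt_add_right M.lact_closed M.lact_add
        elt_balanced[symmetric] flip: M.lact_ract)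
qed

lemma ract_additive:
  assumes "t \<in> carrier T"
  shows "balanced_map S M N TG (\<lambda>m n. m \<boxtimes> ract N n t)"
proof -
  interpret M: bimodule R S M by (rule left_factor)
  interpret N: bimodule S T N by (rule right_factor)
  show ?thesis
    using assms
    by (intro balanced_mapI additive_mapI)
      (simp_all add: elt_closed elt_add_left elt_add_right elt_balanced N.ract_closed N.ract_add
        N.lact_ract N.lact_closed)
qed

lemma lact_elt:
  "r \<in> carrier R \<Longrightarrow> m \<in> carrier M \<Longrightarrow> n \<in> carrier N \<Longrightarrow> lact TP r (m \<boxtimes> n) = lact M r m \<boxtimes> n"
  unfolding TP_simps by (rule tensor_lift_elt[OF TG_abelian_group lact_additive])

lemma ract_elt:
  "t \<in> carrier T \<Longrightarrow> m \<in> carrier M \<Longrightarrow> n \<in> carrier N \<Longrightarrow> ract TP (m \<boxtimes> n) t = m \<boxtimes> ract N n t"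
  unfolding TP_simps by (rule tensor_lift_elt[OF TG_abelian_group ract_additive])

lemma lact_map: "r \<in> carrier R \<Longrightarrow> additive_map TG TG (lact TP r)"
  unfolding TP_simps by (rule additive_map_tensor_lift[OF TG_abelian_group lact_additive])

lemma ract_map: "t \<in> carrier T \<Longrightarrow> additive_map TG TG (\<lambda>w. ract TP w t)"
  unfolding TP_simps by (rule additive_map_tensor_lift[OF TG_abelian_group ract_additive])



lemma TP_abelian_group: "abelian_group TP"
  by (rule abelian_groupI, unfold TP_simps(1-3)) (fact abelian_groupE[OF TG_abelian_group])+

text \<open>The records \<open>TG\<close> and \<open>TP\<close> agree in carrier and addition, so
  facts about additive maps transfer from one to the other by folding with these equations.\<close>

lemma additive_map_TP_iff:
  "additive_map TP P f \<longleftrightarrow> additive_map TG P f" "additive_map P TP g \<longleftrightarrow> additive_map P TG g"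
  by (simp_all add: additive_map_def TP_simps(1-3))

lemma lact_plus:
  assumes "r \<in> carrier R" "r' \<in> carrier R" "w \<in> carrier TG"
  shows "lact TP (r \<oplus>\<^bsub>R\<^esub> r') w = lact TP r w \<oplus>\<^bsub>TG\<^esub> lact TP r' w"
proof -
  interpret M: bimodule R S M by (rule left_factor)
  show ?thesis
    by (rule additive_map_ext[OF lact_map additive_map_plus[OF TG_abelian_group lact_map lact_map] TG_abelian_group])
      (simp_all add: assms lact_elt M.add_lact M.lact_closed elt_add_left)
qed

lemma lact_mult:
  assumes "r \<in> carrier R" "r' \<in> carrier R" "w \<in> carrier TG"
  shows "lact TP (r \<otimes>\<^bsub>R\<^esub> r') w = lact TP r (lact TP r' w)"
proof -
  interpret M: bimodule R S M by (rule left_factor)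
  show ?thesis
    by (rule additive_map_ext[OF lact_map additive_map_compose[OF lact_map lact_map] TG_abelian_group])
      (simp_all add: assms lact_elt M.mult_lact M.lact_closed)
qed

lemma lact_one:
  assumes "w \<in> carrier TG"
  shows "lact TP \<one>\<^bsub>R\<^esub> w = w"
proof -
  interpret M: bimodule R S M by (rule left_factor)
  show ?thesis
    by (rule additive_map_ext[OF lact_map additive_map_id TG_abelian_group])
      (simp_all add: assms lact_elt M.one_lact)
qed

lemma ract_plus:
  assumes "s \<in> carrier T" "s' \<in> carrier T" "w \<in> carrier TG"
  shows "ract TP w (s \<oplus>\<^bsub>T\<^esub> s') = ract TP w s \<oplus>\<^bsub>TG\<^esub> ract TP w s'"
proof -
  interpret N: bimodule S T N by (rule right_factor)
  show ?thesis
    by (rule additive_map_ext[OF ract_map additive_map_plus[OF TG_abelian_group ract_map ract_map] TG_abelian_group])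
      (simp_all add: assms ract_elt N.add_ract N.ract_closed elt_add_right)
qed

lemma ract_mult:
  assumes "s \<in> carrier T" "s' \<in> carrier T" "w \<in> carrier TG"
  shows "ract TP w (s \<otimes>\<^bsub>T\<^esub> s') = ract TP (ract TP w s) s'"
proof -
  interpret N: bimodule S T N by (rule right_factor)
  show ?thesis
    by (rule additive_map_ext[OF ract_map additive_map_compose[OF ract_map ract_map] TG_abelian_group])
      (simp_all add: assms ract_elt N.mult_ract N.ract_closed)
qed

lemma ract_one:
  assumes "w \<in> carrier TG"
  shows "ract TP w \<one>\<^bsub>T\<^esub> = w"
proof -
  interpret N: bimodule S T N by (rule right_factor)
  show ?thesis
    by (rule additive_map_ext[OF ract_map additive_map_id TG_abelian_group])
      (simp_all add: assms ract_elt N.one_ract)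
qed

lemma lact_ract_comm:
  assumes "r \<in> carrier R" "w \<in> carrier TG" "s \<in> carrier T"
  shows "ract TP (lact TP r w) s = lact TP r (ract TP w s)"
proof -
  interpret M: bimodule R S M by (rule left_factor)
  interpret N: bimodule S T N by (rule right_factor)
  show ?thesis
    by (rule additive_map_ext[OF additive_map_compose[OF lact_map ract_map]
          additive_map_compose[OF ract_map lact_map] TG_abelian_group])
      (simp_all add: assms ract_elt lact_elt N.ract_closed M.lact_closed)
qed

lemma tensor_product_bimodule: "bimodule R T TP"
  by (rule bimodule.intro[OF bimodule.axioms(1)[OF left_factor] bimodule.axioms(2)[OF right_factor]
        TP_abelian_group], rule bimodule_axioms.intro, unfold TP_simps(1-3))
    (fact lact_plus lact_mult lact_one ract_plus ract_mult ract_one lact_ract_comm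
      lact_map[THEN additive_map_closed] ract_map[THEN additive_map_closed]
      lact_map[THEN additive_map_add] ract_map[THEN additive_map_add] |
     rule ract_plus ract_mult ract_one ract_map[THEN additive_map_closed] ract_map[THEN additive_map_add]; assumption)+


lemma TP_elt_closed: "m \<in> carrier M \<Longrightarrow> n \<in> carrier N \<Longrightarrow> m \<boxtimes> n \<in> carrier TP"
  unfolding TP_simps(1) by (rule elt_closed)

lemma TP_elt_add_left:
  "m \<in> carrier M \<Longrightarrow> m' \<in> carrier M \<Longrightarrow> n \<in> carrier N \<Longrightarrow>
    (m \<oplus>\<^bsub>M\<^esub> m') \<boxtimes> n = m \<boxtimes> n \<oplus>\<^bsub>TP\<^esub> m' \<boxtimes> n"
  unfolding TP_simps(3) by (rule elt_add_left)

lemma TP_elt_add_right: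
  "m \<in> carrier M \<Longrightarrow> n \<in> carrier N \<Longrightarrow> n' \<in> carrier N \<Longrightarrow>
    m \<boxtimes> (n \<oplus>\<^bsub>N\<^esub> n') = m \<boxtimes> n \<oplus>\<^bsub>TP\<^esub> m \<boxtimes> n'"
  unfolding TP_simps(3) by (rule elt_add_right)

lemma TP_elt_map_left: "n \<in> carrier N \<Longrightarrow> additive_map M TP (\<lambda>m. m \<boxtimes> n)"
  by (intro additive_mapI TP_elt_closed TP_elt_add_left)

lemma TP_elt_map_right: "m \<in> carrier M \<Longrightarrow> additive_map N TP (\<lambda>n. m \<boxtimes> n)"
  by (intro additive_mapI TP_elt_closed TP_elt_add_right)

lemmas TP_ext = additive_map_ext[folded additive_map_TP_iff(1) TP_simps(1)]
lemmas TP_lift_map = additive_map_tensor_lift[folded additive_map_TP_iff(1)]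
lemmas TP_lact_map = lact_map[folded additive_map_TP_iff]
lemmas TP_ract_map = ract_map[folded additive_map_TP_iff]

end

lemma bimodule_maps:
  assumes "bimodule R S M"
  shows bimodule_lact_map: "r \<in> carrier R \<Longrightarrow> additive_map M M (lact M r)"
    and bimodule_ract_map: "s \<in> carrier S \<Longrightarrow> additive_map M M (\<lambda>m. ract M m s)"
    and bimodule_add_lact_map: "m \<in> carrier M \<Longrightarrow> additive_map R M (\<lambda>r. lact M r m)"
    and bimodule_add_ract_map: "m \<in> carrier M \<Longrightarrow> additive_map S M (ract M m)"
  using bimodule.lact_closed[OF assms] bimodule.ract_closed[OF assms]
    bimodule.lact_add[OF assms] bimodule.ract_add[OF assms]
    bimodule.add_lact[OF assms] bimodule.add_ract[OF assms]
  by (auto intro!: additive_mapI)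

text \<open>Restriction of scalars and passage to a stable subset are treated together: the tensor
  square as a B-A- or A-B-bimodule needs the former, T over the centralizer needs both.\<close>

lemma bimodule_restrict:
  assumes M: "bimodule A A' M" and "subring R A" "subring S A'"
    and K: "K \<subseteq> carrier M" "\<zero>\<^bsub>M\<^esub> \<in> K"
    and add: "\<And>m m'. m \<in> K \<Longrightarrow> m' \<in> K \<Longrightarrow> m \<oplus>\<^bsub>M\<^esub> m' \<in> K"
    and neg: "\<And>m. m \<in> K \<Longrightarrow> \<ominus>\<^bsub>M\<^esub> m \<in> K"
    and lact: "\<And>r m. r \<in> R \<Longrightarrow> m \<in> K \<Longrightarrow> lact M r m \<in> K"
    and ract: "\<And>m s. m \<in> K \<Longrightarrow> s \<in> S \<Longrightarrow> ract M m s \<in> K"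
  shows "bimodule (A\<lparr>carrier := R\<rparr>) (A'\<lparr>carrier := S\<rparr>) (M\<lparr>carrier := K\<rparr>)"
proof (rule bimodule.intro)
  interpret M: abelian_group M by (rule bimodule.axioms(3)[OF M])
  show "ring (A\<lparr>carrier := R\<rparr>)" "ring (A'\<lparr>carrier := S\<rparr>)"
    using ring.subring_is_ring bimodule.axioms(1,2)[OF M] assms(2,3) by blast+
  show "abelian_group (M\<lparr>carrier := K\<rparr>)"
  proof (rule abelian_groupI)
    fix x assume "x \<in> carrier (M\<lparr>carrier := K\<rparr>)"
    then show "\<exists>y\<in>carrier (M\<lparr>carrier := K\<rparr>). y \<oplus>\<^bsub>M\<lparr>carrier := K\<rparr>\<^esub> x = \<zero>\<^bsub>M\<lparr>carrier := K\<rparr>\<^esub>"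
      using K neg by (intro bexI[of _ "\<ominus>\<^bsub>M\<^esub> x"]) (auto simp: M.l_neg)
  qed (use K add in \<open>auto simp: subset_iff M.a_ac\<close>)
  note sub = subringE(1)[OF assms(2), THEN subsetD] subringE(1)[OF assms(3), THEN subsetD] K(1)[THEN subsetD]
  show "bimodule_axioms (A\<lparr>carrier := R\<rparr>) (A'\<lparr>carrier := S\<rparr>) (M\<lparr>carrier := K\<rparr>)"
    by (rule bimodule_axioms.intro)
      (simp_all add: lact ract sub bimodule.lact_add[OF M] bimodule.add_lact[OF M]
        bimodule.mult_lact[OF M] bimodule.one_lact[OF M] bimodule.ract_add[OF M] bimodule.add_ract[OF M]
        bimodule.mult_ract[OF M] bimodule.one_ract[OF M] bimodule.lact_ract[OF M])
qed

lemma (in ring) regular_bimodule: "bimodule R R (regular_bimodule R)"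
proof (rule bimodule.intro[OF ring_axioms ring_axioms])
  show "abelian_group (regular_bimodule R)"
    by (rule abelian_groupI)
      (use add.l_inv_ex in \<open>auto simp: regular_bimodule_def a_ac\<close>)
  show "bimodule_axioms R R (regular_bimodule R)"
    by (rule bimodule_axioms.intro) (auto simp: regular_bimodule_def l_distr r_distr m_assoc)
qed

section \<open>The tensor square of a ring extension\<close>

locale ring_extension = ring A for A :: "('a, 'x) ring_scheme" (structure) + fixes B :: "'a set"
  assumes subring: "subring B A"
begin

abbreviation "B_ring \<equiv> subring_of A B"
abbreviation "Reg \<equiv> regular_bimodule A"
abbreviation "AA \<equiv> tensor_square A B"
abbreviation elt (infixl \<open>\<boxtimes>\<close> 68) where "x \<boxtimes> y \<equiv> tensor_square_elt A B x y"
abbreviation la (infixr \<open>\<rhd>\<close> 67) where "a \<rhd> w \<equiv> lact AA a w"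
abbreviation ra (infixl \<open>\<lhd>\<^sub>A\<close> 67) where "w \<lhd>\<^sub>A a \<equiv> ract AA w a"

lemma B_sub: "b \<in> B \<Longrightarrow> b \<in> carrier A"
  using subringE(1)[OF subring] by blast

lemma Reg_simps [simp]:
  "carrier Reg = carrier A" "add Reg = add A" "ring.zero Reg = ring.zero A"
  "lact Reg = monoid.mult A" "ract Reg = monoid.mult A"
  by (simp_all add: regular_bimodule_def)

lemma additive_map_Reg [simp]:
  "additive_map Reg P f \<longleftrightarrow> additive_map A P f" "additive_map P Reg g \<longleftrightarrow> additive_map P A g"
  by (simp_all add: additive_map_def)

lemma regular_restrict:
  assumes "subring R A" "subring S A"
  shows "bimodule (A\<lparr>carrier := R\<rparr>) (A\<lparr>carrier := S\<rparr>) Reg"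
proof -
  have inv: "\<ominus>\<^bsub>Reg\<^esub> x \<in> carrier A" if "x \<in> carrier A" for x
    using abelian_group.a_inv_closed[OF bimodule.axioms(3)[OF regular_bimodule], of x] that by simp
  have "bimodule (A\<lparr>carrier := R\<rparr>) (A\<lparr>carrier := S\<rparr>) (Reg\<lparr>carrier := carrier Reg\<rparr>)"
    using assms subringE(1)
    by (intro bimodule_restrict[OF regular_bimodule]) (auto simp: subset_iff inv)
  moreover have "Reg\<lparr>carrier := carrier Reg\<rparr> = Reg" by (simp del: Reg_simps)
  ultimately show ?thesis by (simp only:)
qed

lemma TS: "tensor_factors A B_ring A Reg Reg"
  using regular_restrict[OF carrier_is_subring subring] regular_restrict[OF subring carrier_is_subring]
  by (simp add: tensor_factors_def)

lemma elt_closed [simp]: "x \<in> carrier A \<Longrightarrow> y \<in> carrier A \<Longrightarrow> x \<boxtimes> y \<in> carrier AA"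
  using tensor_factors.TP_elt_closed[OF TS, of x y] by (simp add: tensor_square_def tensor_square_elt_def)

lemma elt_add_left:
  "x \<in> carrier A \<Longrightarrow> x' \<in> carrier A \<Longrightarrow> y \<in> carrier A \<Longrightarrow> (x \<oplus> x') \<boxtimes> y = x \<boxtimes> y \<oplus>\<^bsub>AA\<^esub> x' \<boxtimes> y"
  using tensor_factors.TP_elt_add_left[OF TS, of x x' y] by (simp add: tensor_square_def tensor_square_elt_def)

lemma elt_add_right:
  "x \<in> carrier A \<Longrightarrow> y \<in> carrier A \<Longrightarrow> y' \<in> carrier A \<Longrightarrow> x \<boxtimes> (y \<oplus> y') = x \<boxtimes> y \<oplus>\<^bsub>AA\<^esub> x \<boxtimes> y'"
  using tensor_factors.TP_elt_add_right[OF TS, of x y y'] by (simp add: tensor_square_def tensor_square_elt_def)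

lemma elt_balanced:
  "x \<in> carrier A \<Longrightarrow> b \<in> B \<Longrightarrow> y \<in> carrier A \<Longrightarrow> (x \<otimes> b) \<boxtimes> y = x \<boxtimes> (b \<otimes> y)"
  using tensor_factors.elt_balanced[OF TS, of x b y] by (simp add: tensor_square_elt_def)

lemma la_elt: "a \<in> carrier A \<Longrightarrow> x \<in> carrier A \<Longrightarrow> y \<in> carrier A \<Longrightarrow> a \<rhd> (x \<boxtimes> y) = (a \<otimes> x) \<boxtimes> y"
  using tensor_factors.lact_elt[OF TS, of a x y] by (simp add: tensor_square_def tensor_square_elt_def)

lemma ra_elt: "a \<in> carrier A \<Longrightarrow> x \<in> carrier A \<Longrightarrow> y \<in> carrier A \<Longrightarrow> (x \<boxtimes> y) \<lhd>\<^sub>A a = x \<boxtimes> (y \<otimes> a)"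
  using tensor_factors.ract_elt[OF TS, of a x y] by (simp add: tensor_square_def tensor_square_elt_def)

lemma AA_bimodule: "bimodule A A AA"
  using tensor_factors.tensor_product_bimodule[OF TS] by (simp add: tensor_square_def)

sublocale AA: abelian_group AA
  by (rule bimodule.axioms(3)[OF AA_bimodule])

lemma AA_ag: "abelian_group AA" by (rule AA.abelian_group_axioms)
lemma A_ag: "abelian_group A" by (rule abelian_group_axioms)

lemma la_closed [simp]: "a \<in> carrier A \<Longrightarrow> w \<in> carrier AA \<Longrightarrow> a \<rhd> w \<in> carrier AA"
  by (rule bimodule.lact_closed[OF AA_bimodule])

lemma ra_closed [simp]: "a \<in> carrier A \<Longrightarrow> w \<in> carrier AA \<Longrightarrow> w \<lhd>\<^sub>A a \<in> carrier AA"
  by (rule bimodule.ract_closed[OF AA_bimodule])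

lemmas la_map = bimodule_lact_map[OF AA_bimodule]
lemmas ra_map = bimodule_ract_map[OF AA_bimodule]
lemmas la_add_map = bimodule_add_lact_map[OF AA_bimodule]
lemmas ra_add_map = bimodule_add_ract_map[OF AA_bimodule]
lemmas la_mult = bimodule.mult_lact[OF AA_bimodule]
lemmas ra_mult = bimodule.mult_ract[OF AA_bimodule]
lemmas la_ra = bimodule.lact_ract[OF AA_bimodule]
lemmas la_add = additive_mapD(2)[OF la_map] additive_mapD(2)[OF la_add_map]
lemmas ra_add = additive_mapD(2)[OF ra_map] additive_mapD(2)[OF ra_add_map]

lemma la_one [simp]: "w \<in> carrier AA \<Longrightarrow> \<one> \<rhd> w = w"
  by (rule bimodule.one_lact[OF AA_bimodule])

lemma ra_one [simp]: "w \<in> carrier AA \<Longrightarrow> w \<lhd>\<^sub>A \<one> = w"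
  by (rule bimodule.one_ract[OF AA_bimodule])

lemma elt_map_left: "y \<in> carrier A \<Longrightarrow> additive_map A AA (\<lambda>x. x \<boxtimes> y)"
  by (intro additive_mapI elt_closed elt_add_left)

lemma elt_map_right: "x \<in> carrier A \<Longrightarrow> additive_map A AA (\<lambda>y. x \<boxtimes> y)"
  by (intro additive_mapI elt_closed elt_add_right)

lemma AA_ext:
  assumes "abelian_group P" "additive_map AA P f" "additive_map AA P g"
    and "\<And>x y. x \<in> carrier A \<Longrightarrow> y \<in> carrier A \<Longrightarrow> f (x \<boxtimes> y) = g (x \<boxtimes> y)"
    and "w \<in> carrier AA"
  shows "f w = g w"
  using tensor_factors.TP_ext[OF TS, of P f g w] assms by (simp add: tensor_square_def tensor_square_elt_def)

definition balanced :: "('p, 'z) ring_scheme \<Rightarrow> ('a \<Rightarrow> 'a \<Rightarrow> 'p) \<Rightarrow> bool"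
  where "balanced P f \<longleftrightarrow> (\<forall>x\<in>carrier A. additive_map A P (f x)) \<and>
    (\<forall>y\<in>carrier A. additive_map A P (\<lambda>x. f x y)) \<and>
    (\<forall>x\<in>carrier A. \<forall>b\<in>B. \<forall>y\<in>carrier A. f (x \<otimes> b) y = f x (b \<otimes> y))"

lemma balancedI:
  assumes "\<And>x. x \<in> carrier A \<Longrightarrow> additive_map A P (f x)"
    and "\<And>y. y \<in> carrier A \<Longrightarrow> additive_map A P (\<lambda>x. f x y)"
    and "\<And>x b y. x \<in> carrier A \<Longrightarrow> b \<in> B \<Longrightarrow> y \<in> carrier A \<Longrightarrow> f (x \<otimes> b) y = f x (b \<otimes> y)"
  shows "balanced P f"
  using assms by (simp add: balanced_def)

lemma balanced_eq: "balanced P f \<longleftrightarrow> balanced_map B_ring Reg Reg P f"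
  by (simp add: balanced_def balanced_map_def)

lemma lift_elt:
  "abelian_group P \<Longrightarrow> balanced P f \<Longrightarrow> x \<in> carrier A \<Longrightarrow> y \<in> carrier A \<Longrightarrow>
    tensor_lift P f (x \<boxtimes> y) = f x y"
  using tensor_factors.tensor_lift_elt[OF TS, of P f x y] by (simp add: balanced_eq tensor_square_elt_def)

lemma lift_map: "abelian_group P \<Longrightarrow> balanced P f \<Longrightarrow> additive_map AA P (tensor_lift P f)"
  using tensor_factors.TP_lift_map[OF TS, of P f] by (simp add: balanced_eq tensor_square_def)

lemma mult_map_left: "a \<in> carrier A \<Longrightarrow> additive_map A A (\<lambda>x. a \<otimes> x)"
  by (simp add: additive_mapI r_distr)

lemma mult_map_right: "a \<in> carrier A \<Longrightarrow> additive_map A A (\<lambda>x. x \<otimes> a)"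
  by (simp add: additive_mapI l_distr)

definition right_linear :: "('a \<Rightarrow> 'a) \<Rightarrow> bool"
  where "right_linear h \<longleftrightarrow> additive_map A A h \<and> (\<forall>a\<in>carrier A. \<forall>b\<in>B. h (a \<otimes> b) = h a \<otimes> b)"

definition left_linear :: "('a \<Rightarrow> 'a) \<Rightarrow> bool"
  where "left_linear h \<longleftrightarrow> additive_map A A h \<and> (\<forall>a\<in>carrier A. \<forall>b\<in>B. h (b \<otimes> a) = b \<otimes> h a)"

lemma right_linearD:
  assumes "right_linear h"
  shows "additive_map A A h" "a \<in> carrier A \<Longrightarrow> h a \<in> carrier A"
    "a \<in> carrier A \<Longrightarrow> b \<in> B \<Longrightarrow> h (a \<otimes> b) = h a \<otimes> b"
  using assms by (auto simp: right_linear_def additive_mapD)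

lemma left_linearD:
  assumes "left_linear h"
  shows "additive_map A A h" "a \<in> carrier A \<Longrightarrow> h a \<in> carrier A"
    "a \<in> carrier A \<Longrightarrow> b \<in> B \<Longrightarrow> h (b \<otimes> a) = b \<otimes> h a"
  using assms by (auto simp: left_linear_def additive_mapD)

lemma hom_BB: "f \<in> bimodule_hom B_ring B_ring Reg Reg \<longleftrightarrow> right_linear f \<and> left_linear f"
  by (auto simp: bimodule_hom_def right_linear_def left_linear_def additive_map_def)

definition lmul :: "('a \<Rightarrow> 'a) \<Rightarrow> ('a, 'a) tensor \<Rightarrow> 'a"
  where "lmul h = tensor_lift A (\<lambda>x y. h x \<otimes> y)"

definition rmul :: "('a \<Rightarrow> 'a) \<Rightarrow> ('a, 'a) tensor \<Rightarrow> 'a"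
  where "rmul h = tensor_lift A (\<lambda>x y. x \<otimes> h y)"

definition lmap :: "('a \<Rightarrow> 'a) \<Rightarrow> ('a, 'a) tensor \<Rightarrow> ('a, 'a) tensor"
  where "lmap h = tensor_lift AA (\<lambda>x y. h x \<boxtimes> y)"

definition rmap :: "('a \<Rightarrow> 'a) \<Rightarrow> ('a, 'a) tensor \<Rightarrow> ('a, 'a) tensor"
  where "rmap h = tensor_lift AA (\<lambda>x y. x \<boxtimes> h y)"

lemma lmul_bal: "right_linear h \<Longrightarrow> balanced A (\<lambda>x y. h x \<otimes> y)"
  by (intro balancedI mult_map_left additive_map_compose[of A A _ A, OF _ mult_map_right])
    (simp_all add: right_linearD m_assoc B_sub)

lemma rmul_bal: "left_linear h \<Longrightarrow> balanced A (\<lambda>x y. x \<otimes> h y)"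
  by (intro balancedI mult_map_right additive_map_compose[of A A _ A, OF _ mult_map_left])
    (simp_all add: left_linearD m_assoc B_sub)

lemma lmap_bal: "right_linear h \<Longrightarrow> balanced AA (\<lambda>x y. h x \<boxtimes> y)"
  by (intro balancedI elt_map_right additive_map_compose[of A A _ AA, OF _ elt_map_left])
    (simp_all add: right_linearD elt_balanced)

lemma rmap_bal: "left_linear h \<Longrightarrow> balanced AA (\<lambda>x y. x \<boxtimes> h y)"
  by (intro balancedI elt_map_left additive_map_compose[of A A _ AA, OF _ elt_map_right])
    (simp_all add: left_linearD elt_balanced)

lemma lmul_elt: "right_linear h \<Longrightarrow> x \<in> carrier A \<Longrightarrow> y \<in> carrier A \<Longrightarrow> lmul h (x \<boxtimes> y) = h x \<otimes> y"
  unfolding lmul_def by (rule lift_elt[OF A_ag lmul_bal])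

lemma rmul_elt: "left_linear h \<Longrightarrow> x \<in> carrier A \<Longrightarrow> y \<in> carrier A \<Longrightarrow> rmul h (x \<boxtimes> y) = x \<otimes> h y"
  unfolding rmul_def by (rule lift_elt[OF A_ag rmul_bal])

lemma lmap_elt: "right_linear h \<Longrightarrow> x \<in> carrier A \<Longrightarrow> y \<in> carrier A \<Longrightarrow> lmap h (x \<boxtimes> y) = h x \<boxtimes> y"
  unfolding lmap_def by (rule lift_elt[OF AA_ag lmap_bal])

lemma rmap_elt: "left_linear h \<Longrightarrow> x \<in> carrier A \<Longrightarrow> y \<in> carrier A \<Longrightarrow> rmap h (x \<boxtimes> y) = x \<boxtimes> h y"
  unfolding rmap_def by (rule lift_elt[OF AA_ag rmap_bal])

lemma lmul_map: "right_linear h \<Longrightarrow> additive_map AA A (lmul h)"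
  unfolding lmul_def by (rule lift_map[OF A_ag lmul_bal])

lemma rmul_map: "left_linear h \<Longrightarrow> additive_map AA A (rmul h)"
  unfolding rmul_def by (rule lift_map[OF A_ag rmul_bal])

lemma lmap_map: "right_linear h \<Longrightarrow> additive_map AA AA (lmap h)"
  unfolding lmap_def by (rule lift_map[OF AA_ag lmap_bal])

lemma rmap_map: "left_linear h \<Longrightarrow> additive_map AA AA (rmap h)"
  unfolding rmap_def by (rule lift_map[OF AA_ag rmap_bal])

lemmas lmul_closed = additive_mapD(1)[OF lmul_map]
lemmas rmul_closed = additive_mapD(1)[OF rmul_map]
lemmas lmap_closed = additive_mapD(1)[OF lmap_map]
lemmas lin_elts = lmul_elt rmul_elt lmap_elt rmap_elt

lemma right_linear_id: "right_linear (\<lambda>x. x)" and left_linear_id: "left_linear (\<lambda>x. x)"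
  by (simp_all add: right_linear_def left_linear_def additive_map_id)

lemma right_linear_comp: "right_linear h \<Longrightarrow> right_linear k \<Longrightarrow> right_linear (\<lambda>x. h (k x))"
  by (auto simp: right_linear_def additive_mapD intro: additive_map_compose)

lemma left_linear_comp: "left_linear h \<Longrightarrow> left_linear k \<Longrightarrow> left_linear (\<lambda>x. h (k x))"
  by (auto simp: left_linear_def additive_mapD intro: additive_map_compose)

lemma right_linear_mult: "a \<in> carrier A \<Longrightarrow> right_linear (\<lambda>x. a \<otimes> x)"
  by (simp add: right_linear_def mult_map_left m_assoc B_sub)

lemma left_linear_mult: "a \<in> carrier A \<Longrightarrow> left_linear (\<lambda>x. x \<otimes> a)"
  by (simp add: left_linear_def mult_map_right m_assoc B_sub)

lemma lmul_ra:
  assumes "right_linear h" "w \<in> carrier AA" "a \<in> carrier A"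
  shows "lmul h (w \<lhd>\<^sub>A a) = lmul h w \<otimes> a"
  by (rule AA_ext[OF A_ag additive_map_compose[OF ra_map lmul_map]
        additive_map_compose[OF lmul_map mult_map_right]])
    (simp_all add: assms lin_elts ra_elt right_linearD[OF assms(1)] m_assoc)

lemma rmul_la:
  assumes "left_linear h" "w \<in> carrier AA" "a \<in> carrier A"
  shows "rmul h (a \<rhd> w) = a \<otimes> rmul h w"
  by (rule AA_ext[OF A_ag additive_map_compose[OF la_map rmul_map]
        additive_map_compose[OF rmul_map mult_map_left]])
    (simp_all add: assms lin_elts la_elt left_linearD[OF assms(1)] m_assoc)

lemma lmap_ra:
  assumes "right_linear h" "w \<in> carrier AA" "a \<in> carrier A"
  shows "lmap h (w \<lhd>\<^sub>A a) = lmap h w \<lhd>\<^sub>A a"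
  by (rule AA_ext[OF AA_ag additive_map_compose[OF ra_map lmap_map]
        additive_map_compose[OF lmap_map ra_map]])
    (simp_all add: assms lin_elts ra_elt right_linearD[OF assms(1)])

lemma rmap_la:
  assumes "left_linear h" "w \<in> carrier AA" "a \<in> carrier A"
  shows "rmap h (a \<rhd> w) = a \<rhd> rmap h w"
  by (rule AA_ext[OF AA_ag additive_map_compose[OF la_map rmap_map]
        additive_map_compose[OF rmap_map la_map]])
    (simp_all add: assms lin_elts la_elt left_linearD[OF assms(1)])

text \<open>A right B-linear h need not commute with left multiplication, so the scalar is absorbed
  into the function. Left linearity of the coproduct, \<open>coprod_lact\<close>, relies on this
  form.\<close>

lemma lmul_la:
  assumes "right_linear h" "w \<in> carrier AA" "a \<in> carrier A"
  shows "lmul h (a \<rhd> w) = lmul (\<lambda>x. h (a \<otimes> x)) w"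
  by (rule AA_ext[OF A_ag additive_map_compose[OF la_map lmul_map] lmul_map])
    (simp_all add: right_linear_comp[OF assms(1) right_linear_mult[OF assms(3)]] assms lin_elts la_elt right_linearD[OF assms(1)])

lemma lmap_la:
  assumes "right_linear h" "w \<in> carrier AA" "a \<in> carrier A"
  shows "lmap h (a \<rhd> w) = lmap (\<lambda>x. h (a \<otimes> x)) w"
  by (rule AA_ext[OF AA_ag additive_map_compose[OF la_map lmap_map] lmap_map])
    (simp_all add: right_linear_comp[OF assms(1) right_linear_mult[OF assms(3)]] assms lin_elts la_elt right_linearD[OF assms(1)])

lemma lmul_lmap:
  assumes "right_linear h" "right_linear k" "w \<in> carrier AA"
  shows "lmul k (lmap h w) = lmul (\<lambda>x. k (h x)) w"
  by (rule AA_ext[OF A_ag additive_map_compose[OF lmap_map lmul_map] lmul_map])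
    (simp_all add: right_linear_comp[OF assms(2,1)] assms lin_elts right_linearD[OF assms(1)] right_linearD[OF assms(2)])

lemma lmul_la_B:
  assumes "right_linear h" "left_linear h" "w \<in> carrier AA" "b \<in> B"
  shows "lmul h (b \<rhd> w) = b \<otimes> lmul h w"
  by (rule AA_ext[OF A_ag additive_map_compose[OF la_map lmul_map]
        additive_map_compose[OF lmul_map mult_map_left]])
    (simp_all add: B_sub[OF assms(4)] assms lin_elts la_elt right_linearD[OF assms(1)] left_linearD(3)[OF assms(2)] m_assoc)

lemma rmul_ra_B:
  assumes "right_linear h" "left_linear h" "w \<in> carrier AA" "b \<in> B"
  shows "rmul h (w \<lhd>\<^sub>A b) = rmul h w \<otimes> b"
  by (rule AA_ext[OF A_ag additive_map_compose[OF ra_map rmul_map]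
        additive_map_compose[OF rmul_map mult_map_right]])
    (simp_all add: B_sub[OF assms(4)] assms lin_elts ra_elt left_linearD[OF assms(2)] right_linearD(3)[OF assms(1)] m_assoc)

lemma lmap_la_B:
  assumes "right_linear h" "left_linear h" "w \<in> carrier AA" "b \<in> B"
  shows "lmap h (b \<rhd> w) = b \<rhd> lmap h w"
  by (rule AA_ext[OF AA_ag additive_map_compose[OF la_map lmap_map]
        additive_map_compose[OF lmap_map la_map]])
    (simp_all add: B_sub[OF assms(4)] assms lin_elts la_elt right_linearD[OF assms(1)] left_linearD(3)[OF assms(2)])

end

section \<open>Direct summands of finite powers\<close>

lemma direct_power_simps:
  "carrier (direct_power n N) = {..<n} \<rightarrow>\<^sub>E carrier N"
  "ring.zero (direct_power n N) = (\<lambda>i\<in>{..<n}. \<zero>\<^bsub>N\<^esub>)"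
  "f \<oplus>\<^bsub>direct_power n N\<^esub> g = (\<lambda>i\<in>{..<n}. f i \<oplus>\<^bsub>N\<^esub> g i)"
  "lact (direct_power n N) r f = (\<lambda>i\<in>{..<n}. lact N r (f i))"
  "ract (direct_power n N) f s = (\<lambda>i\<in>{..<n}. ract N (f i) s)"
  by (simp_all add: direct_power_def)

lemma direct_power_eqI:
  "f \<in> {..<n} \<rightarrow>\<^sub>E X \<Longrightarrow> g \<in> {..<n} \<rightarrow>\<^sub>E Y \<Longrightarrow> (\<And>i. i < n \<Longrightarrow> f i = g i) \<Longrightarrow> f = g"
  by (rule PiE_ext) auto

lemma direct_power_bimodule:
  assumes "bimodule R S N"
  shows "bimodule R S (direct_power n N)"
proof -
  interpret N: abelian_group N by (rule bimodule.axioms(3)[OF assms])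
  have ag: "abelian_group (direct_power n N)"
  proof (rule abelian_groupI)
    fix f assume f: "f \<in> carrier (direct_power n N)"
    then have fi: "f i \<in> carrier N" if "i < n" for i
      using that by (auto simp: direct_power_simps)
    show "\<exists>g\<in>carrier (direct_power n N). g \<oplus>\<^bsub>direct_power n N\<^esub> f = \<zero>\<^bsub>direct_power n N\<^esub>"
      by (intro bexI[of _ "\<lambda>i\<in>{..<n}. \<ominus>\<^bsub>N\<^esub> f i"])
        (simp_all add: direct_power_simps N.l_neg fi cong: restrict_cong)
    show "\<zero>\<^bsub>direct_power n N\<^esub> \<oplus>\<^bsub>direct_power n N\<^esub> f = f"
      by (rule direct_power_eqI[of _ n "carrier N" _ "carrier N"])
        (use f fi in \<open>simp_all add: direct_power_simps\<close>)
  qed (auto simp: direct_power_simps PiE_iff restrict_def fun_eq_iff extensional_def N.a_ac)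
  have ax: "bimodule_axioms R S (direct_power n N)"
  proof (rule bimodule_axioms.intro)
    fix f assume f: "f \<in> carrier (direct_power n N)"
    then have fi: "f i \<in> carrier N" if "i < n" for i
      using that by (auto simp: direct_power_simps)
    show "lact (direct_power n N) \<one>\<^bsub>R\<^esub> f = f"
      by (rule direct_power_eqI[of _ n "carrier N" _ "carrier N"])
        (use f fi in \<open>simp_all add: direct_power_simps bimodule.one_lact[OF assms]\<close>)
    show "ract (direct_power n N) f \<one>\<^bsub>S\<^esub> = f"
      by (rule direct_power_eqI[of _ n "carrier N" _ "carrier N"])
        (use f fi in \<open>simp_all add: direct_power_simps bimodule.one_ract[OF assms]\<close>)
  qed (auto simp: direct_power_simps PiE_iff restrict_def fun_eq_iff extensional_def bimodule.lact_closed[OF assms] bimodule.ract_closed[OF assms]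
      bimodule.lact_add[OF assms] bimodule.add_lact[OF assms]
      bimodule.mult_lact[OF assms] bimodule.ract_add[OF assms] bimodule.add_ract[OF assms]
      bimodule.mult_ract[OF assms] bimodule.lact_ract[OF assms])
  show ?thesis
    by (rule bimodule.intro[OF bimodule.axioms(1,2)[OF assms] ag ax])
qed

lemma bimodule_homD:
  assumes "f \<in> bimodule_hom R S M N"
  shows "additive_map M N f" "m \<in> carrier M \<Longrightarrow> f m \<in> carrier N"
    "m \<in> carrier M \<Longrightarrow> m' \<in> carrier M \<Longrightarrow> f (m \<oplus>\<^bsub>M\<^esub> m') = f m \<oplus>\<^bsub>N\<^esub> f m'"
    "r \<in> carrier R \<Longrightarrow> m \<in> carrier M \<Longrightarrow> f (lact M r m) = lact N r (f m)"
    "m \<in> carrier M \<Longrightarrow> s \<in> carrier S \<Longrightarrow> f (ract M m s) = ract N (f m) s"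
  using assms by (auto simp: bimodule_hom_def additive_map_def)

lemma bimodule_homI:
  assumes "additive_map M N f"
    "\<And>r m. r \<in> carrier R \<Longrightarrow> m \<in> carrier M \<Longrightarrow> f (lact M r m) = lact N r (f m)"
    "\<And>m s. m \<in> carrier M \<Longrightarrow> s \<in> carrier S \<Longrightarrow> f (ract M m s) = ract N (f m) s"
  shows "f \<in> bimodule_hom R S M N"
  using assms by (auto simp: bimodule_hom_def additive_map_def)

lemma bimodule_hom_compose:
  "f \<in> bimodule_hom R S M N \<Longrightarrow> g \<in> bimodule_hom R S N P \<Longrightarrow> (\<lambda>m. g (f m)) \<in> bimodule_hom R S M P"
  by (auto simp: bimodule_hom_def Pi_iff)

text \<open>Since P and Q meet in zero, the P-component of an element is determined
  (\<open>uniq\<close>). It is compatible with both actions because P and Q are stable under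
  them.\<close>

lemma subgroup_projection:
  assumes D: "bimodule R S D" and P: "subbimodule R S P D" and Q: "subbimodule R S Q D"
    and PQ: "P \<inter> Q = {\<zero>\<^bsub>D\<^esub>}" "P <+>\<^bsub>D\<^esub> Q = carrier D"
  obtains \<pi> where "\<pi> \<in> bimodule_hom R S D (D\<lparr>carrier := P\<rparr>)" "\<And>p. p \<in> P \<Longrightarrow> \<pi> p = p"
proof -
  interpret D: abelian_group D by (rule bimodule.axioms(3)[OF D])
  have sP: "subgroup P (add_monoid D)" and sQ: "subgroup Q (add_monoid D)"
    using P Q by (auto simp: subbimodule_def)
  have P1: "p \<in> carrier D" "\<ominus>\<^bsub>D\<^esub> p \<in> P" "p \<oplus>\<^bsub>D\<^esub> p' \<in> P" if "p \<in> P" "p' \<in> P" for p p'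
    using that subgroup.mem_carrier[OF sP] subgroup.m_inv_closed[OF sP] subgroup.m_closed[OF sP]
    by (auto simp: a_inv_def)
  have Q1: "p \<in> carrier D" "\<ominus>\<^bsub>D\<^esub> p \<in> Q" "p \<oplus>\<^bsub>D\<^esub> p' \<in> Q" if "p \<in> Q" "p' \<in> Q" for p p'
    using that subgroup.mem_carrier[OF sQ] subgroup.m_inv_closed[OF sQ] subgroup.m_closed[OF sQ]
    by (auto simp: a_inv_def)
  have zero: "\<zero>\<^bsub>D\<^esub> \<in> P" "\<zero>\<^bsub>D\<^esub> \<in> Q" using PQ(1) by auto
  define \<pi> where "\<pi> v = (SOME p. p \<in> P \<and> (\<exists>q\<in>Q. v = p \<oplus>\<^bsub>D\<^esub> q))" for v
  have ex: "\<exists>p q. p \<in> P \<and> q \<in> Q \<and> v = p \<oplus>\<^bsub>D\<^esub> q" if "v \<in> carrier D" for v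
    using that unfolding PQ(2)[symmetric] by (auto simp: set_add_def')
  have uniq: "p = p'" if "p \<in> P" "q \<in> Q" "p' \<in> P" "q' \<in> Q" "p \<oplus>\<^bsub>D\<^esub> q = p' \<oplus>\<^bsub>D\<^esub> q'" for p q p' q'
  proof -
    note c = P1(1)[OF that(1,1)] P1(1)[OF that(3,3)] Q1(1)[OF that(2,2)] Q1(1)[OF that(4,4)]
    have "\<ominus>\<^bsub>D\<^esub> p' \<oplus>\<^bsub>D\<^esub> (p \<oplus>\<^bsub>D\<^esub> q) \<ominus>\<^bsub>D\<^esub> q = \<ominus>\<^bsub>D\<^esub> p' \<oplus>\<^bsub>D\<^esub> (p' \<oplus>\<^bsub>D\<^esub> q') \<ominus>\<^bsub>D\<^esub> q"
      using that(5) by simp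
    then have e: "\<ominus>\<^bsub>D\<^esub> p' \<oplus>\<^bsub>D\<^esub> p = q' \<ominus>\<^bsub>D\<^esub> q"
      using c by (simp add: a_minus_def D.a_assoc D.r_neg D.r_neg1)
    have "\<ominus>\<^bsub>D\<^esub> p' \<oplus>\<^bsub>D\<^esub> p \<in> P \<inter> Q"
      using P1(3)[OF P1(2)[OF that(3,3)] that(1)] Q1(3)[OF that(4) Q1(2)[OF that(2,2)]] e
      by (auto simp: a_minus_def)
    then have "\<ominus>\<^bsub>D\<^esub> p' \<oplus>\<^bsub>D\<^esub> p = \<zero>\<^bsub>D\<^esub>" using PQ(1) by simp
    then show ?thesis using c by (metis D.a_inv_closed D.minus_equality D.minus_minus)
  qed
  have pi_eq: "\<pi> (p \<oplus>\<^bsub>D\<^esub> q) = p" if "p \<in> P" "q \<in> Q" for p q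
  proof -
    have "\<pi> (p \<oplus>\<^bsub>D\<^esub> q) \<in> P \<and> (\<exists>q'\<in>Q. p \<oplus>\<^bsub>D\<^esub> q = \<pi> (p \<oplus>\<^bsub>D\<^esub> q) \<oplus>\<^bsub>D\<^esub> q')"
      unfolding \<pi>_def by (rule someI[of _ p]) (use that in blast)
    then show ?thesis using uniq that by metis
  qed
  have "\<pi> \<in> bimodule_hom R S D (D\<lparr>carrier := P\<rparr>)"
  proof (rule bimodule_homI)
    show "additive_map D (D\<lparr>carrier := P\<rparr>) \<pi>"
    proof (rule additive_mapI)
      fix v assume "v \<in> carrier D"
      then show "\<pi> v \<in> carrier (D\<lparr>carrier := P\<rparr>)" using ex pi_eq by force
    next
      fix v w assume "v \<in> carrier D" "w \<in> carrier D"
      then obtain p q p' q' where *: "p \<in> P" "q \<in> Q" "v = p \<oplus>\<^bsub>D\<^esub> q" "p' \<in> P" "q' \<in> Q" "w = p' \<oplus>\<^bsub>D\<^esub> q'"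
        using ex by metis
      note c = P1(1)[OF *(1,1)] Q1(1)[OF *(2,2)] P1(1)[OF *(4,4)] Q1(1)[OF *(5,5)]
      have "v \<oplus>\<^bsub>D\<^esub> w = (p \<oplus>\<^bsub>D\<^esub> p') \<oplus>\<^bsub>D\<^esub> (q \<oplus>\<^bsub>D\<^esub> q')"
        using c by (simp add: * D.a_ac)
      then show "\<pi> (v \<oplus>\<^bsub>D\<^esub> w) = \<pi> v \<oplus>\<^bsub>D\<lparr>carrier := P\<rparr>\<^esub> \<pi> w"
        using pi_eq P1(3) Q1(3) * by simp
    qed
  next
    fix r v assume r: "r \<in> carrier R" and "v \<in> carrier D"
    then obtain p q where *: "p \<in> P" "q \<in> Q" "v = p \<oplus>\<^bsub>D\<^esub> q"
      using ex by metis
    have "lact D r v = lact D r p \<oplus>\<^bsub>D\<^esub> lact D r q"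
      using bimodule.lact_add[OF D r P1(1)[OF *(1,1)] Q1(1)[OF *(2,2)]] * by simp
    then show "\<pi> (lact D r v) = lact (D\<lparr>carrier := P\<rparr>) r (\<pi> v)"
      using pi_eq P Q r * by (simp add: subbimodule_def)
  next
    fix v s assume s: "s \<in> carrier S" and "v \<in> carrier D"
    then obtain p q where *: "p \<in> P" "q \<in> Q" "v = p \<oplus>\<^bsub>D\<^esub> q"
      using ex by metis
    have "ract D v s = ract D p s \<oplus>\<^bsub>D\<^esub> ract D q s"
      using bimodule.ract_add[OF D P1(1)[OF *(1,1)] Q1(1)[OF *(2,2)] s] * by simp
    then show "\<pi> (ract D v s) = ract (D\<lparr>carrier := P\<rparr>) (\<pi> v) s"
      using pi_eq P Q s * by (simp add: subbimodule_def)
  qed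
  moreover have "\<pi> p = p" if "p \<in> P" for p
    using pi_eq[OF that zero(2)] P1(1)[OF that that] by simp
  ultimately show ?thesis using that by blast
qed

lemma bimodule_hom_inv_into:
  assumes "bimodule R S M" "f \<in> bimodule_hom R S M N" "bij_betw f (carrier M) (carrier N)"
  shows "inv_into (carrier M) f \<in> bimodule_hom R S N M"
proof -
  interpret M: abelian_group M by (rule bimodule.axioms(3)[OF assms(1)])
  let ?g = "inv_into (carrier M) f"
  have fg: "f (?g n) = n" "?g n \<in> carrier M" if "n \<in> carrier N" for n
    using that assms(3) by (simp_all add: bij_betw_inv_into_right bij_betw_def inv_into_into)
  have gf: "?g n = m" if "m \<in> carrier M" "f m = n" for m n
    using that assms(3) by (auto simp: bij_betw_inv_into_left)
  show ?thesis
    by (intro bimodule_homI additive_mapI gf)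
      (simp_all add: fg bimodule_homD[OF assms(2)] bimodule.lact_closed[OF assms(1)]
        bimodule.ract_closed[OF assms(1)])
qed

text \<open>The dual basis form of being a summand: f_i is the i-th coordinate of the embedding into
  the power, g_i is the i-th inclusion followed by the projection onto the summand and the inverse
  isomorphism. Both depth two conditions and the generator condition enter the proof in this
  form.\<close>

lemma summand_of_power_homs:
  assumes "summand_of_power R S M N" and M: "bimodule R S M" and N: "bimodule R S N"
  shows "\<exists>n f g. (\<forall>i<n. f i \<in> bimodule_hom R S M N) \<and> (\<forall>i<n. g i \<in> bimodule_hom R S N M) \<and>
    (\<forall>m\<in>carrier M. (\<Oplus>\<^bsub>M\<^esub>i\<in>{..<n::nat}. g i (f i m)) = m)"
proof -
  interpret M: abelian_group M by (rule bimodule.axioms(3)[OF M])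
  interpret N: abelian_group N by (rule bimodule.axioms(3)[OF N])
  from assms(1) obtain n P Q \<phi> where P: "subbimodule R S P (direct_power n N)"
    and Q: "subbimodule R S Q (direct_power n N)"
    and PQ: "P \<inter> Q = {\<zero>\<^bsub>direct_power n N\<^esub>}"
      "P <+>\<^bsub>direct_power n N\<^esub> Q = carrier (direct_power n N)"
    and \<phi>: "\<phi> \<in> bimodule_hom R S M ((direct_power n N)\<lparr>carrier := P\<rparr>)"
      "bij_betw \<phi> (carrier M) (carrier ((direct_power n N)\<lparr>carrier := P\<rparr>))"
    unfolding summand_of_power_def bimodule_isomorphic_def by blast
  let ?D = "direct_power n N"
  have D: "bimodule R S ?D" by (rule direct_power_bimodule[OF N])
  interpret D: abelian_group ?D by (rule bimodule.axioms(3)[OF D])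
  obtain \<pi> where \<pi>: "\<pi> \<in> bimodule_hom R S ?D (?D\<lparr>carrier := P\<rparr>)" "\<And>p. p \<in> P \<Longrightarrow> \<pi> p = p"
    using subgroup_projection[OF D P Q PQ] by blast
  let ?\<psi> = "\<lambda>v. inv_into (carrier M) \<phi> (\<pi> v)"
  have \<psi>: "?\<psi> \<in> bimodule_hom R S ?D M"
    by (rule bimodule_hom_compose[OF \<pi>(1) bimodule_hom_inv_into[OF M \<phi>]])
  have PD: "P \<subseteq> carrier ?D"
    using P subgroup.subset[of P "add_monoid ?D"] by (simp add: subbimodule_def)
  have \<phi>P: "\<phi> m \<in> P" if "m \<in> carrier M" for m
    using bimodule_homD(2)[OF \<phi>(1) that] by simp
  define inj where "inj i a = (\<lambda>j\<in>{..<n}. if j = i then a else \<zero>\<^bsub>N\<^esub>)" for i a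
  have zl: "lact N r \<zero>\<^bsub>N\<^esub> = \<zero>\<^bsub>N\<^esub>" if "r \<in> carrier R" for r
    by (rule additive_map_zero[OF N.abelian_group_axioms N.abelian_group_axioms bimodule_lact_map[OF N that]])
  have zr: "ract N \<zero>\<^bsub>N\<^esub> s = \<zero>\<^bsub>N\<^esub>" if "s \<in> carrier S" for s
    using additive_map_zero[OF N.abelian_group_axioms N.abelian_group_axioms bimodule_ract_map[OF N that]] .
  have inj: "inj i \<in> bimodule_hom R S N ?D" if "i < n" for i
    by (intro bimodule_homI additive_mapI)
      (auto simp: inj_def direct_power_simps zl zr intro!: restrict_ext)
  have proj: "(\<lambda>v. v i) \<in> bimodule_hom R S ?D N" if "i < n" for i
    using that by (intro bimodule_homI additive_mapI) (auto simp: direct_power_simps)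
  have sum: "(\<Oplus>\<^bsub>?D\<^esub>i\<in>{..<n}. inj i (v i)) = v" if v: "v \<in> carrier ?D" for v
  proof -
    have vi: "v i \<in> carrier N" if "i < n" for i using v that by (auto simp: direct_power_simps)
    have c: "(\<Oplus>\<^bsub>?D\<^esub>i\<in>{..<n}. inj i (v i)) \<in> carrier ?D"
      using vi bimodule_homD(2)[OF inj] by (intro D.finsum_closed) auto
    have "(\<Oplus>\<^bsub>?D\<^esub>i\<in>{..<n}. inj i (v i)) j = v j" if "j < n" for j
    proof -
      have "(\<Oplus>\<^bsub>?D\<^esub>i\<in>{..<n}. inj i (v i)) j = (\<Oplus>\<^bsub>N\<^esub>i\<in>{..<n}. inj i (v i) j)"
        using additive_map_finsum[OF D.abelian_group_axioms N.abelian_group_axioms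
            bimodule_homD(1)[OF proj[OF that]], of "{..<n}" "\<lambda>i. inj i (v i)"] vi bimodule_homD(2)[OF inj]
        by simp
      also have "\<dots> = (\<Oplus>\<^bsub>N\<^esub>i\<in>{..<n}. if j = i then v i else \<zero>\<^bsub>N\<^esub>)"
        using that vi by (intro N.finsum_cong') (auto simp: inj_def)
      also have "\<dots> = v j"
        using that vi by (intro N.finsum_singleton) auto
      finally show ?thesis .
    qed
    then show ?thesis
      using c v unfolding direct_power_simps(1) by (intro direct_power_eqI)
  qed
  show ?thesis
  proof (intro exI[of _ n] exI[of _ "\<lambda>i m. \<phi> m i"] exI[of _ "\<lambda>i a. ?\<psi> (inj i a)"] conjI allI ballI impI)
    fix i assume i: "i < n"
    have "\<phi> \<in> bimodule_hom R S M ?D"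
      using \<phi>(1) PD by (auto simp: bimodule_hom_def)
    then show "(\<lambda>m. \<phi> m i) \<in> bimodule_hom R S M N"
      using bimodule_hom_compose proj[OF i] by blast
    show "(\<lambda>a. ?\<psi> (inj i a)) \<in> bimodule_hom R S N M"
      by (rule bimodule_hom_compose[OF inj[OF i] \<psi>])
  next
    fix m assume m: "m \<in> carrier M"
    have v: "\<phi> m \<in> carrier ?D" using \<phi>P[OF m] PD by blast
    then have vi: "\<phi> m i \<in> carrier N" if "i < n" for i using that by (auto simp: direct_power_simps)
    have "(\<Oplus>\<^bsub>M\<^esub>i\<in>{..<n}. ?\<psi> (inj i (\<phi> m i))) = ?\<psi> (\<Oplus>\<^bsub>?D\<^esub>i\<in>{..<n}. inj i (\<phi> m i))"
      using vi bimodule_homD(2)[OF inj]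
      by (intro additive_map_finsum[OF D.abelian_group_axioms M.abelian_group_axioms
            bimodule_homD(1)[OF \<psi>], symmetric]) auto
    also have "\<dots> = m"
      using sum[OF v] \<pi>(2)[OF \<phi>P[OF m]] \<phi>(2) m by (simp add: bij_betw_inv_into_left)
    finally show "(\<Oplus>\<^bsub>M\<^esub>i\<in>{..<n}. ?\<psi> (inj i (\<phi> m i))) = m" .
  qed
qed

section \<open>The centralizer, the bimodule T and quasibases\<close>

context ring_extension
begin

abbreviation "C \<equiv> centralizer A B"
abbreviation "C_ring \<equiv> centralizer_ring A B"
abbreviation "Tm \<equiv> T_bimodule A B"
abbreviation "T \<equiv> carrier (T_bimodule A B)"

lemma C_D: "r \<in> C \<Longrightarrow> r \<in> carrier A" "r \<in> C \<Longrightarrow> b \<in> B \<Longrightarrow> b \<otimes> r = r \<otimes> b"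
  by (simp_all add: centralizer_def)

lemma C_I: "r \<in> carrier A \<Longrightarrow> (\<And>b. b \<in> B \<Longrightarrow> b \<otimes> r = r \<otimes> b) \<Longrightarrow> r \<in> C"
  by (simp add: centralizer_def)

lemma C_subring: "subring C A"
proof (rule subringI)
  fix r s assume r: "r \<in> C" "s \<in> C"
  show "r \<otimes> s \<in> C"
  proof (rule C_I)
    fix b assume b: "b \<in> B"
    have "b \<otimes> (r \<otimes> s) = r \<otimes> b \<otimes> s"
      using r b C_D(1) C_D(2)[OF r(1) b] by (simp add: B_sub m_assoc[symmetric])
    also have "\<dots> = r \<otimes> s \<otimes> b"
      using r b C_D(1) C_D(2)[OF r(2) b] by (simp add: B_sub m_assoc)
    finally show "b \<otimes> (r \<otimes> s) = r \<otimes> s \<otimes> b" .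
  qed (use r C_D(1) in simp)
  show "r \<oplus> s \<in> C"
    by (rule C_I) (use r C_D(1) in simp, metis r C_D B_sub l_distr r_distr)
next
  fix r assume "r \<in> C"
  then show "\<ominus> r \<in> C"
    by (intro C_I) (use C_D(1) in simp, metis C_D B_sub l_minus r_minus)
qed (auto simp: centralizer_def B_sub)

lemma T_simps [simp]:
  "add Tm = add AA" "ring.zero Tm = ring.zero AA" "lact Tm = lact AA" "ract Tm = ract AA"
  by (simp_all add: T_bimodule_def)

lemma T_D: "w \<in> T \<Longrightarrow> w \<in> carrier AA" "w \<in> T \<Longrightarrow> b \<in> B \<Longrightarrow> b \<rhd> w = w \<lhd>\<^sub>A b"
  by (simp_all add: T_bimodule_def invariants_def)

lemma T_I: "w \<in> carrier AA \<Longrightarrow> (\<And>b. b \<in> B \<Longrightarrow> b \<rhd> w = w \<lhd>\<^sub>A b) \<Longrightarrow> w \<in> T"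
  by (simp add: T_bimodule_def invariants_def)

lemma T_add: "w \<in> T \<Longrightarrow> v \<in> T \<Longrightarrow> w \<oplus>\<^bsub>AA\<^esub> v \<in> T"
  using T_D by (intro T_I) (simp_all add: la_add ra_add B_sub)

lemma T_zero: "\<zero>\<^bsub>AA\<^esub> \<in> T"
  using additive_map_zero[OF AA_ag AA_ag la_map] additive_map_zero[OF AA_ag AA_ag ra_map]
  by (intro T_I) (simp_all add: B_sub)

lemma T_neg: "w \<in> T \<Longrightarrow> \<ominus>\<^bsub>AA\<^esub> w \<in> T"
  using T_D additive_map_neg[OF AA_ag AA_ag la_map] additive_map_neg[OF AA_ag AA_ag ra_map]
  by (intro T_I) (simp_all add: B_sub)

lemma T_la: "r \<in> C \<Longrightarrow> w \<in> T \<Longrightarrow> r \<rhd> w \<in> T"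
  by (rule T_I) (use T_D C_D B_sub la_mult la_ra in \<open>simp, metis\<close>)

lemma T_ra: "w \<in> T \<Longrightarrow> r \<in> C \<Longrightarrow> w \<lhd>\<^sub>A r \<in> T"
  by (rule T_I) (use T_D C_D B_sub ra_mult la_ra in \<open>simp, metis\<close>)

lemma T_bimod: "bimodule C_ring C_ring Tm"
  unfolding centralizer_ring_def T_bimodule_def
  using T_D(1) T_zero T_add T_neg T_la T_ra
  by (intro bimodule_restrict[OF AA_bimodule C_subring C_subring])
    (simp_all add: T_bimodule_def subset_iff)

sublocale Tm: abelian_group Tm
  by (rule bimodule.axioms(3)[OF T_bimod])

lemma additive_map_T:
  "additive_map AA P f \<Longrightarrow> additive_map Tm P f"
  by (auto simp: additive_map_def T_D)

text \<open>For b in B, left linearity of h brings b next to w, invariance of w carries it to the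
  other side, and there it leaves as a right factor. \<open>rmul_C\<close> and \<open>lmap_T\<close>
  follow the same route. This is what puts the quasibase coefficients of elements of T into the
  centralizer.\<close>

lemma lmul_C:
  assumes "right_linear h" "left_linear h" "w \<in> T"
  shows "lmul h w \<in> C"
  using assms T_D
  by (intro C_I) (simp_all add: lmul_closed B_sub lmul_ra[symmetric] lmul_la_B[symmetric])

lemma rmul_C:
  assumes "right_linear h" "left_linear h" "w \<in> T"
  shows "rmul h w \<in> C"
  using assms T_D
  by (intro C_I) (simp_all add: rmul_closed B_sub rmul_ra_B[symmetric] rmul_la[symmetric])

lemma lmap_T:
  assumes "right_linear h" "left_linear h" "w \<in> T"
  shows "lmap h w \<in> T"
  using assms T_D
  by (intro T_I) (simp_all add: lmap_closed B_sub lmap_ra[symmetric] lmap_la_B[symmetric])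

text \<open>Counterpart of \<open>D2_quasibase\<close> from the A-B-bimodule half of depth two. It
  expands tensors with coefficients on the left, whereas the coproduct is built from a left
  quasibase.\<close>

definition right_quasibase :: "nat \<Rightarrow> (nat \<Rightarrow> ('a, 'a) tensor) \<Rightarrow> (nat \<Rightarrow> 'a \<Rightarrow> 'a) \<Rightarrow> bool"
  where "right_quasibase m u \<gamma> \<longleftrightarrow> (\<forall>j<m. u j \<in> T \<and> right_linear (\<gamma> j) \<and> left_linear (\<gamma> j)) \<and>
    (\<forall>a\<in>carrier A. \<forall>a'\<in>carrier A. a \<boxtimes> a' = (\<Oplus>\<^bsub>AA\<^esub>j\<in>{..<m}. (a \<otimes> \<gamma> j a') \<rhd> u j))"

lemma one_elt_T: "b \<in> B \<Longrightarrow> b \<rhd> (\<one> \<boxtimes> \<one>) = (\<one> \<boxtimes> \<one>) \<lhd>\<^sub>A b"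
  using elt_balanced[of \<one> b \<one>] by (simp add: la_elt ra_elt B_sub)

lemma B_A_bimodules:
  "bimodule B_ring A AA" "bimodule A B_ring AA" "bimodule B_ring A Reg" "bimodule A B_ring Reg"
proof -
  have neg: "\<ominus>\<^bsub>AA\<^esub> w \<in> carrier AA" if "w \<in> carrier AA" for w using that by simp
  have "bimodule B_ring (A\<lparr>carrier := carrier A\<rparr>) (AA\<lparr>carrier := carrier AA\<rparr>)"
    by (rule bimodule_restrict[OF AA_bimodule subring carrier_is_subring]) (simp_all add: B_sub)
  then show "bimodule B_ring A AA" by simp
  have "bimodule (A\<lparr>carrier := carrier A\<rparr>) B_ring (AA\<lparr>carrier := carrier AA\<rparr>)"
    by (rule bimodule_restrict[OF AA_bimodule carrier_is_subring subring]) (simp_all add: B_sub)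
  then show "bimodule A B_ring AA" by simp
  show "bimodule B_ring A Reg" "bimodule A B_ring Reg"
    using regular_restrict[OF subring carrier_is_subring] regular_restrict[OF carrier_is_subring subring]
    by simp_all
qed

text \<open>A B-A-bimodule map g_i from A to the tensor square is determined by t_i = g_i(1), which
  commutes with B. A map f_i in the other direction is determined by beta_i(a) = f_i(a \<otimes> 1),
  since a \<otimes> a' = (a \<otimes> 1) a'.\<close>

lemma left_quasibase_exists:
  assumes "depth_two A B"
  shows "\<exists>n t \<beta>. D2_quasibase A B n t \<beta>"
proof -
  have sp: "summand_of_power B_ring A AA Reg"
    using assms by (simp add: depth_two_def)
  obtain n :: nat and f g where H: "(\<forall>i<n. f i \<in> bimodule_hom B_ring A AA Reg) \<and>
      (\<forall>i<n. g i \<in> bimodule_hom B_ring A Reg AA) \<and>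
      (\<forall>w\<in>carrier AA. (\<Oplus>\<^bsub>AA\<^esub>i\<in>{..<n}. g i (f i w)) = w)"
    using summand_of_power_homs[OF sp B_A_bimodules(1,3)] by (elim exE) (rule that)
  have f: "\<And>i. i < n \<Longrightarrow> f i \<in> bimodule_hom B_ring A AA Reg"
    and g: "\<And>i. i < n \<Longrightarrow> g i \<in> bimodule_hom B_ring A Reg AA"
    and fg: "\<And>w. w \<in> carrier AA \<Longrightarrow> (\<Oplus>\<^bsub>AA\<^esub>i\<in>{..<n}. g i (f i w)) = w"
    using H by simp_all
  note fD = bimodule_homD[OF f, simplified] and gD = bimodule_homD[OF g, simplified]
  have t: "g i \<one> \<in> T" if "i < n" for i
  proof (rule T_I)
    fix b assume b: "b \<in> B"
    then show "b \<rhd> g i \<one> = g i \<one> \<lhd>\<^sub>A b"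
      using gD(4)[OF that b, of \<one>] gD(5)[OF that, of \<one> b] by (simp add: B_sub)
  qed (simp add: gD that)
  have \<beta>: "(\<lambda>a. f i (a \<boxtimes> \<one>)) \<in> bimodule_hom B_ring B_ring Reg Reg" if i: "i < n" for i
    unfolding hom_BB right_linear_def left_linear_def
  proof (intro conjI ballI)
    show "additive_map A A (\<lambda>a. f i (a \<boxtimes> \<one>))" "additive_map A A (\<lambda>a. f i (a \<boxtimes> \<one>))"
      by (rule additive_map_compose[OF elt_map_left fD(1)]; simp add: i)+
    fix a b assume ab: "a \<in> carrier A" "b \<in> B"
    show "f i ((a \<otimes> b) \<boxtimes> \<one>) = f i (a \<boxtimes> \<one>) \<otimes> b"
      using fD(5)[OF i, of "a \<boxtimes> \<one>" b] ab by (simp add: B_sub ra_elt elt_balanced)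
    show "f i ((b \<otimes> a) \<boxtimes> \<one>) = b \<otimes> f i (a \<boxtimes> \<one>)"
      using fD(4)[OF i, of b "a \<boxtimes> \<one>"] ab by (simp add: B_sub la_elt)
  qed
  have sum: "a \<boxtimes> a' = (\<Oplus>\<^bsub>AA\<^esub>i\<in>{..<n}. g i \<one> \<lhd>\<^sub>A (f i (a \<boxtimes> \<one>) \<otimes> a'))"
    if a: "a \<in> carrier A" "a' \<in> carrier A" for a a'
  proof -
    have "g i (f i (a \<boxtimes> a')) = g i \<one> \<lhd>\<^sub>A (f i (a \<boxtimes> \<one>) \<otimes> a')" if i: "i < n" for i
      using fD(5)[OF i, of "a \<boxtimes> \<one>" a'] gD(5)[OF i, of \<one> "f i (a \<boxtimes> \<one>) \<otimes> a'"] a i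
      by (simp add: ra_elt fD(2))
    then have "(\<Oplus>\<^bsub>AA\<^esub>i\<in>{..<n}. g i \<one> \<lhd>\<^sub>A (f i (a \<boxtimes> \<one>) \<otimes> a')) = (\<Oplus>\<^bsub>AA\<^esub>i\<in>{..<n}. g i (f i (a \<boxtimes> a')))"
      using a fD(2) gD(2) by (intro AA.finsum_cong') auto
    then show ?thesis using fg[of "a \<boxtimes> a'"] a by simp
  qed
  have "D2_quasibase A B n (\<lambda>i. g i \<one>) (\<lambda>i a. f i (a \<boxtimes> \<one>))"
    unfolding D2_quasibase_def by (intro conjI ballI Pi_I t \<beta> sum) simp_all
  then show ?thesis by blast
qed

text \<open>Mirror image of \<open>left_quasibase_exists\<close>: u_j = g_j(1) and gamma_j(a) =
  f_j(1 \<otimes> a), because a \<otimes> a' = a (1 \<otimes> a').\<close>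

lemma right_quasibase_exists:
  assumes "depth_two A B"
  shows "\<exists>m u \<gamma>. right_quasibase m u \<gamma>"
proof -
  have sp: "summand_of_power A B_ring AA Reg"
    using assms by (simp add: depth_two_def)
  obtain n :: nat and f g where H: "(\<forall>i<n. f i \<in> bimodule_hom A B_ring AA Reg) \<and>
      (\<forall>i<n. g i \<in> bimodule_hom A B_ring Reg AA) \<and>
      (\<forall>w\<in>carrier AA. (\<Oplus>\<^bsub>AA\<^esub>i\<in>{..<n}. g i (f i w)) = w)"
    using summand_of_power_homs[OF sp B_A_bimodules(2,4)] by (elim exE) (rule that)
  have f: "\<And>i. i < n \<Longrightarrow> f i \<in> bimodule_hom A B_ring AA Reg"
    and g: "\<And>i. i < n \<Longrightarrow> g i \<in> bimodule_hom A B_ring Reg AA"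
    and fg: "\<And>w. w \<in> carrier AA \<Longrightarrow> (\<Oplus>\<^bsub>AA\<^esub>i\<in>{..<n}. g i (f i w)) = w"
    using H by simp_all
  note fD = bimodule_homD[OF f, simplified] and gD = bimodule_homD[OF g, simplified]
  have u: "g i \<one> \<in> T" if "i < n" for i
  proof (rule T_I)
    fix b assume b: "b \<in> B"
    then show "b \<rhd> g i \<one> = g i \<one> \<lhd>\<^sub>A b"
      using gD(4)[OF that, of b \<one>] gD(5)[OF that, of \<one> b] by (simp add: B_sub)
  qed (simp add: gD that)
  have \<gamma>: "right_linear (\<lambda>a. f i (\<one> \<boxtimes> a)) \<and> left_linear (\<lambda>a. f i (\<one> \<boxtimes> a))" if i: "i < n" for i
    unfolding right_linear_def left_linear_def
  proof (intro conjI ballI)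
    show "additive_map A A (\<lambda>a. f i (\<one> \<boxtimes> a))" "additive_map A A (\<lambda>a. f i (\<one> \<boxtimes> a))"
      by (rule additive_map_compose[OF elt_map_right fD(1)]; simp add: i)+
    fix a b assume ab: "a \<in> carrier A" "b \<in> B"
    show "f i (\<one> \<boxtimes> (a \<otimes> b)) = f i (\<one> \<boxtimes> a) \<otimes> b"
      using fD(5)[OF i, of "\<one> \<boxtimes> a" b] ab by (simp add: B_sub ra_elt)
    show "f i (\<one> \<boxtimes> (b \<otimes> a)) = b \<otimes> f i (\<one> \<boxtimes> a)"
      using fD(4)[OF i, of b "\<one> \<boxtimes> a"] ab elt_balanced[of \<one> b a] by (simp add: B_sub la_elt)
  qed
  have sum: "a \<boxtimes> a' = (\<Oplus>\<^bsub>AA\<^esub>i\<in>{..<n}. (a \<otimes> f i (\<one> \<boxtimes> a')) \<rhd> g i \<one>)"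
    if a: "a \<in> carrier A" "a' \<in> carrier A" for a a'
  proof -
    have "g i (f i (a \<boxtimes> a')) = (a \<otimes> f i (\<one> \<boxtimes> a')) \<rhd> g i \<one>" if i: "i < n" for i
      using fD(4)[OF i, of a "\<one> \<boxtimes> a'"] gD(4)[OF i, of "a \<otimes> f i (\<one> \<boxtimes> a')" \<one>] a i
      by (simp add: la_elt fD(2))
    then have "(\<Oplus>\<^bsub>AA\<^esub>i\<in>{..<n}. (a \<otimes> f i (\<one> \<boxtimes> a')) \<rhd> g i \<one>) = (\<Oplus>\<^bsub>AA\<^esub>i\<in>{..<n}. g i (f i (a \<boxtimes> a')))"
      using a fD(2) gD(2) by (intro AA.finsum_cong') auto
    then show ?thesis using fg[of "a \<boxtimes> a'"] a by simp
  qed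
  have "right_quasibase n (\<lambda>i. g i \<one>) (\<lambda>i a. f i (\<one> \<boxtimes> a))"
    unfolding right_quasibase_def
    by (intro conjI ballI allI impI u \<gamma>[THEN conjunct1] \<gamma>[THEN conjunct2] sum)
  then show ?thesis by blast
qed

end

locale left_quasibased = ring_extension +
  fixes n :: nat and t :: "nat \<Rightarrow> ('a, 'a) tensor" and \<beta> :: "nat \<Rightarrow> 'a \<Rightarrow> 'a"
  assumes quasibase: "D2_quasibase A B n t \<beta>"
begin

lemma t_T: "i < n \<Longrightarrow> t i \<in> T"
  using quasibase by (auto simp: D2_quasibase_def)

lemma t_AA: "i < n \<Longrightarrow> t i \<in> carrier AA"
  using t_T T_D(1) by blast

lemma \<beta>_lin: "i < n \<Longrightarrow> right_linear (\<beta> i)" "i < n \<Longrightarrow> left_linear (\<beta> i)"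
  using quasibase hom_BB by (auto simp: D2_quasibase_def)

lemma \<beta>_closed: "i < n \<Longrightarrow> a \<in> carrier A \<Longrightarrow> \<beta> i a \<in> carrier A"
  using \<beta>_lin right_linearD by blast

lemma quasibase_elt:
  "a \<in> carrier A \<Longrightarrow> a' \<in> carrier A \<Longrightarrow> a \<boxtimes> a' = (\<Oplus>\<^bsub>AA\<^esub>i\<in>{..<n}. t i \<lhd>\<^sub>A (\<beta> i a \<otimes> a'))"
  using quasibase by (simp add: D2_quasibase_def)

lemma left_expansion:
  assumes "w \<in> carrier AA"
  shows "(\<Oplus>\<^bsub>AA\<^esub>i\<in>{..<n}. t i \<lhd>\<^sub>A lmul (\<beta> i) w) = w"
proof (rule AA_ext[OF AA_ag additive_map_sum[OF AA_ag] additive_map_id])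
  fix i assume "i \<in> {..<n}"
  then show "additive_map AA AA (\<lambda>w. t i \<lhd>\<^sub>A lmul (\<beta> i) w)"
    by (intro additive_map_compose[OF lmul_map ra_add_map]) (simp_all add: \<beta>_lin t_AA)
next
  fix x y assume xy: "x \<in> carrier A" "y \<in> carrier A"
  have "(\<Oplus>\<^bsub>AA\<^esub>i\<in>{..<n}. t i \<lhd>\<^sub>A lmul (\<beta> i) (x \<boxtimes> y)) = (\<Oplus>\<^bsub>AA\<^esub>i\<in>{..<n}. t i \<lhd>\<^sub>A (\<beta> i x \<otimes> y))"
    using xy by (intro AA.finsum_cong') (auto simp: lin_elts \<beta>_lin t_AA \<beta>_closed)
  then show "(\<Oplus>\<^bsub>AA\<^esub>i\<in>{..<n}. t i \<lhd>\<^sub>A lmul (\<beta> i) (x \<boxtimes> y)) = x \<boxtimes> y"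
    using quasibase_elt xy by simp
qed (simp_all add: assms)

lemma lmul_lmap_expansion:
  assumes h: "right_linear h" and w: "w \<in> carrier AA"
  shows "(\<Oplus>\<^bsub>AA\<^esub>i\<in>{..<n}. lmul h (t i) \<rhd> lmap (\<beta> i) w) = lmap h w"
proof (rule AA_ext[OF AA_ag additive_map_sum[OF AA_ag] lmap_map[OF h] _ w])
  fix i assume "i \<in> {..<n}"
  then show "additive_map AA AA (\<lambda>w. lmul h (t i) \<rhd> lmap (\<beta> i) w)"
    by (intro additive_map_compose[OF lmap_map la_map]) (simp_all add: \<beta>_lin t_AA lmul_closed h)
next
  fix x y assume xy: "x \<in> carrier A" "y \<in> carrier A"
  have c: "(\<lambda>i. lmul h (t i) \<otimes> \<beta> i x) \<in> {..<n} \<rightarrow> carrier A"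
    using xy by (auto simp: lmul_closed h t_AA \<beta>_closed)
  have "(\<Oplus>\<^bsub>AA\<^esub>i\<in>{..<n}. lmul h (t i) \<rhd> lmap (\<beta> i) (x \<boxtimes> y)) =
      (\<Oplus>\<^bsub>AA\<^esub>i\<in>{..<n}. (lmul h (t i) \<otimes> \<beta> i x) \<boxtimes> y)"
    using xy c by (intro AA.finsum_cong') (auto simp: lin_elts la_elt \<beta>_lin t_AA \<beta>_closed lmul_closed h)
  also have "\<dots> = (\<Oplus>i\<in>{..<n}. lmul h (t i) \<otimes> \<beta> i x) \<boxtimes> y"
    using c xy by (intro additive_map_finsum[OF A_ag AA_ag elt_map_left, symmetric]) auto
  \<comment> \<open>As \<open>lmul h\<close> is right A-linear, the coefficient is the value of
    \<open>lmul h\<close> on the quasibase expansion of x \<otimes> 1, which is h(x). The factor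
    \<one> only brings the expansion to the shape of \<open>quasibase_elt\<close>.\<close>
  also have "(\<Oplus>i\<in>{..<n}. lmul h (t i) \<otimes> \<beta> i x) = (\<Oplus>i\<in>{..<n}. lmul h (t i \<lhd>\<^sub>A (\<beta> i x \<otimes> \<one>)))"
    using xy by (intro finsum_cong') (auto simp: lmul_ra lmul_closed h t_AA \<beta>_closed)
  also have "\<dots> = lmul h (x \<boxtimes> \<one>)"
    unfolding quasibase_elt[OF xy(1) one_closed]
    using xy by (intro additive_map_finsum[OF AA_ag A_ag lmul_map[OF h], symmetric]) (auto simp: t_AA \<beta>_closed)
  also have "\<dots> \<boxtimes> y = lmap h (x \<boxtimes> y)"
    using xy by (simp add: lin_elts h right_linearD(2)[OF h])
  finally show "(\<Oplus>\<^bsub>AA\<^esub>i\<in>{..<n}. lmul h (t i) \<rhd> lmap (\<beta> i) (x \<boxtimes> y)) = lmap h (x \<boxtimes> y)" .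
qed simp

end

locale right_quasibased = ring_extension +
  fixes m :: nat and u :: "nat \<Rightarrow> ('a, 'a) tensor" and \<gamma> :: "nat \<Rightarrow> 'a \<Rightarrow> 'a"
  assumes rquasibase: "right_quasibase m u \<gamma>"
begin

lemma u_T: "j < m \<Longrightarrow> u j \<in> T"
  using rquasibase by (auto simp: right_quasibase_def)

lemma u_AA: "j < m \<Longrightarrow> u j \<in> carrier AA"
  using u_T T_D(1) by blast

lemma \<gamma>_lin: "j < m \<Longrightarrow> right_linear (\<gamma> j)" "j < m \<Longrightarrow> left_linear (\<gamma> j)"
  using rquasibase by (auto simp: right_quasibase_def)

lemma \<gamma>_closed: "j < m \<Longrightarrow> a \<in> carrier A \<Longrightarrow> \<gamma> j a \<in> carrier A"
  using \<gamma>_lin right_linearD by blast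

lemma right_expansion:
  assumes "w \<in> carrier AA"
  shows "(\<Oplus>\<^bsub>AA\<^esub>j\<in>{..<m}. rmul (\<gamma> j) w \<rhd> u j) = w"
proof (rule AA_ext[OF AA_ag additive_map_sum[OF AA_ag] additive_map_id])
  fix j assume "j \<in> {..<m}"
  then show "additive_map AA AA (\<lambda>w. rmul (\<gamma> j) w \<rhd> u j)"
    by (intro additive_map_compose[OF rmul_map la_add_map]) (simp_all add: \<gamma>_lin u_AA)
next
  fix x y assume xy: "x \<in> carrier A" "y \<in> carrier A"
  have "(\<Oplus>\<^bsub>AA\<^esub>j\<in>{..<m}. rmul (\<gamma> j) (x \<boxtimes> y) \<rhd> u j) = (\<Oplus>\<^bsub>AA\<^esub>j\<in>{..<m}. (x \<otimes> \<gamma> j y) \<rhd> u j)"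
    using xy by (intro AA.finsum_cong') (auto simp: lin_elts \<gamma>_lin u_AA \<gamma>_closed)
  then show "(\<Oplus>\<^bsub>AA\<^esub>j\<in>{..<m}. rmul (\<gamma> j) (x \<boxtimes> y) \<rhd> u j) = x \<boxtimes> y"
    using rquasibase xy by (simp add: right_quasibase_def)
qed (simp_all add: assms)

end

section \<open>Sandwich forms of a B-B-bimodule endomorphism\<close>

context ring_extension
begin

lemma right_linearI:
  assumes "additive_map A A h" "\<And>a b. a \<in> carrier A \<Longrightarrow> b \<in> B \<Longrightarrow> h (a \<otimes> b) = h a \<otimes> b"
  shows "right_linear h"
  using assms by (simp add: right_linear_def)

lemma left_linearI:
  assumes "additive_map A A h" "\<And>a b. a \<in> carrier A \<Longrightarrow> b \<in> B \<Longrightarrow> h (b \<otimes> a) = b \<otimes> h a"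
  shows "left_linear h"
  using assms by (simp add: left_linear_def)

text \<open>\<open>fleft f c x = c\<^sup>1 f(c\<^sup>2x)\<close> and \<open>fright f c q = f(q c\<^sup>1) c\<^sup>2\<close>.\<close>

definition fleft :: "('a \<Rightarrow> 'a) \<Rightarrow> ('a, 'a) tensor \<Rightarrow> 'a \<Rightarrow> 'a"
  where "fleft f c x = rmul (\<lambda>q. f (q \<otimes> x)) c"

definition fright :: "('a \<Rightarrow> 'a) \<Rightarrow> ('a, 'a) tensor \<Rightarrow> 'a \<Rightarrow> 'a"
  where "fright f c q = lmul (\<lambda>x. f (q \<otimes> x)) c"

text \<open>\<open>sandwich f c d = c\<^sup>1 f(c\<^sup>2d\<^sup>1) d\<^sup>2\<close>, and the tensors
  \<open>sandwich_l f c d = c\<^sup>1 f(c\<^sup>2d\<^sup>1) \<otimes> d\<^sup>2\<close>, \<open>sandwich_r f c d = c\<^sup>1 \<otimes> f(c\<^sup>2d\<^sup>1) d\<^sup>2\<close>.\<close>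

definition sandwich :: "('a \<Rightarrow> 'a) \<Rightarrow> ('a, 'a) tensor \<Rightarrow> ('a, 'a) tensor \<Rightarrow> 'a"
  where "sandwich f c d = lmul (fleft f c) d"

definition sandwich_l :: "('a \<Rightarrow> 'a) \<Rightarrow> ('a, 'a) tensor \<Rightarrow> ('a, 'a) tensor \<Rightarrow> ('a, 'a) tensor"
  where "sandwich_l f c d = lmap (fleft f c) d"

definition sandwich_r :: "('a \<Rightarrow> 'a) \<Rightarrow> ('a, 'a) tensor \<Rightarrow> ('a, 'a) tensor \<Rightarrow> ('a, 'a) tensor"
  where "sandwich_r f c d = rmap (fright f d) c"

end

locale bilinear_endo = ring_extension +
  fixes f :: "'a \<Rightarrow> 'a"
  assumes f_right: "right_linear f" and f_left: "left_linear f"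
begin

lemmas f_map = right_linearD(1)[OF f_right]
lemmas f_closed [simp] = right_linearD(2)[OF f_right]
lemmas f_B_right = right_linearD(3)[OF f_right]
lemmas f_B_left = left_linearD(3)[OF f_left]
lemmas f_add = additive_mapD(2)[OF f_map]

lemma f_mult_left: "x \<in> carrier A \<Longrightarrow> left_linear (\<lambda>q. f (q \<otimes> x))"
  by (rule left_linear_comp[OF f_left left_linear_mult])

lemma f_mult_right: "q \<in> carrier A \<Longrightarrow> right_linear (\<lambda>x. f (q \<otimes> x))"
  by (rule right_linear_comp[OF f_right right_linear_mult])

lemma fleft_elt:
  "p \<in> carrier A \<Longrightarrow> q \<in> carrier A \<Longrightarrow> x \<in> carrier A \<Longrightarrow> fleft f (p \<boxtimes> q) x = p \<otimes> f (q \<otimes> x)"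
  by (simp add: fleft_def rmul_elt f_mult_left)

lemma fright_elt:
  "q \<in> carrier A \<Longrightarrow> x \<in> carrier A \<Longrightarrow> y \<in> carrier A \<Longrightarrow> fright f (x \<boxtimes> y) q = f (q \<otimes> x) \<otimes> y"
  by (simp add: fright_def lmul_elt f_mult_right)

lemma fleft_map: "x \<in> carrier A \<Longrightarrow> additive_map AA A (\<lambda>c. fleft f c x)"
  by (simp add: fleft_def rmul_map f_mult_left)

lemma fright_map: "q \<in> carrier A \<Longrightarrow> additive_map AA A (\<lambda>c. fright f c q)"
  by (simp add: fright_def lmul_map f_mult_right)

lemmas fleft_closed = additive_mapD(1)[OF fleft_map]
lemmas fright_closed = additive_mapD(1)[OF fright_map]

lemma fleft_right_linear:
  assumes "c \<in> carrier AA"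
  shows "right_linear (fleft f c)"
proof (rule right_linearI, rule additive_mapI)
  fix x assume "x \<in> carrier A"
  then show "fleft f c x \<in> carrier A" using assms by (simp add: fleft_closed)
next
  fix x x' assume x: "x \<in> carrier A" "x' \<in> carrier A"
  show "fleft f c (x \<oplus> x') = fleft f c x \<oplus> fleft f c x'"
    by (rule AA_ext[OF A_ag fleft_map additive_map_plus[OF A_ag fleft_map fleft_map] _ assms])
      (simp_all add: x fleft_elt r_distr f_add)
next
  fix x b assume x: "x \<in> carrier A" "b \<in> B"
  show "fleft f c (x \<otimes> b) = fleft f c x \<otimes> b"
    by (rule AA_ext[OF A_ag fleft_map additive_map_compose[OF fleft_map mult_map_right] _ assms])
      (simp_all add: x fleft_elt B_sub f_B_right m_assoc[symmetric])
qed

lemma fright_left_linear: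
  assumes "c \<in> carrier AA"
  shows "left_linear (fright f c)"
proof (rule left_linearI, rule additive_mapI)
  fix x assume "x \<in> carrier A"
  then show "fright f c x \<in> carrier A" using assms by (simp add: fright_closed)
next
  fix x x' assume x: "x \<in> carrier A" "x' \<in> carrier A"
  show "fright f c (x \<oplus> x') = fright f c x \<oplus> fright f c x'"
    by (rule AA_ext[OF A_ag fright_map additive_map_plus[OF A_ag fright_map fright_map] _ assms])
      (simp_all add: x fright_elt l_distr f_add)
next
  fix x b assume x: "x \<in> carrier A" "b \<in> B"
  show "fright f c (b \<otimes> x) = b \<otimes> fright f c x"
    by (rule AA_ext[OF A_ag fright_map additive_map_compose[OF fright_map mult_map_left] _ assms])
      (simp_all add: x fright_elt B_sub f_B_left m_assoc)
qed

abbreviation "bil \<equiv> sandwich f"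
abbreviation "bil_l \<equiv> sandwich_l f"
abbreviation "bil_r \<equiv> sandwich_r f"

lemmas bil_def = sandwich_def[of f]
lemmas bil_l_def = sandwich_l_def[of f]
lemmas bil_r_def = sandwich_r_def[of f]

lemma bil_elt_right:
  "c \<in> carrier AA \<Longrightarrow> x \<in> carrier A \<Longrightarrow> y \<in> carrier A \<Longrightarrow> bil c (x \<boxtimes> y) = fleft f c x \<otimes> y"
  by (simp add: bil_def lmul_elt fleft_right_linear)

lemma bil_map_right: "c \<in> carrier AA \<Longrightarrow> additive_map AA A (bil c)"
  unfolding bil_def by (rule lmul_map[OF fleft_right_linear])

lemma bil_map_left:
  assumes "d \<in> carrier AA"
  shows "additive_map AA A (\<lambda>c. bil c d)"
proof (rule additive_mapI)
  fix c assume "c \<in> carrier AA"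
  then show "bil c d \<in> carrier A" using assms additive_mapD(1)[OF bil_map_right] by blast
next
  fix c c' assume c: "c \<in> carrier AA" "c' \<in> carrier AA"
  then have cc: "c \<oplus>\<^bsub>AA\<^esub> c' \<in> carrier AA" by simp
  show "bil (c \<oplus>\<^bsub>AA\<^esub> c') d = bil c d \<oplus> bil c' d"
    by (rule AA_ext[OF A_ag bil_map_right[OF cc]
          additive_map_plus[OF A_ag bil_map_right[OF c(1)] bil_map_right[OF c(2)]] _ assms])
      (simp_all add: c cc bil_elt_right additive_mapD(2)[OF fleft_map] l_distr fleft_closed)
qed

lemmas bil_closed = additive_mapD(1)[OF bil_map_right]

text \<open>The definition of the form reads it as a function of d and makes right linearity in d
  evident. This second reading, as a function of c, does the same for left linearity in c
  (\<open>bil_la\<close>).\<close>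

lemma bil_eq_rmul:
  assumes c: "c \<in> carrier AA" and d: "d \<in> carrier AA"
  shows "bil c d = rmul (fright f d) c"
proof (rule AA_ext[OF A_ag bil_map_left[OF d] rmul_map[OF fright_left_linear[OF d]] _ c])
  fix p q assume pq: "p \<in> carrier A" "q \<in> carrier A"
  have "bil (p \<boxtimes> q) d = p \<otimes> fright f d q"
    by (rule AA_ext[OF A_ag bil_map_right additive_map_compose[OF fright_map mult_map_left] _ d])
      (simp_all add: pq bil_elt_right fleft_elt fright_elt m_assoc)
  then show "bil (p \<boxtimes> q) d = rmul (fright f d) (p \<boxtimes> q)"
    using pq d by (simp add: rmul_elt fright_left_linear)
qed

lemma bil_elt_left:
  "d \<in> carrier AA \<Longrightarrow> p \<in> carrier A \<Longrightarrow> q \<in> carrier A \<Longrightarrow> bil (p \<boxtimes> q) d = p \<otimes> fright f d q"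
  by (simp add: bil_eq_rmul rmul_elt fright_left_linear)

lemma bil_la:
  assumes "c \<in> carrier AA" "d \<in> carrier AA" "a \<in> carrier A"
  shows "bil (a \<rhd> c) d = a \<otimes> bil c d"
  using assms by (simp add: bil_eq_rmul rmul_la fright_left_linear)

lemma bil_ra:
  assumes "c \<in> carrier AA" "d \<in> carrier AA" "a \<in> carrier A"
  shows "bil c (d \<lhd>\<^sub>A a) = bil c d \<otimes> a"
  using assms by (simp add: bil_def lmul_ra fleft_right_linear)

text \<open>Both sides are c^1 f(c^2 a d^1) d^2.\<close>

lemma bil_middle:
  assumes c: "c \<in> carrier AA" and d: "d \<in> carrier AA" and a: "a \<in> carrier A"
  shows "bil (c \<lhd>\<^sub>A a) d = bil c (a \<rhd> d)"
proof (rule AA_ext[OF A_ag additive_map_compose[OF ra_map[OF a] bil_map_left[OF d]] bil_map_left _ c])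
  fix p q assume pq: "p \<in> carrier A" "q \<in> carrier A"
  show "bil ((p \<boxtimes> q) \<lhd>\<^sub>A a) d = bil (p \<boxtimes> q) (a \<rhd> d)"
    by (rule AA_ext[OF A_ag bil_map_right additive_map_compose[OF la_map bil_map_right] _ d])
      (simp_all add: pq a ra_elt la_elt bil_elt_right fleft_elt m_assoc)
qed (simp add: a d)

text \<open>An element b of B travels through the form from left to right: past c because c is in T,
  across the middle by \<open>bil_middle\<close>, and past d because d is in T.\<close>

lemma bil_C:
  assumes "c \<in> T" "d \<in> T"
  shows "bil c d \<in> C"
proof (rule C_I)
  note c = T_D(1)[OF assms(1)] and d = T_D(1)[OF assms(2)]
  show "bil c d \<in> carrier A" using c d by (simp add: bil_closed)
  fix b assume b: "b \<in> B"
  have "b \<otimes> bil c d = bil (c \<lhd>\<^sub>A b) d"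
    using T_D(2)[OF assms(1) b] bil_la[OF c d B_sub[OF b]] by simp
  also have "\<dots> = bil c d \<otimes> b"
    using T_D(2)[OF assms(2) b] bil_ra[OF c d B_sub[OF b]] bil_middle[OF c d B_sub[OF b]] by simp
  finally show "b \<otimes> bil c d = bil c d \<otimes> b" .
qed

lemma bil_l_map_right: "c \<in> carrier AA \<Longrightarrow> additive_map AA AA (bil_l c)"
  unfolding bil_l_def by (rule lmap_map[OF fleft_right_linear])

lemma bil_r_map_left: "d \<in> carrier AA \<Longrightarrow> additive_map AA AA (\<lambda>c. bil_r c d)"
  unfolding bil_r_def by (rule rmap_map[OF fright_left_linear])

lemma bil_l_elt_right:
  "c \<in> carrier AA \<Longrightarrow> x \<in> carrier A \<Longrightarrow> y \<in> carrier A \<Longrightarrow> bil_l c (x \<boxtimes> y) = fleft f c x \<boxtimes> y"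
  by (simp add: bil_l_def lmap_elt fleft_right_linear)

lemma bil_r_elt_left:
  "d \<in> carrier AA \<Longrightarrow> p \<in> carrier A \<Longrightarrow> q \<in> carrier A \<Longrightarrow> bil_r (p \<boxtimes> q) d = p \<boxtimes> fright f d q"
  by (simp add: bil_r_def rmap_elt fright_left_linear)

lemma bil_l_map_left:
  assumes "d \<in> carrier AA"
  shows "additive_map AA AA (\<lambda>c. bil_l c d)"
proof (rule additive_mapI)
  fix c assume "c \<in> carrier AA"
  then show "bil_l c d \<in> carrier AA" using assms additive_mapD(1)[OF bil_l_map_right] by blast
next
  fix c c' assume c: "c \<in> carrier AA" "c' \<in> carrier AA"
  then have cc: "c \<oplus>\<^bsub>AA\<^esub> c' \<in> carrier AA" by simp
  show "bil_l (c \<oplus>\<^bsub>AA\<^esub> c') d = bil_l c d \<oplus>\<^bsub>AA\<^esub> bil_l c' d"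
    by (rule AA_ext[OF AA_ag bil_l_map_right[OF cc]
          additive_map_plus[OF AA_ag bil_l_map_right[OF c(1)] bil_l_map_right[OF c(2)]] _ assms])
      (simp_all add: c cc bil_l_elt_right additive_mapD(2)[OF fleft_map] elt_add_left fleft_closed)
qed

lemma bil_r_map_right:
  assumes "c \<in> carrier AA"
  shows "additive_map AA AA (bil_r c)"
proof (rule additive_mapI)
  fix d assume "d \<in> carrier AA"
  then show "bil_r c d \<in> carrier AA" using assms additive_mapD(1)[OF bil_r_map_left] by blast
next
  fix d d' assume d: "d \<in> carrier AA" "d' \<in> carrier AA"
  then have dd: "d \<oplus>\<^bsub>AA\<^esub> d' \<in> carrier AA" by simp
  show "bil_r c (d \<oplus>\<^bsub>AA\<^esub> d') = bil_r c d \<oplus>\<^bsub>AA\<^esub> bil_r c d'"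
    by (rule AA_ext[OF AA_ag bil_r_map_left[OF dd]
          additive_map_plus[OF AA_ag bil_r_map_left[OF d(1)] bil_r_map_left[OF d(2)]] _ assms])
      (simp_all add: d dd bil_r_elt_left additive_mapD(2)[OF fright_map] elt_add_right fright_closed)
qed

lemma bil_l_la:
  assumes c: "c \<in> carrier AA" and d: "d \<in> carrier AA" and a: "a \<in> carrier A"
  shows "bil_l (a \<rhd> c) d = a \<rhd> bil_l c d"
proof -
  have "fleft f (a \<rhd> c) x = a \<otimes> fleft f c x" if "x \<in> carrier A" for x
    using that c a by (simp add: fleft_def rmul_la f_mult_left)
  then show ?thesis
    by (intro AA_ext[OF AA_ag bil_l_map_right additive_map_compose[OF bil_l_map_right la_map] _ d])
      (simp_all add: c a la_elt bil_l_elt_right fleft_closed)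
qed

lemma bil_r_ra:
  assumes c: "c \<in> carrier AA" and d: "d \<in> carrier AA" and a: "a \<in> carrier A"
  shows "bil_r c (d \<lhd>\<^sub>A a) = bil_r c d \<lhd>\<^sub>A a"
proof -
  have "fright f (d \<lhd>\<^sub>A a) x = fright f d x \<otimes> a" if "x \<in> carrier A" for x
    using that d a by (simp add: fright_def lmul_ra f_mult_right)
  then show ?thesis
    by (intro AA_ext[OF AA_ag bil_r_map_left additive_map_compose[OF bil_r_map_left ra_map] _ c])
      (simp_all add: d a ra_elt bil_r_elt_left fright_closed)
qed

lemma bil_l_ra:
  "c \<in> carrier AA \<Longrightarrow> d \<in> carrier AA \<Longrightarrow> a \<in> carrier A \<Longrightarrow> bil_l c (d \<lhd>\<^sub>A a) = bil_l c d \<lhd>\<^sub>A a"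
  by (simp add: bil_l_def lmap_ra fleft_right_linear)

lemma bil_r_la:
  "c \<in> carrier AA \<Longrightarrow> d \<in> carrier AA \<Longrightarrow> a \<in> carrier A \<Longrightarrow> bil_r (a \<rhd> c) d = a \<rhd> bil_r c d"
  by (simp add: bil_r_def rmap_la fright_left_linear)

end

section \<open>The two sides of the Frobenius condition for a sandwich form\<close>

context left_quasibased
begin

text \<open>This is the value of <c, d_(1)> d_(2). The form with first argument c is
  \<open>lmul\<close> of the right B-linear map \<open>fleft f c\<close>, so the general expansion
  applies with h = \<open>fleft f c\<close>.\<close>

lemma frobenius_left_side:
  assumes "bilinear_endo A B f" "c \<in> carrier AA" "d \<in> carrier AA"
  shows "(\<Oplus>\<^bsub>AA\<^esub>i\<in>{..<n}. sandwich f c (t i) \<rhd> lmap (\<beta> i) d) = sandwich_l f c d"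
proof -
  interpret bilinear_endo A B f by fact
  show ?thesis
    unfolding bil_def bil_l_def
    by (rule lmul_lmap_expansion[OF fleft_right_linear[OF assms(2)] assms(3)])
qed

text \<open>This is the value of c_(1) <c_(2), d>. Here beta_i meets only the outer leg p of c = p
  \<otimes> q, so the sum is the quasibase expansion of p \<otimes> f(q d^1) d^2.\<close>

lemma frobenius_right_side:
  assumes "bilinear_endo A B f" "c \<in> carrier AA" "d \<in> carrier AA"
  shows "(\<Oplus>\<^bsub>AA\<^esub>i\<in>{..<n}. t i \<lhd>\<^sub>A sandwich f (lmap (\<beta> i) c) d) = sandwich_r f c d"
proof -
  interpret bilinear_endo A B f by fact
  show ?thesis
  proof (rule AA_ext[OF AA_ag additive_map_sum[OF AA_ag] bil_r_map_left _ assms(2)])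
    fix i assume "i \<in> {..<n}"
    then show "additive_map AA AA (\<lambda>c. t i \<lhd>\<^sub>A bil (lmap (\<beta> i) c) d)"
      by (intro additive_map_compose[OF lmap_map] additive_map_compose[OF bil_map_left ra_add_map])
        (simp_all add: \<beta>_lin t_AA assms)
  next
    fix p q assume pq: "p \<in> carrier A" "q \<in> carrier A"
    have fr: "fright f d q \<in> carrier A" using pq assms by (simp add: fright_closed)
    have "(\<Oplus>\<^bsub>AA\<^esub>i\<in>{..<n}. t i \<lhd>\<^sub>A bil (lmap (\<beta> i) (p \<boxtimes> q)) d) =
        (\<Oplus>\<^bsub>AA\<^esub>i\<in>{..<n}. t i \<lhd>\<^sub>A (\<beta> i p \<otimes> fright f d q))"
      using pq fr by (intro AA.finsum_cong') (auto simp: lin_elts \<beta>_lin \<beta>_closed t_AA bil_elt_left assms)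
    then show "(\<Oplus>\<^bsub>AA\<^esub>i\<in>{..<n}. t i \<lhd>\<^sub>A bil (lmap (\<beta> i) (p \<boxtimes> q)) d) = bil_r (p \<boxtimes> q) d"
      using pq fr quasibase_elt[of p "fright f d q"] by (simp add: bil_r_elt_left assms)
  qed (simp_all add: assms)
qed

end

section \<open>The coring of a depth two extension\<close>

lemma bimodule_cong:
  assumes "bimodule R S M" "carrier N = carrier M" "add N = add M" "ring.zero N = ring.zero M"
    "lact N = lact M" "ract N = ract M"
  shows "bimodule R S N"
proof -
  note M = assms(1)
  have ag: "abelian_group N"
    by (rule abelian_groupI, unfold assms(2-))
      (fact abelian_groupE[OF bimodule.axioms(3)[OF M]])+
  show ?thesis
    by (rule bimodule.intro[OF bimodule.axioms(1,2)[OF M] ag], rule bimodule_axioms.intro, unfold assms(2-))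
      (fact bimodule.lact_closed[OF M] bimodule.lact_add[OF M] bimodule.add_lact[OF M]
        bimodule.mult_lact[OF M] bimodule.one_lact[OF M] bimodule.ract_closed[OF M]
        bimodule.ract_add[OF M] bimodule.add_ract[OF M]
        bimodule.mult_ract[OF M] bimodule.one_ract[OF M] bimodule.lact_ract[OF M])+
qed

lemma (in abelian_monoid) finsum_eqI:
  "(\<And>i. i \<in> I \<Longrightarrow> f i = g i) \<Longrightarrow> (\<And>i. i \<in> I \<Longrightarrow> g i \<in> carrier G) \<Longrightarrow> finsum G f I = finsum G g I"
  by (rule finsum_cong') auto

context ring_extension
begin

abbreviation "K \<equiv> T_coring A B"

lemma K_simps [simp]:
  "carrier K = T" "add K = add AA" "ring.zero K = ring.zero AA" "lact K = lact AA" "ract K = ract AA"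
  "coprod K = T_coprod A B" "counit K = lmul (\<lambda>x. x)"
  by (simp_all add: T_coring_def bimodule.extend_def T_bimodule_def lmul_def)

lemma K_bimod: "bimodule C_ring C_ring K"
  by (rule bimodule_cong[OF T_bimod]) simp_all

sublocale K: abelian_group K
  by (rule bimodule.axioms(3)[OF K_bimod])

lemma K_ag: "abelian_group K" by (rule K.abelian_group_axioms)

lemma KK: "tensor_factors C_ring C_ring C_ring K K"
  by (simp add: tensor_factors_def K_bimod)

abbreviation "TT \<equiv> tensor_product C_ring K K"
abbreviation tt (infixl \<open>\<bullet>\<close> 68) where "s \<bullet> s' \<equiv> tensor_elt C_ring K K s s'"

text \<open>\<open>T_coprod\<close> is defined with tensor products of \<open>T_bimodule\<close>,
  while the coring axioms speak of the larger record \<open>T_coring\<close>. Only fields shared by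
  the two records enter the construction.\<close>

lemma K_tensor:
  "tensor_elt C_ring Tm Tm = tensor_elt C_ring K K" "tensor_product C_ring Tm Tm = TT"
proof -
  have rels: "tensor_relations C_ring Tm Tm = tensor_relations C_ring K K"
    unfolding tensor_relations_def K_simps T_simps ..
  have group: "tensor_group C_ring Tm Tm = tensor_group C_ring K K"
    unfolding tensor_group_def rels K_simps ..
  show elt: "tensor_elt C_ring Tm Tm = tensor_elt C_ring K K"
    unfolding tensor_elt_def rels K_simps ..
  show "tensor_product C_ring Tm Tm = TT"
    unfolding tensor_product_def group elt K_simps T_simps ..
qed

lemma C_ring_carrier [simp]: "carrier C_ring = C"
  by (simp add: centralizer_ring_def)

lemma regular_C_simps:
  "carrier (regular_bimodule C_ring) = C" "add (regular_bimodule C_ring) = add A"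
  "lact (regular_bimodule C_ring) = monoid.mult A" "ract (regular_bimodule C_ring) = monoid.mult A"
  by (simp_all add: regular_bimodule_def centralizer_ring_def)

lemma K_additive:
  "additive_map M K g \<longleftrightarrow> additive_map M Tm g" "additive_map K P f \<longleftrightarrow> additive_map Tm P f"
  by (simp_all add: additive_map_def)

lemma additive_map_K: "additive_map AA P f \<Longrightarrow> additive_map K P f"
  unfolding K_additive by (rule additive_map_T)

lemma additive_map_KK:
  "additive_map AA AA f \<Longrightarrow> (\<And>x. x \<in> T \<Longrightarrow> f x \<in> T) \<Longrightarrow> additive_map K K f"
  by (auto simp: additive_map_def T_D)

lemma K_finsum:
  assumes "finite I" "\<And>i. i \<in> I \<Longrightarrow> g i \<in> T"
  shows "finsum K g I = finsum AA g I"
  using additive_map_finsum[OF K_ag AA_ag additive_map_K[OF additive_map_id] assms(1), of g] assms(2)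
  by simp

lemma TT_bimod: "bimodule C_ring C_ring TT"
  by (rule tensor_factors.tensor_product_bimodule[OF KK])

sublocale TT: abelian_group TT
  by (rule bimodule.axioms(3)[OF TT_bimod])

lemma TT_ag: "abelian_group TT" by (rule TT.abelian_group_axioms)

lemma tt_closed [simp]: "x \<in> T \<Longrightarrow> y \<in> T \<Longrightarrow> x \<bullet> y \<in> carrier TT"
  using tensor_factors.TP_elt_closed[OF KK] by simp

lemma tt_map_left: "y \<in> T \<Longrightarrow> additive_map K TT (\<lambda>x. x \<bullet> y)"
  using tensor_factors.TP_elt_map_left[OF KK] by simp

lemma tt_map_right: "x \<in> T \<Longrightarrow> additive_map K TT (\<lambda>y. x \<bullet> y)"
  using tensor_factors.TP_elt_map_right[OF KK] by simp

lemma tt_balanced: "x \<in> T \<Longrightarrow> r \<in> C \<Longrightarrow> y \<in> T \<Longrightarrow> (x \<lhd>\<^sub>A r) \<bullet> y = x \<bullet> (r \<rhd> y)"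
  using tensor_factors.elt_balanced[OF KK] by simp

lemma tt_lact: "r \<in> C \<Longrightarrow> x \<in> T \<Longrightarrow> y \<in> T \<Longrightarrow> lact TT r (x \<bullet> y) = (r \<rhd> x) \<bullet> y"
  using tensor_factors.lact_elt[OF KK] by simp

lemma tt_ract: "r \<in> C \<Longrightarrow> x \<in> T \<Longrightarrow> y \<in> T \<Longrightarrow> ract TT (x \<bullet> y) r = x \<bullet> (y \<lhd>\<^sub>A r)"
  using tensor_factors.ract_elt[OF KK] by simp

lemmas TT_lift_elt = tensor_factors.tensor_lift_elt[OF KK, simplified]
lemmas TT_lift_map = tensor_factors.TP_lift_map[OF KK, simplified]
lemmas TT_ext = tensor_factors.TP_ext[OF KK, simplified]
lemmas TT_lact_map = tensor_factors.TP_lact_map[OF KK, simplified]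
lemmas TT_ract_map = tensor_factors.TP_ract_map[OF KK, simplified]

lemma TT_lift_finsum:
  assumes "abelian_group P" "balanced_map C_ring K K P f" "finite I"
    "\<And>i. i \<in> I \<Longrightarrow> v i \<in> T" "\<And>i. i \<in> I \<Longrightarrow> z i \<in> T"
  shows "tensor_lift P f (\<Oplus>\<^bsub>TT\<^esub>i\<in>I. v i \<bullet> z i) = (\<Oplus>\<^bsub>P\<^esub>i\<in>I. f (v i) (z i))"
proof -
  interpret P: abelian_group P by fact
  have "f x y \<in> carrier P" if "x \<in> T" "y \<in> T" for x y
    using tensor_factors.balanced_closed[OF KK assms(1,2)] that by simp
  moreover have "tensor_lift P f (\<Oplus>\<^bsub>TT\<^esub>i\<in>I. v i \<bullet> z i) = (\<Oplus>\<^bsub>P\<^esub>i\<in>I. tensor_lift P f (v i \<bullet> z i))"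
    using assms by (intro additive_map_finsum[OF TT_ag assms(1) TT_lift_map]) auto
  ultimately show ?thesis
    using assms by (auto simp: TT_lift_elt intro!: P.finsum_eqI)
qed

lemma lmap_lmap:
  assumes "right_linear h" "right_linear k" "w \<in> carrier AA"
  shows "lmap k (lmap h w) = lmap (\<lambda>x. k (h x)) w"
  by (rule AA_ext[OF AA_ag additive_map_compose[OF lmap_map lmap_map] lmap_map])
    (simp_all add: right_linear_comp[OF assms(2,1)] assms lin_elts right_linearD[OF assms(1)] right_linearD[OF assms(2)])

end

text \<open>\<open>T_coprod\<close> selects its quasibase by \<open>SOME\<close>. Fixing the
  selected triple turns the coproduct into an explicit sum, and the coring axioms are checked for
  this quasibase.\<close>

locale chosen_quasibase = left_quasibased +
  assumes chosen: "(SOME (n, t, \<beta>). D2_quasibase A B n t \<beta>) = (n, t, \<beta>)"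
begin

abbreviation "\<Delta> \<equiv> T_coprod A B"

lemma lmap_\<beta>_T [simp]: "i < n \<Longrightarrow> w \<in> T \<Longrightarrow> lmap (\<beta> i) w \<in> T"
  by (simp add: lmap_T \<beta>_lin)

lemma lmul_\<beta>_C [simp]: "i < n \<Longrightarrow> w \<in> T \<Longrightarrow> lmul (\<beta> i) w \<in> C"
  by (simp add: lmul_C \<beta>_lin)

declare t_T [simp]

lemma coprod_eq: "\<Delta> w = (\<Oplus>\<^bsub>TT\<^esub>i\<in>{..<n}. t i \<bullet> lmap (\<beta> i) w)"
  by (simp add: T_coprod_def chosen Let_def K_tensor lmap_def)

lemma lmap_\<beta>_map: "i < n \<Longrightarrow> additive_map K K (lmap (\<beta> i))"
  by (rule additive_map_KK) (simp_all add: lmap_map \<beta>_lin)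

lemma coprod_map: "additive_map K TT \<Delta>"
  unfolding coprod_eq
  by (intro additive_map_sum[OF TT_ag] additive_map_compose[OF lmap_\<beta>_map tt_map_right]) simp_all

lemma coprod_closed [simp]: "w \<in> T \<Longrightarrow> \<Delta> w \<in> carrier TT"
  using additive_mapD(1)[OF coprod_map] by simp

lemma left_expansion_K: "v \<in> T \<Longrightarrow> (\<Oplus>\<^bsub>K\<^esub>k\<in>{..<n}. t k \<lhd>\<^sub>A lmul (\<beta> k) v) = v"
  by (subst K_finsum) (simp_all add: T_ra left_expansion T_D(1))

text \<open>The coefficients of v in its quasibase expansion lie in the centralizer, so they cross
  the tensor sign. An arbitrary first factor is thereby replaced by the t_k, with all coefficients
  collected in the second factor.\<close>

lemma expand_left:
  assumes "v \<in> T" "z \<in> T"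
  shows "v \<bullet> z = (\<Oplus>\<^bsub>TT\<^esub>k\<in>{..<n}. t k \<bullet> (lmul (\<beta> k) v \<rhd> z))"
proof -
  have "v \<bullet> z = (\<Oplus>\<^bsub>TT\<^esub>k\<in>{..<n}. (t k \<lhd>\<^sub>A lmul (\<beta> k) v) \<bullet> z)"
    using additive_map_finsum[OF K_ag TT_ag tt_map_left[OF assms(2)], of "{..<n}" "\<lambda>k. t k \<lhd>\<^sub>A lmul (\<beta> k) v"]
      assms by (simp add: left_expansion_K T_ra)
  also have "\<dots> = (\<Oplus>\<^bsub>TT\<^esub>k\<in>{..<n}. t k \<bullet> (lmul (\<beta> k) v \<rhd> z))"
    using assms by (intro TT.finsum_eqI) (simp_all add: tt_balanced T_la)
  finally show ?thesis .
qed

lemma lmul_lmap_expansion_K: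
  assumes "right_linear h" "\<And>i. i < n \<Longrightarrow> lmul h (t i) \<in> C" "w \<in> T"
  shows "(\<Oplus>\<^bsub>K\<^esub>i\<in>{..<n}. lmul h (t i) \<rhd> lmap (\<beta> i) w) = lmap h w"
  using assms lmul_lmap_expansion[OF assms(1) T_D(1)[OF assms(3)]]
  by (subst K_finsum) (simp_all add: T_la)

text \<open>Right linearity is immediate because beta_i acts on the first leg of w; left linearity
  is not, since r enters inside beta_i on one side and in front of t_i on the other. Expanding r t_i
  in the t_k and exchanging the sums leaves, for each k, a sum over i that collapses with h(x) =
  beta_k(r x).\<close>

lemma coprod_lact:
  assumes r: "r \<in> C" and w: "w \<in> T"
  shows "\<Delta> (r \<rhd> w) = lact TT r (\<Delta> w)"
proof -
  let ?z = "\<lambda>i. lmap (\<beta> i) w"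
  have rA: "r \<in> carrier A" and wA: "w \<in> carrier AA" using r w C_D T_D by auto
  have "lact TT r (\<Delta> w) = (\<Oplus>\<^bsub>TT\<^esub>i\<in>{..<n}. lact TT r (t i \<bullet> ?z i))"
    unfolding coprod_eq using w r by (intro additive_map_finsum[OF TT_ag TT_ag TT_lact_map]) auto
  also have "\<dots> = (\<Oplus>\<^bsub>TT\<^esub>i\<in>{..<n}. \<Oplus>\<^bsub>TT\<^esub>k\<in>{..<n}. t k \<bullet> (lmul (\<beta> k) (r \<rhd> t i) \<rhd> ?z i))"
    using w r by (intro TT.finsum_eqI) (auto simp: tt_lact T_la expand_left[symmetric] intro!: tt_closed)
  also have "\<dots> = (\<Oplus>\<^bsub>TT\<^esub>k\<in>{..<n}. \<Oplus>\<^bsub>TT\<^esub>i\<in>{..<n}. t k \<bullet> (lmul (\<beta> k) (r \<rhd> t i) \<rhd> ?z i))"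
    using w r by (intro TT.finsum_swap) (auto simp: T_la)
  also have "\<dots> = (\<Oplus>\<^bsub>TT\<^esub>k\<in>{..<n}. t k \<bullet> (\<Oplus>\<^bsub>K\<^esub>i\<in>{..<n}. lmul (\<beta> k) (r \<rhd> t i) \<rhd> ?z i))"
    using w r
    by (intro TT.finsum_eqI additive_map_finsum[OF K_ag TT_ag tt_map_right, symmetric])
      (auto simp: T_la Pi_iff intro!: tt_closed K.finsum_closed[simplified])
  also have "\<dots> = (\<Oplus>\<^bsub>TT\<^esub>k\<in>{..<n}. t k \<bullet> lmap (\<beta> k) (r \<rhd> w))"
  proof (intro TT.finsum_eqI)
    fix k assume "k \<in> {..<n}"
    then have k: "k < n" by simp
    let ?h = "\<lambda>x. \<beta> k (r \<otimes> x)"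
    have h: "right_linear ?h"
      by (rule right_linear_comp[OF \<beta>_lin(1)[OF k] right_linear_mult[OF rA]])
    have hs: "lmul ?h s = lmul (\<beta> k) (r \<rhd> s)" if "s \<in> carrier AA" for s
      using lmul_la[OF \<beta>_lin(1)[OF k] that rA] by simp
    have "(\<Oplus>\<^bsub>K\<^esub>i\<in>{..<n}. lmul (\<beta> k) (r \<rhd> t i) \<rhd> ?z i) = (\<Oplus>\<^bsub>K\<^esub>i\<in>{..<n}. lmul ?h (t i) \<rhd> ?z i)"
      using w r k by (intro K.finsum_eqI) (auto simp: hs t_AA T_la)
    also have "\<dots> = lmap (\<beta> k) (r \<rhd> w)"
      using lmul_lmap_expansion_K[OF h _ w] k r w
      by (simp add: hs T_D T_la lmap_la[OF \<beta>_lin(1)[OF k] wA rA])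
    finally show "t k \<bullet> (\<Oplus>\<^bsub>K\<^esub>i\<in>{..<n}. lmul (\<beta> k) (r \<rhd> t i) \<rhd> ?z i) = t k \<bullet> lmap (\<beta> k) (r \<rhd> w)"
      by simp
  qed (use w r in \<open>auto simp: T_la\<close>)
  finally show ?thesis unfolding coprod_eq by simp
qed

lemma coprod_ract:
  assumes r: "r \<in> C" and w: "w \<in> T"
  shows "\<Delta> (w \<lhd>\<^sub>A r) = ract TT (\<Delta> w) r"
proof -
  have "ract TT (\<Delta> w) r = (\<Oplus>\<^bsub>TT\<^esub>i\<in>{..<n}. ract TT (t i \<bullet> lmap (\<beta> i) w) r)"
    unfolding coprod_eq using w r by (intro additive_map_finsum[OF TT_ag TT_ag TT_ract_map]) auto
  also have "\<dots> = \<Delta> (w \<lhd>\<^sub>A r)"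
    unfolding coprod_eq using w r C_D(1) T_D(1)
    by (intro TT.finsum_eqI) (auto simp: tt_ract T_ra lmap_ra \<beta>_lin)
  finally show ?thesis by simp
qed

lemma coprod_hom: "\<Delta> \<in> bimodule_hom C_ring C_ring K TT"
  by (rule bimodule_homI[OF coprod_map]) (simp_all add: coprod_lact coprod_ract)

text \<open>\<open>lmul\<close> has right linearity built in and \<open>rmul\<close> left linearity.
  The multiplication map is an instance of both and so obtains both.\<close>

lemma counit_eq_rmul: "lmul (\<lambda>x. x) = rmul (\<lambda>x. x)"
  by (simp add: lmul_def rmul_def)

lemma counit_hom: "lmul (\<lambda>x. x) \<in> bimodule_hom C_ring C_ring K (regular_bimodule C_ring)"
proof -
  have "additive_map K (regular_bimodule C_ring) (lmul (\<lambda>x. x))"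
    by (rule additive_mapI) (simp_all add: regular_C_simps lmul_C right_linear_id left_linear_id
        additive_mapD(2)[OF lmul_map[OF right_linear_id]] T_D)
  moreover have "lmul (\<lambda>x. x) (r \<rhd> w) = r \<otimes> lmul (\<lambda>x. x) w" if "r \<in> C" "w \<in> T" for r w
    unfolding counit_eq_rmul using that by (simp add: rmul_la left_linear_id T_D C_D)
  moreover have "lmul (\<lambda>x. x) (w \<lhd>\<^sub>A r) = lmul (\<lambda>x. x) w \<otimes> r" if "r \<in> C" "w \<in> T" for r w
    using that by (simp add: lmul_ra right_linear_id T_D C_D)
  ultimately show ?thesis
    by (intro bimodule_homI) (simp_all add: regular_C_simps)
qed

text \<open>This is the collapsing sum with h the identity. The other counit law,
  \<open>counit_right\<close>, is the quasibase expansion of w itself.\<close>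

lemma counit_left:
  assumes w: "w \<in> T"
  shows "tensor_lift K (\<lambda>x y. lmul (\<lambda>x. x) x \<rhd> y) (\<Delta> w) = w"
proof -
  have bal: "balanced_map C_ring K K K (\<lambda>x y. lmul (\<lambda>x. x) x \<rhd> y)"
    using bimodule_homD[OF counit_hom]
    by (intro balanced_mapI additive_mapI)
      (simp_all add: regular_bimodule_def T_la la_add T_D C_D la_mult centralizer_ring_def)
  have "tensor_lift K (\<lambda>x y. lmul (\<lambda>x. x) x \<rhd> y) (\<Delta> w) =
      (\<Oplus>\<^bsub>K\<^esub>i\<in>{..<n}. lmul (\<lambda>x. x) (t i) \<rhd> lmap (\<beta> i) w)"
    unfolding coprod_eq using w by (intro TT_lift_finsum[OF K_ag bal]) auto
  also have "\<dots> = lmap (\<lambda>x. x) w"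
    by (rule lmul_lmap_expansion_K) (simp_all add: lmul_C right_linear_id left_linear_id w)
  also have "\<dots> = w"
    by (rule AA_ext[OF AA_ag lmap_map additive_map_id])
      (simp_all add: right_linear_id lmap_elt w T_D)
  finally show ?thesis .
qed

lemma counit_right:
  assumes w: "w \<in> T"
  shows "tensor_lift K (\<lambda>x y. x \<lhd>\<^sub>A lmul (\<lambda>x. x) y) (\<Delta> w) = w"
proof -
  have bal: "balanced_map C_ring K K K (\<lambda>x y. x \<lhd>\<^sub>A lmul (\<lambda>x. x) y)"
    using bimodule_homD[OF counit_hom]
    by (intro balanced_mapI additive_mapI)
      (simp_all add: regular_bimodule_def T_ra ra_add T_D C_D ra_mult centralizer_ring_def)
  have "tensor_lift K (\<lambda>x y. x \<lhd>\<^sub>A lmul (\<lambda>x. x) y) (\<Delta> w) =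
      (\<Oplus>\<^bsub>K\<^esub>i\<in>{..<n}. t i \<lhd>\<^sub>A lmul (\<lambda>x. x) (lmap (\<beta> i) w))"
    unfolding coprod_eq using w by (intro TT_lift_finsum[OF K_ag bal]) auto
  also have "\<dots> = (\<Oplus>\<^bsub>K\<^esub>i\<in>{..<n}. t i \<lhd>\<^sub>A lmul (\<beta> i) w)"
    using w by (intro K.finsum_eqI) (simp_all add: lmul_lmap \<beta>_lin right_linear_id T_D T_ra)
  also have "\<dots> = w" by (rule left_expansion_K[OF w])
  finally show ?thesis .
qed

end

section \<open>Coassociativity and the Frobenius condition in the coring\<close>

context chosen_quasibase
begin

abbreviation "TTT \<equiv> tensor_product C_ring TT K"
abbreviation ttt (infixl \<open>\<bullet>\<bullet>\<close> 66) where "w \<bullet>\<bullet> s \<equiv> tensor_elt C_ring TT K w s"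

lemma TTK: "tensor_factors C_ring C_ring C_ring TT K"
  by (simp add: tensor_factors_def K_bimod TT_bimod)

lemma TTT_ag: "abelian_group TTT"
  by (rule bimodule.axioms(3)[OF tensor_factors.tensor_product_bimodule[OF TTK]])

interpretation TTT: abelian_group TTT by (rule TTT_ag)

lemma ttt_closed [simp]: "w \<in> carrier TT \<Longrightarrow> s \<in> T \<Longrightarrow> w \<bullet>\<bullet> s \<in> carrier TTT"
  using tensor_factors.TP_elt_closed[OF TTK] by simp

lemma ttt_map_left: "s \<in> T \<Longrightarrow> additive_map TT TTT (\<lambda>w. w \<bullet>\<bullet> s)"
  using tensor_factors.TP_elt_map_left[OF TTK] by simp

lemma ttt_map_right: "w \<in> carrier TT \<Longrightarrow> additive_map K TTT (\<lambda>s. w \<bullet>\<bullet> s)"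
  using tensor_factors.TP_elt_map_right[OF TTK] by simp

lemma ttt_balanced: "w \<in> carrier TT \<Longrightarrow> r \<in> C \<Longrightarrow> s \<in> T \<Longrightarrow> ract TT w r \<bullet>\<bullet> s = w \<bullet>\<bullet> (r \<rhd> s)"
  using tensor_factors.elt_balanced[OF TTK] by simp

lemma coprod_ttt_balanced: "balanced_map C_ring K K TTT (\<lambda>x y. \<Delta> x \<bullet>\<bullet> y)"
  by (intro balanced_mapI additive_map_compose[OF coprod_map ttt_map_left])
    (simp_all add: ttt_map_right coprod_ract ttt_balanced)

lemma inner_balanced: "x \<in> T \<Longrightarrow> balanced_map C_ring K K TTT (\<lambda>y z. (x \<bullet> y) \<bullet>\<bullet> z)"
  by (intro balanced_mapI additive_map_compose[OF tt_map_right ttt_map_left])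
    (simp_all add: ttt_map_right tt_ract[symmetric] ttt_balanced)

text \<open>The inner lift of the coassociativity axiom, that is, the image of x \<otimes> w under
  the associativity isomorphism. It is named because the outer lift is meaningful only once this is
  known to be additive and balanced in x as well.\<close>

definition assoc_lift where
  "assoc_lift x w = tensor_lift TTT (\<lambda>y z. (x \<bullet> y) \<bullet>\<bullet> z) w"

lemma assoc_lift_map: "x \<in> T \<Longrightarrow> additive_map TT TTT (assoc_lift x)"
  unfolding assoc_lift_def by (rule TT_lift_map[OF TTT_ag inner_balanced])

lemma assoc_lift_elt: "x \<in> T \<Longrightarrow> y \<in> T \<Longrightarrow> z \<in> T \<Longrightarrow> assoc_lift x (y \<bullet> z) = (x \<bullet> y) \<bullet>\<bullet> z"
  unfolding assoc_lift_def by (rule TT_lift_elt[OF TTT_ag inner_balanced])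

lemma assoc_lift_add:
  assumes "x \<in> T" "x' \<in> T" "w \<in> carrier TT"
  shows "assoc_lift (x \<oplus>\<^bsub>AA\<^esub> x') w = assoc_lift x w \<oplus>\<^bsub>TTT\<^esub> assoc_lift x' w"
  by (rule TT_ext[OF assoc_lift_map additive_map_plus[OF TTT_ag assoc_lift_map assoc_lift_map] TTT_ag])
    (simp_all add: assms T_add assoc_lift_elt additive_mapD(2)[OF tt_map_left, simplified]
      additive_mapD(2)[OF ttt_map_left])

lemma assoc_lift_balanced:
  assumes "x \<in> T" "r \<in> C" "w \<in> carrier TT"
  shows "assoc_lift (x \<lhd>\<^sub>A r) w = assoc_lift x (lact TT r w)"
  by (rule TT_ext[OF assoc_lift_map additive_map_compose[OF TT_lact_map assoc_lift_map] TTT_ag])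
    (simp_all add: assms T_ra T_la assoc_lift_elt tt_balanced tt_lact)

lemma outer_balanced: "balanced_map C_ring K K TTT (\<lambda>x y. assoc_lift x (\<Delta> y))"
  by (rule balanced_mapI, rule additive_map_compose[OF coprod_map assoc_lift_map], simp, rule additive_mapI)
    (simp_all add: assoc_lift_add assoc_lift_balanced coprod_lact additive_mapD(1)[OF assoc_lift_map])

text \<open>Both sides are brought to the sum over j and k of (t_j \<otimes> t_k) \<otimes>
  (beta_k(beta_j(w^1)) \<otimes> w^2). The right-hand side has this form after two unfoldings of the
  coproduct. On the left-hand side the coproduct falls on the t_i, and the sum over i has to be
  eliminated.\<close>

lemma coassoc:
  assumes w: "w \<in> T"
  shows "tensor_lift TTT (\<lambda>x y. \<Delta> x \<bullet>\<bullet> y) (\<Delta> w) = tensor_lift TTT (\<lambda>x y. assoc_lift x (\<Delta> y)) (\<Delta> w)"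
proof -
  let ?z = "\<lambda>i. lmap (\<beta> i) w"
  let ?r = "\<lambda>i j k. lmul (\<beta> k) (lmap (\<beta> j) (t i))"
  have exp: "\<Delta> (t i) \<bullet>\<bullet> ?z i =
      (\<Oplus>\<^bsub>TTT\<^esub>j\<in>{..<n}. \<Oplus>\<^bsub>TTT\<^esub>k\<in>{..<n}. (t j \<bullet> t k) \<bullet>\<bullet> (?r i j k \<rhd> ?z i))" if i: "i < n" for i
  proof -
    \<comment> \<open>Only the second factor is expanded. Its coefficients lie in the centralizer
      and can then cross to the third factor by \<open>ttt_balanced\<close>.\<close>
    have e: "t j \<bullet> lmap (\<beta> j) (t i) = (\<Oplus>\<^bsub>TT\<^esub>k\<in>{..<n}. ract TT (t j \<bullet> t k) (?r i j k))" if j: "j < n" for j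
    proof -
      have "t j \<bullet> lmap (\<beta> j) (t i) = t j \<bullet> (\<Oplus>\<^bsub>K\<^esub>k\<in>{..<n}. t k \<lhd>\<^sub>A ?r i j k)"
        using i j by (simp add: left_expansion_K)
      also have "\<dots> = (\<Oplus>\<^bsub>TT\<^esub>k\<in>{..<n}. t j \<bullet> (t k \<lhd>\<^sub>A ?r i j k))"
        using i j by (intro additive_map_finsum[OF K_ag TT_ag tt_map_right]) (simp_all add: T_ra)
      also have "\<dots> = (\<Oplus>\<^bsub>TT\<^esub>k\<in>{..<n}. ract TT (t j \<bullet> t k) (?r i j k))"
        using i j by (intro TT.finsum_eqI) (simp_all add: tt_ract T_ra)
      finally show ?thesis .
    qed
    have rc: "ract TT (t j \<bullet> t k) (?r i j k) \<in> carrier TT" if "j < n" "k < n" for j k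
      using that i by (simp add: tt_ract T_ra)
    have "\<Delta> (t i) \<bullet>\<bullet> ?z i = (\<Oplus>\<^bsub>TTT\<^esub>j\<in>{..<n}. (t j \<bullet> lmap (\<beta> j) (t i)) \<bullet>\<bullet> ?z i)"
      unfolding coprod_eq[of "t i"]
      using w i by (intro additive_map_finsum[OF TT_ag TTT_ag ttt_map_left]) simp_all
    also have "\<dots> = (\<Oplus>\<^bsub>TTT\<^esub>j\<in>{..<n}. \<Oplus>\<^bsub>TTT\<^esub>k\<in>{..<n}. (t j \<bullet> t k) \<bullet>\<bullet> (?r i j k \<rhd> ?z i))"
    proof (intro TTT.finsum_eqI TTT.finsum_closed)
      fix j assume "j \<in> {..<n}"
      then have j: "j < n" by simp
      have "(t j \<bullet> lmap (\<beta> j) (t i)) \<bullet>\<bullet> ?z i = (\<Oplus>\<^bsub>TTT\<^esub>k\<in>{..<n}. ract TT (t j \<bullet> t k) (?r i j k) \<bullet>\<bullet> ?z i)"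
        unfolding e[OF j]
        using w i j by (intro additive_map_finsum[OF TT_ag TTT_ag ttt_map_left]) (simp_all add: rc)
      also have "\<dots> = (\<Oplus>\<^bsub>TTT\<^esub>k\<in>{..<n}. (t j \<bullet> t k) \<bullet>\<bullet> (?r i j k \<rhd> ?z i))"
        using w i j by (intro TTT.finsum_eqI) (simp_all add: ttt_balanced T_la)
      finally show "(t j \<bullet> lmap (\<beta> j) (t i)) \<bullet>\<bullet> ?z i =
        (\<Oplus>\<^bsub>TTT\<^esub>k\<in>{..<n}. (t j \<bullet> t k) \<bullet>\<bullet> (?r i j k \<rhd> ?z i))" .
    qed (use w i in \<open>auto simp: T_la\<close>)
    finally show ?thesis .
  qed
  have c1: "(t j \<bullet> t k) \<bullet>\<bullet> (?r i j k \<rhd> ?z i) \<in> carrier TTT" if "i < n" "j < n" "k < n" for i j k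
    using that w by (simp add: T_la)
  have "tensor_lift TTT (\<lambda>x y. \<Delta> x \<bullet>\<bullet> y) (\<Delta> w) = (\<Oplus>\<^bsub>TTT\<^esub>i\<in>{..<n}. \<Delta> (t i) \<bullet>\<bullet> ?z i)"
    unfolding coprod_eq[of w] using w by (intro TT_lift_finsum[OF TTT_ag coprod_ttt_balanced]) simp_all
  also have "\<dots> = (\<Oplus>\<^bsub>TTT\<^esub>i\<in>{..<n}. \<Oplus>\<^bsub>TTT\<^esub>j\<in>{..<n}. \<Oplus>\<^bsub>TTT\<^esub>k\<in>{..<n}. (t j \<bullet> t k) \<bullet>\<bullet> (?r i j k \<rhd> ?z i))"
    by (intro TTT.finsum_eqI TTT.finsum_closed) (auto simp: exp intro!: c1 TTT.finsum_closed)
  also have "\<dots> = (\<Oplus>\<^bsub>TTT\<^esub>j\<in>{..<n}. \<Oplus>\<^bsub>TTT\<^esub>i\<in>{..<n}. \<Oplus>\<^bsub>TTT\<^esub>k\<in>{..<n}. (t j \<bullet> t k) \<bullet>\<bullet> (?r i j k \<rhd> ?z i))"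
    by (intro TTT.finsum_swap TTT.finsum_closed) (auto intro!: c1)
  also have "\<dots> = (\<Oplus>\<^bsub>TTT\<^esub>j\<in>{..<n}. \<Oplus>\<^bsub>TTT\<^esub>k\<in>{..<n}. \<Oplus>\<^bsub>TTT\<^esub>i\<in>{..<n}. (t j \<bullet> t k) \<bullet>\<bullet> (?r i j k \<rhd> ?z i))"
    by (intro TTT.finsum_eqI TTT.finsum_swap TTT.finsum_closed) (auto intro!: c1 TTT.finsum_closed)
  also have "\<dots> = (\<Oplus>\<^bsub>TTT\<^esub>j\<in>{..<n}. \<Oplus>\<^bsub>TTT\<^esub>k\<in>{..<n}. (t j \<bullet> t k) \<bullet>\<bullet> lmap (\<beta> k) (lmap (\<beta> j) w))"
  proof (intro TTT.finsum_eqI TTT.finsum_closed)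
    fix j k assume "j \<in> {..<n}" "k \<in> {..<n}"
    then have jk: "j < n" "k < n" by simp_all
    \<comment> \<open>With this composite the coefficient of the i-th term is
      \<open>lmul ?h (t i)\<close>, so the sum over i collapses to \<open>lmap ?h w\<close>.\<close>
    let ?h = "\<lambda>x. \<beta> k (\<beta> j x)"
    have h: "right_linear ?h"
      by (rule right_linear_comp[OF \<beta>_lin(1)[OF jk(2)] \<beta>_lin(1)[OF jk(1)]])
    have r: "lmul ?h s = lmul (\<beta> k) (lmap (\<beta> j) s)" if "s \<in> T" for s
      using lmul_lmap[OF \<beta>_lin(1)[OF jk(1)] \<beta>_lin(1)[OF jk(2)] T_D(1)[OF that]] by simp
    have "(\<Oplus>\<^bsub>TTT\<^esub>i\<in>{..<n}. (t j \<bullet> t k) \<bullet>\<bullet> (?r i j k \<rhd> ?z i)) =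
        (t j \<bullet> t k) \<bullet>\<bullet> (\<Oplus>\<^bsub>K\<^esub>i\<in>{..<n}. ?r i j k \<rhd> ?z i)"
      using w jk
      by (intro additive_map_finsum[OF K_ag TTT_ag ttt_map_right, symmetric]) (simp_all add: T_la)
    also have "(\<Oplus>\<^bsub>K\<^esub>i\<in>{..<n}. ?r i j k \<rhd> ?z i) = (\<Oplus>\<^bsub>K\<^esub>i\<in>{..<n}. lmul ?h (t i) \<rhd> ?z i)"
      using w jk by (intro K.finsum_eqI) (simp_all add: r T_la)
    also have "\<dots> = lmap ?h w"
      using jk by (intro lmul_lmap_expansion_K[OF h _ w]) (simp add: r)
    also have "\<dots> = lmap (\<beta> k) (lmap (\<beta> j) w)"
      using lmap_lmap[OF \<beta>_lin(1)[OF jk(1)] \<beta>_lin(1)[OF jk(2)] T_D(1)[OF w]] by simp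
    finally show "(\<Oplus>\<^bsub>TTT\<^esub>i\<in>{..<n}. (t j \<bullet> t k) \<bullet>\<bullet> (?r i j k \<rhd> ?z i)) =
      (t j \<bullet> t k) \<bullet>\<bullet> lmap (\<beta> k) (lmap (\<beta> j) w)" .
  qed (use w in \<open>auto intro!: TTT.finsum_closed\<close>)
  also have "\<dots> = (\<Oplus>\<^bsub>TTT\<^esub>j\<in>{..<n}. assoc_lift (t j) (\<Delta> (?z j)))"
  proof (intro TTT.finsum_eqI)
    fix j assume "j \<in> {..<n}"
    then have j: "j < n" by simp
    have "assoc_lift (t j) (\<Delta> (?z j)) = (\<Oplus>\<^bsub>TTT\<^esub>k\<in>{..<n}. (t j \<bullet> t k) \<bullet>\<bullet> lmap (\<beta> k) (?z j))"
      unfolding assoc_lift_def coprod_eq[of "?z j"]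
      using w j by (intro TT_lift_finsum[OF TTT_ag inner_balanced]) simp_all
    then show "(\<Oplus>\<^bsub>TTT\<^esub>k\<in>{..<n}. (t j \<bullet> t k) \<bullet>\<bullet> lmap (\<beta> k) (?z j)) = assoc_lift (t j) (\<Delta> (?z j))"
      by simp
    show "assoc_lift (t j) (\<Delta> (?z j)) \<in> carrier TTT"
      using j w by (simp add: additive_mapD(1)[OF assoc_lift_map])
  qed
  also have "\<dots> = tensor_lift TTT (\<lambda>x y. assoc_lift x (\<Delta> y)) (\<Delta> w)"
    unfolding coprod_eq[of w] using w by (intro TT_lift_finsum[OF TTT_ag outer_balanced, symmetric]) simp_all
  finally show ?thesis .
qed

lemma T_coring: "coring C_ring K"
proof (intro coring.intro K_bimod coring_axioms.intro, unfold K_simps)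
  fix w assume "w \<in> T"
  then show "tensor_lift TTT (\<lambda>x y. \<Delta> x \<bullet>\<bullet> y) (\<Delta> w) =
    tensor_lift TTT (\<lambda>x y. tensor_lift TTT (\<lambda>y z. (x \<bullet> y) \<bullet>\<bullet> z) (\<Delta> y)) (\<Delta> w)"
    using coassoc[unfolded assoc_lift_def] by simp
qed (fact coprod_hom counit_hom counit_left counit_right)+

text \<open>Used in both directions of the equivalence: for the form built from a Frobenius
  homomorphism and for a given form once it is known to be a sandwich form. Comparing the two sides
  of the Frobenius condition thus becomes an equation in A \<otimes>_B A.\<close>

lemma frobenius_condition:
  assumes f: "right_linear f" "left_linear f"
    and g: "g \<in> bimodule_hom C_ring C_ring TT (regular_bimodule C_ring)"
    and gf: "\<And>x y. x \<in> T \<Longrightarrow> y \<in> T \<Longrightarrow> g (x \<bullet> y) = sandwich f x y"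
    and c: "c \<in> T" and d: "d \<in> T"
  shows "tensor_lift K (\<lambda>x y. g (c \<bullet> x) \<rhd> y) (\<Delta> d) = sandwich_l f c d"
    and "tensor_lift K (\<lambda>x y. x \<lhd>\<^sub>A g (y \<bullet> d)) (\<Delta> c) = sandwich_r f c d"
proof -
  interpret bilinear_endo A B f by unfold_locales (fact f)+
  have gC: "g (x \<bullet> y) \<in> C" if "x \<in> T" "y \<in> T" for x y
    using bimodule_homD(2)[OF g, of "x \<bullet> y"] that by (simp add: regular_C_simps)
  note gA = gC[THEN C_D(1)]
  have gadd: "g (v \<oplus>\<^bsub>TT\<^esub> w) = g v \<oplus> g w" if "v \<in> carrier TT" "w \<in> carrier TT" for v w
    using bimodule_homD(3)[OF g that] by (simp add: regular_C_simps)
  have gl: "g (x \<bullet> (y \<oplus>\<^bsub>AA\<^esub> y')) = g (x \<bullet> y) \<oplus> g (x \<bullet> y')"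
    "g ((y \<oplus>\<^bsub>AA\<^esub> y') \<bullet> x) = g (y \<bullet> x) \<oplus> g (y' \<bullet> x)" if "x \<in> T" "y \<in> T" "y' \<in> T" for x y y'
    using that additive_mapD(2)[OF tt_map_right, of x y y'] additive_mapD(2)[OF tt_map_left, of x y y']
    by (simp_all add: gadd)
  have gr: "g (x \<bullet> (y \<lhd>\<^sub>A r)) = g (x \<bullet> y) \<otimes> r" "g ((r \<rhd> x) \<bullet> y) = r \<otimes> g (x \<bullet> y)"
    if "x \<in> T" "y \<in> T" "r \<in> C" for x y r
    using that bimodule_homD(5)[OF g, of "x \<bullet> y" r] bimodule_homD(4)[OF g, of r "x \<bullet> y"]
    by (simp_all add: regular_C_simps tt_ract tt_lact)
  have "balanced_map C_ring K K K (\<lambda>x y. g (c \<bullet> x) \<rhd> y)"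
    by (intro balanced_mapI additive_mapI) (simp_all add: c T_la gC gl gr la_add la_mult T_D(1) C_D(1) gA)
  then have "tensor_lift K (\<lambda>x y. g (c \<bullet> x) \<rhd> y) (\<Delta> d) = (\<Oplus>\<^bsub>K\<^esub>i\<in>{..<n}. g (c \<bullet> t i) \<rhd> lmap (\<beta> i) d)"
    unfolding coprod_eq using d by (intro TT_lift_finsum[OF K_ag]) simp_all
  also have "\<dots> = (\<Oplus>\<^bsub>AA\<^esub>i\<in>{..<n}. g (c \<bullet> t i) \<rhd> lmap (\<beta> i) d)"
    using c d by (intro K_finsum) (simp_all add: T_la gC)
  also have "\<dots> = (\<Oplus>\<^bsub>AA\<^esub>i\<in>{..<n}. sandwich f c (t i) \<rhd> lmap (\<beta> i) d)"
    using c d by (intro AA.finsum_eqI) (simp_all add: gf[symmetric] gA T_D(1))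
  finally show "tensor_lift K (\<lambda>x y. g (c \<bullet> x) \<rhd> y) (\<Delta> d) = sandwich_l f c d"
    using frobenius_left_side[OF bilinear_endo_axioms] c d T_D(1) by simp
  have "balanced_map C_ring K K K (\<lambda>x y. x \<lhd>\<^sub>A g (y \<bullet> d))"
    by (intro balanced_mapI additive_mapI) (simp_all add: d T_ra gC gl gr ra_add ra_mult T_D(1) C_D(1) gA)
  then have "tensor_lift K (\<lambda>x y. x \<lhd>\<^sub>A g (y \<bullet> d)) (\<Delta> c) = (\<Oplus>\<^bsub>K\<^esub>i\<in>{..<n}. t i \<lhd>\<^sub>A g (lmap (\<beta> i) c \<bullet> d))"
    unfolding coprod_eq using c by (intro TT_lift_finsum[OF K_ag]) simp_all
  also have "\<dots> = (\<Oplus>\<^bsub>AA\<^esub>i\<in>{..<n}. t i \<lhd>\<^sub>A g (lmap (\<beta> i) c \<bullet> d))"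
    using c d by (intro K_finsum) (simp_all add: T_ra gC)
  also have "\<dots> = (\<Oplus>\<^bsub>AA\<^esub>i\<in>{..<n}. t i \<lhd>\<^sub>A sandwich f (lmap (\<beta> i) c) d)"
    using c d by (intro AA.finsum_eqI) (simp_all add: gf[symmetric] gA T_D(1))
  finally show "tensor_lift K (\<lambda>x y. x \<lhd>\<^sub>A g (y \<bullet> d)) (\<Delta> c) = sandwich_r f c d"
    using frobenius_right_side[OF bilinear_endo_axioms] c d T_D(1) by simp
qed

end

section \<open>Frobenius extensions and Frobenius corings\<close>

lemma (in ring) right_regular_bimodule:
  assumes "subring S R"
  shows "bimodule \<Z> (R\<lparr>carrier := S\<rparr>) (right_regular_module R)"
proof -
  have S: "s \<in> S \<Longrightarrow> s \<in> carrier R" for s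
    using subringE(1)[OF assms] by blast
  have pow: "add_pow R k x \<in> carrier R"
    "add_pow R k (x \<oplus> y) = add_pow R k x \<oplus> add_pow R k y"
    "add_pow R (k + l) x = add_pow R k x \<oplus> add_pow R l x"
    "add_pow R (k * l) x = add_pow R k (add_pow R l x)"
    "add_pow R (1::int) x = x"
    if "x \<in> carrier R" "y \<in> carrier R" for x y and k l :: int
    using that
    by (simp_all add: add.int_pow_distrib add.int_pow_mult add.int_pow_pow mult.commute)
  have ag: "abelian_group (right_regular_module R)"
    by (rule abelian_groupI)
      (use add.l_inv_ex in \<open>auto simp: right_regular_module_def a_ac\<close>)
  have "bimodule_axioms \<Z> (R\<lparr>carrier := S\<rparr>) (right_regular_module R)"
    by (rule bimodule_axioms.intro)
      (simp_all add: right_regular_module_def S pow l_distr r_distr m_assoc add_pow_ldistr_int)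
  then show ?thesis
    using ag subring_is_ring[OF assms] cring.axioms(1)[OF int_is_cring] by (intro bimodule.intro)
qed

context ring_extension
begin

lemma procesi_induct [consumes 2, case_names zero mult add]:
  assumes "procesi_extension A B" "a \<in> carrier A"
    and zero: "P \<zero>" and mult: "\<And>b r. b \<in> B \<Longrightarrow> r \<in> C \<Longrightarrow> P (b \<otimes> r)"
    and add: "\<And>x y. x \<in> carrier A \<Longrightarrow> y \<in> carrier A \<Longrightarrow> P x \<Longrightarrow> P y \<Longrightarrow> P (x \<oplus> y)"
  shows "P a"
proof -
  have "a \<in> sums_of_products A B C"
    using assms(1,2) by (simp add: procesi_extension_def)
  then obtain n b r where a: "a = (\<Oplus>i\<in>{..<n::nat}. b i \<otimes> r i)" and br: "b \<in> {..<n} \<rightarrow> B" "r \<in> {..<n} \<rightarrow> C"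
    unfolding sums_of_products_def by blast
  have "P (\<Oplus>i\<in>I. b i \<otimes> r i)" if "finite I" "I \<subseteq> {..<n}" for I
    using that
  proof (induction I)
    case (insert i I)
    have "b j \<otimes> r j \<in> carrier A" if "j \<in> {..<n}" for j
      using that br B_sub C_D(1) by (auto simp: Pi_iff)
    then show ?case
      using insert br by (subst finsum_insert) (auto simp: Pi_iff subset_iff intro!: add mult finsum_closed)
  qed (simp add: zero)
  then show ?thesis by (simp add: a)
qed

text \<open>A form of descent along B \<subseteq> A. If there were a right B-linear retraction of A
  onto B, applying it to the first leg would give the claim at once; the finitely many g_i of the
  generator condition together take its place.\<close>

lemma generator_descent:
  assumes gen: "summand_of_power \<Z> B_ring (right_regular_module B_ring) (right_regular_module A)"
    and x: "x \<in> carrier A" and eq: "x \<boxtimes> \<one> = \<one> \<boxtimes> x"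
  shows "x \<in> B"
proof -
  interpret BR: ring B_ring by (rule subring_is_ring[OF subring])
  have "bimodule \<Z> (B_ring\<lparr>carrier := carrier B_ring\<rparr>) (right_regular_module B_ring)"
    by (rule BR.right_regular_bimodule[OF BR.carrier_is_subring])
  then have bB: "bimodule \<Z> B_ring (right_regular_module B_ring)" by simp
  have bA: "bimodule \<Z> B_ring (right_regular_module A)"
    by (rule right_regular_bimodule[OF subring])
  obtain n :: nat and f g where H: "(\<forall>i<n. f i \<in> bimodule_hom \<Z> B_ring (right_regular_module B_ring) (right_regular_module A)) \<and>
      (\<forall>i<n. g i \<in> bimodule_hom \<Z> B_ring (right_regular_module A) (right_regular_module B_ring)) \<and>
      (\<forall>w\<in>carrier (right_regular_module B_ring).
        (\<Oplus>\<^bsub>right_regular_module B_ring\<^esub>i\<in>{..<n}. g i (f i w)) = w)"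
    using summand_of_power_homs[OF gen bB bA] by (elim exE) (rule that)
  let ?RB = "right_regular_module B_ring"
  have fh: "f i \<in> bimodule_hom \<Z> B_ring ?RB (right_regular_module A)"
    and gh: "g i \<in> bimodule_hom \<Z> B_ring (right_regular_module A) ?RB" if "i < n" for i
    using H that by simp_all
  have fg: "(\<Oplus>\<^bsub>?RB\<^esub>i\<in>{..<n}. g i (f i w)) = w" if "w \<in> carrier ?RB" for w
    using H that by blast
  have simps: "carrier ?RB = B" "add ?RB = add A" "ract ?RB = monoid.mult A"
    "carrier (right_regular_module A) = carrier A" "add (right_regular_module A) = add A"
    "ract (right_regular_module A) = monoid.mult A"
    by (simp_all add: right_regular_module_def)
  have one: "\<one> \<in> B" using subringE(3)[OF subring] .
  have fx: "f i \<one> \<in> carrier A" if "i < n" for i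
    using bimodule_homD(2)[OF fh[OF that], of \<one>] one by (simp add: simps)
  have gB: "g i a \<in> B" if "i < n" "a \<in> carrier A" for i a
    using bimodule_homD(2)[OF gh[OF that(1)], of a] that by (simp add: simps)
  have g: "right_linear (g i)" if "i < n" for i
    using gB[OF that] B_sub bimodule_homD(3,5)[OF gh[OF that]]
    by (intro right_linearI additive_mapI) (simp_all add: simps)
  have RB_ag: "abelian_group ?RB" by (rule bimodule.axioms(3)[OF bB])
  have sum: "(\<Oplus>\<^bsub>?RB\<^esub>i\<in>{..<n}. h i) = (\<Oplus>i\<in>{..<n}. h i)" if "\<And>i. i < n \<Longrightarrow> h i \<in> B" for h
    using that by (intro additive_map_finsum[OF RB_ag A_ag, of "\<lambda>x. x"])
      (simp_all add: additive_map_def simps B_sub)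
  have "g i (f i \<one> \<otimes> x) = g i (f i \<one>) \<otimes> x" if i: "i < n" for i
  proof -
    have "lmul (g i) (f i \<one> \<rhd> (x \<boxtimes> \<one>)) = lmul (g i) (f i \<one> \<rhd> (\<one> \<boxtimes> x))"
      by (simp add: eq)
    then show ?thesis
      using fx[OF i] x right_linearD(2)[OF g[OF i]] by (simp add: la_elt lmul_elt g[OF i])
  qed
  then have "(\<Oplus>i\<in>{..<n}. g i (f i \<one> \<otimes> x)) = (\<Oplus>i\<in>{..<n}. g i (f i \<one>) \<otimes> x)"
    using x fx B_sub[OF gB] by (intro finsum_eqI) simp_all
  also have "\<dots> = (\<Oplus>i\<in>{..<n}. g i (f i \<one>)) \<otimes> x"
    using x fx B_sub[OF gB] by (intro additive_map_finsum[OF A_ag A_ag mult_map_right, symmetric]) simp_all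
  also have "(\<Oplus>i\<in>{..<n}. g i (f i \<one>)) = \<one>"
    using fg[of \<one>] sum[of "\<lambda>i. g i (f i \<one>)"] gB fx one by (simp add: simps)
  \<comment> \<open>Summation in A and in the right regular module of B agree on elements of B; in
    the second reading the sum visibly lies in B.\<close>
  finally have "x = (\<Oplus>\<^bsub>?RB\<^esub>i\<in>{..<n}. g i (f i \<one> \<otimes> x))"
    using x fx gB by (subst sum) simp_all
  also have "\<dots> \<in> carrier ?RB"
    using x fx gB by (intro abelian_monoid.finsum_closed[OF abelian_group.axioms(1)[OF RB_ag]]) (auto simp: simps)
  finally show ?thesis by (simp add: simps)
qed

lemma regular_C_ag: "abelian_group (regular_bimodule C_ring)"
  unfolding centralizer_ring_def
  by (rule bimodule.axioms(3)[OF ring.regular_bimodule[OF subring_is_ring[OF C_subring]]])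

end

section \<open>From a Frobenius extension to a Frobenius coring\<close>

context chosen_quasibase
begin

text \<open>The distinguished element of the coring is the Frobenius element e of the extension
  itself: commuting with A, it commutes with B and so lies in T, and it commutes with the
  centralizer.\<close>

lemma frobenius_extension_imp_coring:
  assumes "frobenius_extension A B"
  shows "frobenius_coring C_ring K"
proof -
  obtain E e where E: "E \<in> bimodule_hom B_ring B_ring Reg (regular_bimodule B_ring)"
    and e: "e \<in> invariants (carrier A) AA"
    and Ee: "\<And>a. a \<in> carrier A \<Longrightarrow> a = tensor_lift A (\<lambda>x y. x \<otimes> E (y \<otimes> a)) e"
      "\<And>a. a \<in> carrier A \<Longrightarrow> a = tensor_lift A (\<lambda>x y. E (a \<otimes> x) \<otimes> y) e"
    using assms unfolding frobenius_extension_def by blast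
  have EB: "E x \<in> B" if "x \<in> carrier A" for x
    using bimodule_homD(2)[OF E, of x] that by (simp add: regular_bimodule_def)
  have E_lin: "right_linear E" "left_linear E"
    using bimodule_homD(3-5)[OF E] EB B_sub
    by (auto intro!: right_linearI left_linearI additive_mapI simp: regular_bimodule_def)
  interpret bilinear_endo A B E by unfold_locales (fact E_lin)+
  have eAA: "e \<in> carrier AA" and e_inv: "\<And>a. a \<in> carrier A \<Longrightarrow> a \<rhd> e = e \<lhd>\<^sub>A a"
    using e by (auto simp: invariants_def)
  have eT: "e \<in> T" using eAA e_inv B_sub by (intro T_I) auto
  \<comment> \<open>The two dual basis identities say exactly that \<open>fleft E e\<close> and
    \<open>fright E e\<close> are the identity. Inserting e on either side of the form therefore
    leaves the multiplication map, which is the counit.\<close>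
  have fl: "fleft E e a = a" and fr: "fright E e a = a" if "a \<in> carrier A" for a
    using Ee[OF that] by (simp_all add: fleft_def fright_def lmul_def rmul_def)
  have counit: "bil c e = lmul (\<lambda>x. x) c" "bil e c = lmul (\<lambda>x. x) c" if "c \<in> T" for c
  proof -
    show "bil c e = lmul (\<lambda>x. x) c"
      by (rule AA_ext[OF A_ag bil_map_left lmul_map _ T_D(1)[OF that]])
        (simp_all add: eAA bil_elt_left fr right_linear_id lmul_elt)
    show "bil e c = lmul (\<lambda>x. x) c"
      by (rule AA_ext[OF A_ag bil_map_right lmul_map _ T_D(1)[OF that]])
        (simp_all add: eAA bil_elt_right fl right_linear_id lmul_elt)
  qed
  have lr: "bil_l c d = bil_r c d" if c: "c \<in> carrier AA" and d: "d \<in> carrier AA" for c d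
  proof (rule AA_ext[OF AA_ag bil_l_map_left[OF d] bil_r_map_left[OF d] _ c])
    fix p q assume pq: "p \<in> carrier A" "q \<in> carrier A"
    \<comment> \<open>On pure tensors this reads p E(q x) \<otimes> y = p \<otimes> E(q x) y, and
      E(q x) may cross the tensor sign because it lies in B.\<close>
    show "bil_l (p \<boxtimes> q) d = bil_r (p \<boxtimes> q) d"
      by (rule AA_ext[OF AA_ag bil_l_map_right bil_r_map_right _ d])
        (simp_all add: pq bil_l_elt_right bil_r_elt_left fleft_elt fright_elt elt_balanced EB)
  qed
  let ?RC = "regular_bimodule C_ring"
  define g where "g = tensor_lift ?RC bil"
  have bal: "balanced_map C_ring K K ?RC bil"
    by (intro balanced_mapI additive_mapI)
      (simp_all add: regular_C_simps bil_C T_D(1) bil_middle C_D(1)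
        additive_mapD(2)[OF bil_map_left] additive_mapD(2)[OF bil_map_right])
  have g_elt: "g (x \<bullet> y) = bil x y" if "x \<in> T" "y \<in> T" for x y
    unfolding g_def using that by (intro TT_lift_elt[OF regular_C_ag bal])
  have g_map: "additive_map TT ?RC g"
    unfolding g_def by (rule TT_lift_map[OF regular_C_ag bal])
  have RC_bimod: "bimodule C_ring C_ring ?RC"
    unfolding centralizer_ring_def by (rule ring.regular_bimodule[OF subring_is_ring[OF C_subring]])
  have g_hom: "g \<in> bimodule_hom C_ring C_ring TT ?RC"
  proof (rule bimodule_homI[OF g_map], unfold C_ring_carrier)
    fix r w assume r: "r \<in> C" and w: "w \<in> carrier TT"
    show "g (lact TT r w) = lact ?RC r (g w)"
      by (rule TT_ext[OF additive_map_compose[OF TT_lact_map g_map]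
            additive_map_compose[OF g_map bimodule_lact_map[OF RC_bimod]] regular_C_ag _ w])
        (simp_all add: r tt_lact g_elt T_la T_D(1) C_D(1) bil_la regular_C_simps)
    show "g (ract TT w r) = ract ?RC (g w) r"
      by (rule TT_ext[OF additive_map_compose[OF TT_ract_map g_map]
            additive_map_compose[OF g_map bimodule_ract_map[OF RC_bimod]] regular_C_ag _ w])
        (simp_all add: r tt_ract g_elt T_ra T_D(1) C_D(1) bil_ra regular_C_simps)
  qed
  show ?thesis
    unfolding frobenius_coring_def
  proof (intro conjI bexI[of _ g] bexI[of _ e] ballI, unfold K_simps)
    show "coring C_ring K" by (rule T_coring)
    show "g \<in> bimodule_hom C_ring C_ring TT ?RC" by (rule g_hom)
    show "e \<in> invariants (carrier C_ring) K"
      using eT e_inv C_D(1) by (simp add: invariants_def)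
  next
    fix c assume "c \<in> T"
    then show "g (c \<bullet> e) = lmul (\<lambda>x. x) c" "lmul (\<lambda>x. x) c = g (e \<bullet> c)"
      using eT counit by (simp_all add: g_elt)
  next
    fix c d assume "c \<in> T" "d \<in> T"
    then show "tensor_lift K (\<lambda>x y. g (c \<bullet> x) \<rhd> y) (\<Delta> d) = tensor_lift K (\<lambda>x y. x \<lhd>\<^sub>A g (y \<bullet> d)) (\<Delta> c)"
      using frobenius_condition[OF E_lin g_hom g_elt] lr T_D(1) by simp
  qed
qed

end

section \<open>T spans the tensor square from either side\<close>

locale both_quasibases = chosen_quasibase A B n t \<beta> + right_quasibased A B m u \<gamma>
  for A :: "('a, 'x) ring_scheme" (structure) and B n t \<beta> m u \<gamma>
begin

text \<open>By \<open>left_expansion\<close> every tensor is a sum of elements t_i a_i, so equality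
  of additive maps is tested on right multiples of elements of T.\<close>

lemma TA_ext:
  assumes "abelian_group P" "additive_map AA P h" "additive_map AA P k"
    and "\<And>s a. s \<in> T \<Longrightarrow> a \<in> carrier A \<Longrightarrow> h (s \<lhd>\<^sub>A a) = k (s \<lhd>\<^sub>A a)" and w: "w \<in> carrier AA"
  shows "h w = k w"
proof -
  interpret P: abelian_group P by fact
  have c: "t i \<lhd>\<^sub>A lmul (\<beta> i) w \<in> carrier AA" if "i \<in> {..<n}" for i
    using that w by (simp add: t_AA lmul_closed \<beta>_lin)
  have "(\<Oplus>\<^bsub>P\<^esub>i\<in>{..<n}. h (t i \<lhd>\<^sub>A lmul (\<beta> i) w)) = (\<Oplus>\<^bsub>P\<^esub>i\<in>{..<n}. k (t i \<lhd>\<^sub>A lmul (\<beta> i) w))"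
    using w assms(4) by (intro P.finsum_eqI additive_mapD(1)[OF assms(3) c]) (simp_all add: lmul_closed \<beta>_lin)
  then show ?thesis
    using additive_map_finsum[OF AA_ag assms(1,2), of "{..<n}" "\<lambda>i. t i \<lhd>\<^sub>A lmul (\<beta> i) w"]
      additive_map_finsum[OF AA_ag assms(1,3), of "{..<n}" "\<lambda>i. t i \<lhd>\<^sub>A lmul (\<beta> i) w"] c left_expansion[OF w]
    by simp
qed

text \<open>The same with left multiples, by \<open>right_expansion\<close>.\<close>

lemma AT_ext:
  assumes "abelian_group P" "additive_map AA P h" "additive_map AA P k"
    and "\<And>s a. s \<in> T \<Longrightarrow> a \<in> carrier A \<Longrightarrow> h (a \<rhd> s) = k (a \<rhd> s)" and w: "w \<in> carrier AA"
  shows "h w = k w"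
proof -
  interpret P: abelian_group P by fact
  have c: "rmul (\<gamma> j) w \<rhd> u j \<in> carrier AA" if "j \<in> {..<m}" for j
    using that w by (simp add: u_AA rmul_closed \<gamma>_lin)
  have "(\<Oplus>\<^bsub>P\<^esub>j\<in>{..<m}. h (rmul (\<gamma> j) w \<rhd> u j)) = (\<Oplus>\<^bsub>P\<^esub>j\<in>{..<m}. k (rmul (\<gamma> j) w \<rhd> u j))"
    using w assms(4) by (intro P.finsum_eqI additive_mapD(1)[OF assms(3) c]) (simp_all add: rmul_closed \<gamma>_lin u_T)
  then show ?thesis
    using additive_map_finsum[OF AA_ag assms(1,2), of "{..<m}" "\<lambda>j. rmul (\<gamma> j) w \<rhd> u j"]
      additive_map_finsum[OF AA_ag assms(1,3), of "{..<m}" "\<lambda>j. rmul (\<gamma> j) w \<rhd> u j"] c right_expansion[OF w]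
    by simp
qed

end

section \<open>Extending a form from T to the tensor square\<close>

locale extended_form = both_quasibases +
  fixes g
  assumes g_hom: "g \<in> bimodule_hom C_ring C_ring TT (regular_bimodule C_ring)"
    and procesi: "procesi_extension A B"
begin

lemma g_C [simp]: "x \<in> T \<Longrightarrow> y \<in> T \<Longrightarrow> g (x \<bullet> y) \<in> C"
  using bimodule_homD(2)[OF g_hom, of "x \<bullet> y"] by (simp add: regular_C_simps)

lemma g_A [simp]: "x \<in> T \<Longrightarrow> y \<in> T \<Longrightarrow> g (x \<bullet> y) \<in> carrier A"
  using g_C C_D(1) by blast

lemma g_map: "additive_map TT A g"
  using bimodule_homD(2,3)[OF g_hom] by (auto simp: additive_map_def regular_C_simps C_D)

lemma g_ra: "x \<in> T \<Longrightarrow> y \<in> T \<Longrightarrow> r \<in> C \<Longrightarrow> g (x \<bullet> (y \<lhd>\<^sub>A r)) = g (x \<bullet> y) \<otimes> r"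
  using bimodule_homD(5)[OF g_hom, of "x \<bullet> y" r] by (simp add: regular_C_simps tt_ract)

lemma g_la: "x \<in> T \<Longrightarrow> y \<in> T \<Longrightarrow> r \<in> C \<Longrightarrow> g ((r \<rhd> x) \<bullet> y) = r \<otimes> g (x \<bullet> y)"
  using bimodule_homD(4)[OF g_hom, of r "x \<bullet> y"] by (simp add: regular_C_simps tt_lact)

text \<open>The extension has to send (a x, y a') to a g(x, y) a' for x, y in T. The formula is that
  value on the right quasibase expansion of w, with coefficients on the left, and the left quasibase
  expansion of v, with coefficients on the right. Being written with functions of w and v only, it
  is well defined from the start; that it restricts to g is what has to be proved
  (\<open>ext_form_T\<close>).\<close>

definition ext_form :: "('a, 'a) tensor \<Rightarrow> ('a, 'a) tensor \<Rightarrow> 'a"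
  where "ext_form w v = (\<Oplus>j\<in>{..<m}. \<Oplus>i\<in>{..<n}. rmul (\<gamma> j) w \<otimes> (g (u j \<bullet> t i) \<otimes> lmul (\<beta> i) v))"

declare u_T [simp]

lemma ext_form_map_left: "v \<in> carrier AA \<Longrightarrow> additive_map AA A (\<lambda>w. ext_form w v)"
  unfolding ext_form_def
  by (intro additive_map_sum[OF A_ag] additive_map_compose[OF rmul_map mult_map_right])
    (simp_all add: \<gamma>_lin \<beta>_lin lmul_closed)

lemma ext_form_map_right: "w \<in> carrier AA \<Longrightarrow> additive_map AA A (ext_form w)"
  unfolding ext_form_def
  by (intro additive_map_sum[OF A_ag] additive_map_compose[OF _ mult_map_left]
      additive_map_compose[OF lmul_map mult_map_left])
    (simp_all add: \<gamma>_lin \<beta>_lin rmul_closed)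

lemmas ext_form_closed = additive_mapD(1)[OF ext_form_map_right]

lemma ext_form_la:
  assumes "w \<in> carrier AA" "v \<in> carrier AA" "a \<in> carrier A"
  shows "ext_form (a \<rhd> w) v = a \<otimes> ext_form w v"
proof -
  have c: "rmul (\<gamma> j) w \<otimes> (g (u j \<bullet> t i) \<otimes> lmul (\<beta> i) v) \<in> carrier A" if "j < m" "i < n" for i j
    using that assms by (simp add: rmul_closed lmul_closed \<gamma>_lin \<beta>_lin)
  have "a \<otimes> ext_form w v = (\<Oplus>j\<in>{..<m}. \<Oplus>i\<in>{..<n}. a \<otimes> (rmul (\<gamma> j) w \<otimes> (g (u j \<bullet> t i) \<otimes> lmul (\<beta> i) v)))"
    unfolding ext_form_def using assms c
    by (subst additive_map_finsum[OF A_ag A_ag mult_map_left])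
      (auto intro!: finsum_closed finsum_eqI additive_map_finsum[OF A_ag A_ag mult_map_left])
  also have "\<dots> = ext_form (a \<rhd> w) v"
    unfolding ext_form_def using assms c
    by (intro finsum_eqI finsum_closed)
      (auto simp: rmul_la rmul_closed lmul_closed \<gamma>_lin \<beta>_lin m_assoc intro!: finsum_closed)
  finally show ?thesis by simp
qed

lemma ext_form_ra:
  assumes "w \<in> carrier AA" "v \<in> carrier AA" "a \<in> carrier A"
  shows "ext_form w (v \<lhd>\<^sub>A a) = ext_form w v \<otimes> a"
proof -
  have c: "rmul (\<gamma> j) w \<otimes> (g (u j \<bullet> t i) \<otimes> lmul (\<beta> i) v) \<in> carrier A" if "j < m" "i < n" for i j
    using that assms by (simp add: rmul_closed lmul_closed \<gamma>_lin \<beta>_lin)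
  have "ext_form w v \<otimes> a = (\<Oplus>j\<in>{..<m}. \<Oplus>i\<in>{..<n}. rmul (\<gamma> j) w \<otimes> (g (u j \<bullet> t i) \<otimes> lmul (\<beta> i) v) \<otimes> a)"
    unfolding ext_form_def using assms c
    by (subst additive_map_finsum[OF A_ag A_ag mult_map_right])
      (auto intro!: finsum_closed finsum_eqI additive_map_finsum[OF A_ag A_ag mult_map_right])
  also have "\<dots> = ext_form w (v \<lhd>\<^sub>A a)"
    unfolding ext_form_def using assms c
    by (intro finsum_eqI finsum_closed)
      (auto simp: lmul_ra rmul_closed lmul_closed \<gamma>_lin \<beta>_lin m_assoc intro!: finsum_closed)
  finally show ?thesis by simp
qed

lemma right_expansion_K: "v \<in> T \<Longrightarrow> (\<Oplus>\<^bsub>K\<^esub>j\<in>{..<m}. rmul (\<gamma> j) v \<rhd> u j) = v"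
  by (subst K_finsum) (simp_all add: T_la rmul_C \<gamma>_lin right_expansion T_D(1))

text \<open>For arguments in T the quasibase coefficients lie in the centralizer, so the bimodule
  linearity of g absorbs them and the expansions of x and y can be summed up again inside g.\<close>

lemma ext_form_T:
  assumes x: "x \<in> T" and y: "y \<in> T"
  shows "ext_form x y = g (x \<bullet> y)"
proof -
  have rC: "rmul (\<gamma> j) x \<in> C" if "j < m" for j
    using that x by (simp add: rmul_C \<gamma>_lin)
  have gx: "additive_map K A (\<lambda>y. g (z \<bullet> y))" if "z \<in> T" for z
    using that by (intro additive_map_compose[OF tt_map_right g_map])
  have gy: "additive_map K A (\<lambda>x. g (x \<bullet> y))"
    using y by (intro additive_map_compose[OF tt_map_left g_map])
  have "g (x \<bullet> y) = g ((\<Oplus>\<^bsub>K\<^esub>j\<in>{..<m}. rmul (\<gamma> j) x \<rhd> u j) \<bullet> y)"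
    by (simp add: right_expansion_K x)
  also have "\<dots> = (\<Oplus>j\<in>{..<m}. g ((rmul (\<gamma> j) x \<rhd> u j) \<bullet> y))"
    using x y by (intro additive_map_finsum[OF K_ag A_ag gy]) (simp_all add: T_la rC)
  also have "\<dots> = (\<Oplus>j\<in>{..<m}. \<Oplus>i\<in>{..<n}. rmul (\<gamma> j) x \<otimes> (g (u j \<bullet> t i) \<otimes> lmul (\<beta> i) y))"
  proof (intro finsum_eqI)
    fix j assume "j \<in> {..<m}"
    then have j: "j < m" by simp
    have "g (u j \<bullet> y) = g (u j \<bullet> (\<Oplus>\<^bsub>K\<^esub>i\<in>{..<n}. t i \<lhd>\<^sub>A lmul (\<beta> i) y))"
      by (simp add: left_expansion_K y)
    also have "\<dots> = (\<Oplus>i\<in>{..<n}. g (u j \<bullet> (t i \<lhd>\<^sub>A lmul (\<beta> i) y)))"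
      using j y by (intro additive_map_finsum[OF K_ag A_ag gx]) (simp_all add: T_ra)
    also have "\<dots> = (\<Oplus>i\<in>{..<n}. g (u j \<bullet> t i) \<otimes> lmul (\<beta> i) y)"
      using j y by (intro finsum_eqI) (simp_all add: g_ra C_D(1))
    finally have e: "g (u j \<bullet> y) = (\<Oplus>i\<in>{..<n}. g (u j \<bullet> t i) \<otimes> lmul (\<beta> i) y)" .
    have "g ((rmul (\<gamma> j) x \<rhd> u j) \<bullet> y) = rmul (\<gamma> j) x \<otimes> g (u j \<bullet> y)"
      using j y by (simp add: g_la rC)
    also have "\<dots> = (\<Oplus>i\<in>{..<n}. rmul (\<gamma> j) x \<otimes> (g (u j \<bullet> t i) \<otimes> lmul (\<beta> i) y))"
      unfolding e using j y rC[OF j]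
      by (intro additive_map_finsum[OF A_ag A_ag mult_map_left]) (simp_all add: C_D(1))
    finally show "g ((rmul (\<gamma> j) x \<rhd> u j) \<bullet> y) =
      (\<Oplus>i\<in>{..<n}. rmul (\<gamma> j) x \<otimes> (g (u j \<bullet> t i) \<otimes> lmul (\<beta> i) y))" .
    show "(\<Oplus>i\<in>{..<n}. rmul (\<gamma> j) x \<otimes> (g (u j \<bullet> t i) \<otimes> lmul (\<beta> i) y)) \<in> carrier A"
      using j y rC[OF j] by (intro finsum_closed) (auto simp: C_D(1))
  qed
  finally show ?thesis by (simp add: ext_form_def)
qed

lemma ext_form_elt_T:
  "x \<in> T \<Longrightarrow> y \<in> T \<Longrightarrow> a \<in> carrier A \<Longrightarrow> a' \<in> carrier A \<Longrightarrow>
    ext_form (a \<rhd> x) (y \<lhd>\<^sub>A a') = a \<otimes> g (x \<bullet> y) \<otimes> a'"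
  by (simp add: ext_form_la ext_form_ra ext_form_T T_D(1) m_assoc)

text \<open>Testing w on left multiples and v on right multiples of elements of T keeps the outer
  scalars away from c, which stands in the middle; on such tensors the extended form is known
  explicitly.\<close>

lemma middle_ext:
  assumes c: "c \<in> carrier A"
    and H: "\<And>x y a a'. x \<in> T \<Longrightarrow> y \<in> T \<Longrightarrow> a \<in> carrier A \<Longrightarrow> a' \<in> carrier A \<Longrightarrow>
      ext_form ((a \<rhd> x) \<lhd>\<^sub>A c) (y \<lhd>\<^sub>A a') = ext_form (a \<rhd> x) (c \<rhd> (y \<lhd>\<^sub>A a'))"
    and w: "w \<in> carrier AA" and v: "v \<in> carrier AA"
  shows "ext_form (w \<lhd>\<^sub>A c) v = ext_form w (c \<rhd> v)"
proof (rule AT_ext[OF A_ag additive_map_compose[OF ra_map[OF c] ext_form_map_left[OF v]]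
      ext_form_map_left _ w])
  fix x a assume x: "x \<in> T" "a \<in> carrier A"
  show "ext_form ((a \<rhd> x) \<lhd>\<^sub>A c) v = ext_form (a \<rhd> x) (c \<rhd> v)"
    by (rule TA_ext[OF A_ag ext_form_map_right additive_map_compose[OF la_map[OF c] ext_form_map_right] _ v])
      (simp_all add: x c T_D(1) H)
qed (simp add: c v)

text \<open>The only place where the form is compared across a scalar from A, and where A = BR is
  indispensable to the argument: a factor from B passes because elements of T and values of g
  commute with it, a factor from R passes because g is defined on a tensor product over R. A product
  b r is handled by moving r first and then b.\<close>

lemma ext_form_middle:
  assumes "a \<in> carrier A" "w \<in> carrier AA" "v \<in> carrier AA"
  shows "ext_form (w \<lhd>\<^sub>A a) v = ext_form w (a \<rhd> v)"
  using procesi assms(1,2,3)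
proof (induction a arbitrary: w v rule: procesi_induct)
  case zero
  have "w \<lhd>\<^sub>A \<zero> = \<zero>\<^bsub>AA\<^esub>" "\<zero> \<rhd> v = \<zero>\<^bsub>AA\<^esub>"
    using zero additive_map_zero[OF A_ag AA_ag la_add_map] additive_map_zero[OF A_ag AA_ag ra_add_map]
    by blast+
  then show ?case
    using zero additive_map_zero[OF AA_ag A_ag ext_form_map_left]
      additive_map_zero[OF AA_ag A_ag ext_form_map_right] by simp
next
  case (add a a')
  then show ?case
    by (simp add: ra_add la_add additive_mapD(2)[OF ext_form_map_left] additive_mapD(2)[OF ext_form_map_right])
next
  case (mult b r)
  have bA: "b \<in> carrier A" and rA: "r \<in> carrier A" using mult B_sub C_D(1) by auto
  have mb: "ext_form (w \<lhd>\<^sub>A b) v = ext_form w (b \<rhd> v)" if "w \<in> carrier AA" "v \<in> carrier AA" for w v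
  proof (rule middle_ext[OF bA _ that])
    fix x y a a' assume x: "x \<in> T" "y \<in> T" and a: "a \<in> carrier A" "a' \<in> carrier A"
    have "(a \<rhd> x) \<lhd>\<^sub>A b = (a \<otimes> b) \<rhd> x"
      using x a bA T_D(1) T_D(2)[OF x(1) mult(1)] by (simp add: la_ra la_mult)
    moreover have "b \<rhd> (y \<lhd>\<^sub>A a') = y \<lhd>\<^sub>A (b \<otimes> a')"
      using x a bA T_D(1) T_D(2)[OF x(2) mult(1)] by (simp add: la_ra[symmetric] ra_mult)
    \<comment> \<open>After b has passed x on one side and y on the other, it stands directly before
      or after the value of g, which centralizes B.\<close>
    moreover have "a \<otimes> b \<otimes> g (x \<bullet> y) \<otimes> a' = a \<otimes> g (x \<bullet> y) \<otimes> (b \<otimes> a')"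
      using C_D(2)[OF g_C[OF x] mult(1)] g_A[OF x] a bA by (metis m_assoc m_closed)
    ultimately show "ext_form ((a \<rhd> x) \<lhd>\<^sub>A b) (y \<lhd>\<^sub>A a') = ext_form (a \<rhd> x) (b \<rhd> (y \<lhd>\<^sub>A a'))"
      using ext_form_elt_T[OF x, of "a \<otimes> b" a'] ext_form_elt_T[OF x, of a "b \<otimes> a'"] a bA by simp
  qed
  have mr: "ext_form (w \<lhd>\<^sub>A r) v = ext_form w (r \<rhd> v)" if "w \<in> carrier AA" "v \<in> carrier AA" for w v
  proof (rule middle_ext[OF rA _ that])
    fix x y a a' assume x: "x \<in> T" "y \<in> T" and a: "a \<in> carrier A" "a' \<in> carrier A"
    have "(a \<rhd> x) \<lhd>\<^sub>A r = a \<rhd> (x \<lhd>\<^sub>A r)" "r \<rhd> (y \<lhd>\<^sub>A a') = (r \<rhd> y) \<lhd>\<^sub>A a'"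
      using x a rA T_D(1) by (simp_all add: la_ra)
    then show "ext_form ((a \<rhd> x) \<lhd>\<^sub>A r) (y \<lhd>\<^sub>A a') = ext_form (a \<rhd> x) (r \<rhd> (y \<lhd>\<^sub>A a'))"
      using x a mult by (simp add: ext_form_elt_T T_la T_ra tt_balanced)
  qed
  show ?case
    using mult bA rA by (simp add: ra_mult la_mult mb mr)
qed

text \<open>The only candidate: if the form is c^1 f(c^2 d^1) d^2, then its value at 1 \<otimes> 1
  and a \<otimes> 1 is f(a).\<close>

definition middle_form :: "'a \<Rightarrow> 'a"
  where "middle_form a = ext_form (\<one> \<boxtimes> \<one>) (a \<boxtimes> \<one>)"

lemma middle_form_right: "right_linear middle_form"
proof (rule right_linearI)
  show "additive_map A A middle_form"
    unfolding middle_form_def by (rule additive_map_compose[OF elt_map_left ext_form_map_right]) simp_all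
  fix a b assume a: "a \<in> carrier A" "b \<in> B"
  have "(a \<otimes> b) \<boxtimes> \<one> = (a \<boxtimes> \<one>) \<lhd>\<^sub>A b"
    using a by (simp add: elt_balanced ra_elt B_sub)
  then show "middle_form (a \<otimes> b) = middle_form a \<otimes> b"
    using a by (simp add: middle_form_def ext_form_ra B_sub)
qed

text \<open>Right linearity comes from the right argument alone; here b has to go through the middle
  by \<open>ext_form_middle\<close> and then past 1 \<otimes> 1, which commutes with B.\<close>

lemma middle_form_left: "left_linear middle_form"
proof (rule left_linearI)
  show "additive_map A A middle_form" by (rule right_linearD(1)[OF middle_form_right])
  fix a b assume a: "a \<in> carrier A" "b \<in> B"
  have "middle_form (b \<otimes> a) = ext_form ((\<one> \<boxtimes> \<one>) \<lhd>\<^sub>A b) (a \<boxtimes> \<one>)"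
    using a by (simp add: middle_form_def ext_form_middle la_elt B_sub)
  also have "\<dots> = b \<otimes> middle_form a"
    using a one_elt_T[OF a(2)] by (simp add: middle_form_def ext_form_la B_sub flip: one_elt_T)
  finally show "middle_form (b \<otimes> a) = b \<otimes> middle_form a" .
qed

sublocale bilinear_endo A B middle_form
  by unfold_locales (fact middle_form_right middle_form_left)+

text \<open>With p \<otimes> q = p (1 \<otimes> 1) q and x \<otimes> y = (x \<otimes> 1) y, the
  outer scalars p and y leave the form by linearity, and q crosses the middle to give q x.\<close>

lemma ext_form_eq_sandwich:
  assumes w: "w \<in> carrier AA" and v: "v \<in> carrier AA"
  shows "ext_form w v = sandwich middle_form w v"
proof (rule AA_ext[OF A_ag ext_form_map_left[OF v] bil_map_left[OF v] _ w])
  fix p q assume pq: "p \<in> carrier A" "q \<in> carrier A"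
  show "ext_form (p \<boxtimes> q) v = sandwich middle_form (p \<boxtimes> q) v"
  proof (rule AA_ext[OF A_ag ext_form_map_right bil_map_right _ v])
    fix x y assume xy: "x \<in> carrier A" "y \<in> carrier A"
    have "p \<boxtimes> q = p \<rhd> ((\<one> \<boxtimes> \<one>) \<lhd>\<^sub>A q)" "x \<boxtimes> y = (x \<boxtimes> \<one>) \<lhd>\<^sub>A y"
      using pq xy by (simp_all add: la_elt ra_elt)
    then have "ext_form (p \<boxtimes> q) (x \<boxtimes> y) = p \<otimes> (ext_form ((\<one> \<boxtimes> \<one>) \<lhd>\<^sub>A q) (x \<boxtimes> \<one>) \<otimes> y)"
      using pq xy by (simp add: ext_form_la ext_form_ra ext_form_closed m_assoc)
    also have "\<dots> = p \<otimes> (middle_form (q \<otimes> x) \<otimes> y)"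
      using pq xy by (simp add: ext_form_middle la_elt middle_form_def)
    finally show "ext_form (p \<boxtimes> q) (x \<boxtimes> y) = sandwich middle_form (p \<boxtimes> q) (x \<boxtimes> y)"
      using pq xy by (simp add: bil_elt_right fleft_elt m_assoc)
  qed (use pq in simp_all)
qed

lemma g_eq_sandwich: "x \<in> T \<Longrightarrow> y \<in> T \<Longrightarrow> g (x \<bullet> y) = sandwich middle_form x y"
  by (simp add: ext_form_T[symmetric] ext_form_eq_sandwich T_D(1))

end

section \<open>From a Frobenius coring to a Frobenius extension\<close>

context both_quasibases
begin

lemma frobenius_coring_imp_extension:
  assumes procesi: "procesi_extension A B"
    and gen: "summand_of_power \<Z> B_ring (right_regular_module B_ring) (right_regular_module A)"
    and fc: "frobenius_coring C_ring K"
  shows "frobenius_extension A B"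
proof -
  obtain g e where g_hom: "g \<in> bimodule_hom C_ring C_ring TT (regular_bimodule C_ring)"
    and e: "e \<in> invariants C K"
    and ge: "\<And>c. c \<in> T \<Longrightarrow> g (c \<bullet> e) = lmul (\<lambda>x. x) c \<and> lmul (\<lambda>x. x) c = g (e \<bullet> c)"
    and fr: "\<And>c d. c \<in> T \<Longrightarrow> d \<in> T \<Longrightarrow>
      tensor_lift K (\<lambda>x y. g (c \<bullet> x) \<rhd> y) (\<Delta> d) = tensor_lift K (\<lambda>x y. x \<lhd>\<^sub>A g (y \<bullet> d)) (\<Delta> c)"
    using fc unfolding frobenius_coring_def K_simps C_ring_carrier by blast
  interpret extended_form A B n t \<beta> m u \<gamma> g
    by unfold_locales (fact g_hom procesi)+
  let ?f = middle_form
  \<comment> \<open>The Frobenius condition of the coring is known for c and d in T only. Both sides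
    are left A-linear in c and right A-linear in d, so it extends to the whole tensor
    square.\<close>
  have lr: "bil_l c d = bil_r c d" if c: "c \<in> carrier AA" and d: "d \<in> carrier AA" for c d
  proof (rule AT_ext[OF AA_ag bil_l_map_left[OF d] bil_r_map_left[OF d] _ c])
    fix x a assume x: "x \<in> T" "a \<in> carrier A"
    show "bil_l (a \<rhd> x) d = bil_r (a \<rhd> x) d"
    proof (rule TA_ext[OF AA_ag bil_l_map_right bil_r_map_right _ d])
      fix y a' assume y: "y \<in> T" "a' \<in> carrier A"
      have "bil_l x y = bil_r x y"
        using frobenius_condition[OF middle_form_right middle_form_left g_hom g_eq_sandwich x(1) y(1)]
          fr[OF x(1) y(1)] by simp
      then show "bil_l (a \<rhd> x) (y \<lhd>\<^sub>A a') = bil_r (a \<rhd> x) (y \<lhd>\<^sub>A a')"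
        using x y by (simp add: bil_l_la bil_l_ra bil_r_la bil_r_ra T_D(1))
    qed (use x T_D(1) in simp_all)
  qed
  have fB: "?f a \<in> B" if a: "a \<in> carrier A" for a
  proof (rule generator_descent[OF gen])
    show "?f a \<in> carrier A" using a by simp
    \<comment> \<open>The extended condition at c = 1 \<otimes> 1 and d = a \<otimes> 1, two tensors
      that need not both lie in T; this is what the extension beyond T is for.\<close>
    show "?f a \<boxtimes> \<one> = \<one> \<boxtimes> ?f a"
      using lr[of "\<one> \<boxtimes> \<one>" "a \<boxtimes> \<one>"] a
      by (simp add: bil_l_elt_right bil_r_elt_left fleft_elt fright_elt)
  qed
  have f_hom: "?f \<in> bimodule_hom B_ring B_ring Reg (regular_bimodule B_ring)"
    using fB f_add f_B_left f_B_right
    by (intro bimodule_homI additive_mapI) (simp_all add: regular_bimodule_def)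
  have eT: "e \<in> T" and e_C: "\<And>r. r \<in> C \<Longrightarrow> r \<rhd> e = e \<lhd>\<^sub>A r"
    using e by (auto simp: invariants_def)
  note eAA = T_D(1)[OF eT]
  \<comment> \<open>The coring provides commutation with the centralizer, and e commutes with B as
    an element of T. A Frobenius element must commute with all of A, which the induction over sums
    of products b r supplies.\<close>
  have "a \<rhd> e = e \<lhd>\<^sub>A a" if "a \<in> carrier A" for a
    using procesi that
  proof (induction a rule: procesi_induct)
    case zero
    show ?case
      using additive_map_zero[OF A_ag AA_ag la_add_map[OF eAA]] additive_map_zero[OF A_ag AA_ag ra_add_map[OF eAA]]
      by simp
  next
    case (mult b r)
    then have "(b \<otimes> r) \<rhd> e = b \<rhd> (e \<lhd>\<^sub>A r)"
      using eAA by (simp add: la_mult B_sub C_D(1) e_C)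
    also have "\<dots> = e \<lhd>\<^sub>A (b \<otimes> r)"
      using mult eAA T_D(2)[OF eT mult(1)] by (simp add: la_ra[symmetric] ra_mult B_sub C_D(1))
    finally show ?case .
  next
    case (add x y)
    then show ?case using eAA by (simp add: la_add ra_add)
  qed
  then have e_inv: "e \<in> invariants (carrier A) AA"
    using eAA by (simp add: invariants_def)
  \<comment> \<open>The counit identities also have to leave T. Right multiples of T suit the second
    argument of the form, and left multiples suit the first one in \<open>er\<close>.\<close>
  have el: "bil e c = lmul (\<lambda>x. x) c" if c: "c \<in> carrier AA" for c
    by (rule TA_ext[OF A_ag bil_map_right[OF eAA] lmul_map[OF right_linear_id] _ c])
      (use ge eT in \<open>simp_all add: bil_ra lmul_ra right_linear_id eAA T_D(1) g_eq_sandwich\<close>)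
  have er: "bil c e = lmul (\<lambda>x. x) c" if c: "c \<in> carrier AA" for c
    by (rule AT_ext[OF A_ag bil_map_left[OF eAA] lmul_map[OF right_linear_id] _ c])
      (use ge eT in \<open>simp_all add: bil_la rmul_la left_linear_id eAA T_D(1) g_eq_sandwich counit_eq_rmul\<close>)
  show ?thesis
    unfolding frobenius_extension_def
  proof (intro bexI[OF _ f_hom] bexI[OF _ e_inv] ballI conjI)
    fix a assume a: "a \<in> carrier A"
    \<comment> \<open>Evaluating the extended counit identities at a \<otimes> 1, and below at 1
      \<otimes> a, makes the outer leg trivial and leaves the two dual basis identities.\<close>
    have "fleft ?f e a = a"
      using el[of "a \<boxtimes> \<one>"] a eAA by (simp add: bil_elt_right lmul_elt right_linear_id fleft_closed)
    then show "a = tensor_lift A (\<lambda>x y. x \<otimes> ?f (y \<otimes> a)) e"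
      by (simp add: fleft_def rmul_def)
    have "fright ?f e a = a"
      using er[of "\<one> \<boxtimes> a"] a eAA by (simp add: bil_elt_left lmul_elt right_linear_id fright_closed)
    then show "a = tensor_lift A (\<lambda>x y. ?f (a \<otimes> x) \<otimes> y) e"
      by (simp add: fright_def lmul_def)
  qed
qed

end

theorem proposition3p6:
  fixes A :: "('a, 'x) ring_scheme" and B :: "'a set"
  assumes "ring A" and "subring B A"
    and "depth_two A B"
    and "right_progenerator (subring_of A B) (right_regular_module A)"
    and "procesi_extension A B"
  shows "frobenius_extension A B \<longleftrightarrow>
    frobenius_coring (centralizer_ring A B) (T_coring A B)"
proof -
  interpret ring_extension A B
    using assms(1,2) by (simp add: ring_extension_def ring_extension_axioms_def)
  \<comment> \<open>The triple that \<open>T_coprod\<close> selects is named before it is known to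
    be a quasibase; depth two then shows that it is one.\<close>
  obtain n t \<beta> where some: "(SOME (n, t, \<beta>). D2_quasibase A B n t \<beta>) = (n, t, \<beta>)"
    by (metis prod_cases3)
  have "\<exists>q. case q of (n, t, \<beta>) \<Rightarrow> D2_quasibase A B n t \<beta>"
    using left_quasibase_exists[OF assms(3)] by auto
  from someI_ex[OF this] have "D2_quasibase A B n t \<beta>"
    unfolding some by simp
  moreover obtain m u \<gamma> where "right_quasibase m u \<gamma>"
    using right_quasibase_exists[OF assms(3)] by blast
  ultimately interpret both_quasibases A B n t \<beta> m u \<gamma>
    using some by unfold_locales
  show ?thesis
    using frobenius_extension_imp_coring frobenius_coring_imp_extension[OF assms(5)] assms(4)
    unfolding right_progenerator_def by blast
qed

end
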